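(* Every $(\text{co-gem}, K_4)$-free graph is $4$-colourable.
   Context: All graphs are finite and simple. A graph is $k$-colourable if its vertices can be assigned colours from $\{1,\dots,k\}$ so that adjacent vertices receive different colours. $P_n$ denotes the path on $n$ vertices, $K_n$ the complete graph on $n$ vertices, and $G+H$ the disjoint union of graphs $G$ and $H$. The co-gem is the graph $P_4+P_1$. A graph is $(H_1,\dots,H_m)$-free if none of $H_1,\dots,H_m$ is isomorphic to an induced subgraph of it. *)

theory Defs
  imports "Graph_Theory.Graph_Theory"
begin

text \<open>
  Finite simple graphs are rendered by the locale \<open>graph\<close>: finite symmetric digraphs without
  loops and without parallel arcs. Each undirected edge is thus a pair of opposite arcs.
  The null graph is allowed.
\<close>

definition colourable :: "nat \<Rightarrow> ('a, 'b) pre_digraph \<Rightarrow> bool" where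
  "colourable k G \<longleftrightarrow>
     (\<exists>c :: 'a \<Rightarrow> nat. c ` verts G \<subseteq> {1..k} \<and> (\<forall>u v. u \<rightarrow>\<^bsub>G\<^esub> v \<longrightarrow> c u \<noteq> c v))"

definition path_graph :: "nat \<Rightarrow> nat pair_pre_digraph" where
  "path_graph n = \<lparr> pverts = {..<n},
     parcs = {(i, j). i < n \<and> j < n \<and> (j = Suc i \<or> i = Suc j)} \<rparr>"

definition complete_graph :: "nat \<Rightarrow> nat pair_pre_digraph" where
  "complete_graph n = \<lparr> pverts = {..<n}, parcs = {(i, j). i < n \<and> j < n \<and> i \<noteq> j} \<rparr>"

definition disjoint_graph_union ::
  "'a pair_pre_digraph \<Rightarrow> 'b pair_pre_digraph \<Rightarrow> ('a + 'b) pair_pre_digraph" where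
  "disjoint_graph_union G H = \<lparr> pverts = Inl ` pverts G \<union> Inr ` pverts H,
     parcs = map_prod Inl Inl ` parcs G \<union> map_prod Inr Inr ` parcs H \<rparr>"

definition co_gem :: "(nat + nat) pair_pre_digraph" where
  "co_gem = disjoint_graph_union (path_graph 4) (path_graph 1)"

text \<open>
  Freeness is a binary relation, since the forbidden graphs may have different vertex types;
  being free of several graphs is the conjunction.
\<close>

definition free_of :: "('a, 'b) pre_digraph \<Rightarrow> 'c pair_pre_digraph \<Rightarrow> bool" where
  "free_of G H \<longleftrightarrow> \<not> (\<exists>H'. induced_subgraph H' G \<and> digraph_iso (with_proj H) H')"

lemma pair_graph_path_graph: "pair_graph (path_graph n)"
proof -
  have "finite {(i, j). i < n \<and> j < n \<and> (j = Suc i \<or> i = Suc j)}"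
    by (rule finite_subset[of _ "{..<n} \<times> {..<n}"]) auto
  then show ?thesis
    by unfold_locales (auto simp: path_graph_def symmetric_def intro!: symI)
qed

lemma complete_digraph_complete_graph: "complete_digraph n (with_proj (complete_graph n))"
  unfolding complete_digraph_pair_def by (auto simp: complete_graph_def)

lemma pair_graph_disjoint_graph_union:
  assumes "pair_graph G" "pair_graph H"
  shows "pair_graph (disjoint_graph_union G H)"
proof -
  interpret G: pair_graph G by fact
  interpret H: pair_graph H by fact
  have "sym (parcs G)" "sym (parcs H)"
    using G.pair_sym_arcs H.pair_sym_arcs by (simp_all add: symmetric_def)
  then have "sym (parcs (disjoint_graph_union G H))"
    by (fastforce simp: disjoint_graph_union_def sym_def map_prod_def image_iff split: prod.splits)
  then show ?thesis
    by unfold_locales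
      (auto simp: disjoint_graph_union_def symmetric_def
        dest: G.in_arcsD1 G.in_arcsD2 H.in_arcsD1 H.in_arcsD2 G.adj_not_same H.adj_not_same)
qed

lemma pair_graph_co_gem: "pair_graph co_gem"
  unfolding co_gem_def by (intro pair_graph_disjoint_graph_union pair_graph_path_graph)

text \<open>
  Characterisation by vertex embeddings, for graphs without parallel arcs.
\<close>

lemma not_free_of_iff:
  assumes "nomulti_digraph G" "pair_wf_digraph H"
  shows "\<not> free_of G H \<longleftrightarrow>
    (\<exists>f. inj_on f (pverts H) \<and> f ` pverts H \<subseteq> verts G \<and>
      (\<forall>u \<in> pverts H. \<forall>v \<in> pverts H. (u, v) \<in> parcs H \<longleftrightarrow> f u \<rightarrow>\<^bsub>G\<^esub> f v))"
    (is "?L \<longleftrightarrow> ?R")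
proof
  interpret G: nomulti_digraph G by fact
  interpret H: pair_wf_digraph H by fact
  assume ?L
  then obtain h where ind: "induced_subgraph (app_iso h (with_proj H)) G"
    and iso: "pre_digraph.digraph_isomorphism (with_proj H) h"
    by (auto simp: free_of_def digraph_iso_def)
  let ?f = "iso_verts h" and ?g = "iso_arcs h"
  have tl: "iso_tail h = tail G" "iso_head h = head G"
    and vs: "?f ` pverts H \<subseteq> verts G"
    and arcs: "?g ` parcs H = {e \<in> arcs G. tail G e \<in> ?f ` pverts H \<and> head G e \<in> ?f ` pverts H}"
    using ind by (auto simp: induced_subgraph_def subgraph_def compatible_def)
  have inj: "inj_on ?f (pverts H)"
    and ht: "\<And>a. a \<in> parcs H \<Longrightarrow> ?f (fst a) = tail G (?g a) \<and> ?f (snd a) = head G (?g a)"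
    using iso by (auto simp: pre_digraph.digraph_isomorphism_def tl)
  have "(u, v) \<in> parcs H \<longleftrightarrow> ?f u \<rightarrow>\<^bsub>G\<^esub> ?f v" if uv: "u \<in> pverts H" "v \<in> pverts H" for u v
  proof
    assume a: "(u, v) \<in> parcs H"
    then have "?g (u, v) \<in> arcs G" using arcs by blast
    with ht[OF a] show "?f u \<rightarrow>\<^bsub>G\<^esub> ?f v" by (auto simp: arcs_ends_conv image_iff)
  next
    assume "?f u \<rightarrow>\<^bsub>G\<^esub> ?f v"
    then obtain e where e: "e \<in> arcs G" "tail G e = ?f u" "head G e = ?f v" by auto
    with uv have "e \<in> ?g ` parcs H" unfolding arcs by blast
    then obtain a where a: "a \<in> parcs H" "e = ?g a" by auto
    with ht[OF a(1)] e have "?f (fst a) = ?f u" "?f (snd a) = ?f v" by auto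
    with a uv inj have "fst a = u" "snd a = v"
      by (auto dest: inj_onD H.arc_fst_in_verts H.arc_snd_in_verts)
    with a show "(u, v) \<in> parcs H" by (cases a) auto
  qed
  with inj vs show ?R by blast
next
  interpret G: nomulti_digraph G by fact
  interpret H: pair_wf_digraph H by fact
  assume ?R
  then obtain f where inj: "inj_on f (pverts H)" and vs: "f ` pverts H \<subseteq> verts G"
    and adj: "\<And>u v. u \<in> pverts H \<Longrightarrow> v \<in> pverts H \<Longrightarrow> (u, v) \<in> parcs H \<longleftrightarrow> f u \<rightarrow>\<^bsub>G\<^esub> f v"
    by blast
  define g where "g a = (SOME e. e \<in> arcs G \<and> tail G e = f (fst a) \<and> head G e = f (snd a))" for a
  have g: "g a \<in> arcs G \<and> tail G (g a) = f (fst a) \<and> head G (g a) = f (snd a)"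
    if "a \<in> parcs H" for a
  proof -
    have "f (fst a) \<rightarrow>\<^bsub>G\<^esub> f (snd a)"
      using adj[of "fst a" "snd a"] that H.arc_fst_in_verts H.arc_snd_in_verts by simp
    then have "\<exists>e. e \<in> arcs G \<and> tail G e = f (fst a) \<and> head G e = f (snd a)" by blast
    then show ?thesis unfolding g_def by (rule someI_ex)
  qed
  define h where "h = \<lparr> iso_verts = f, iso_arcs = g, iso_head = head G, iso_tail = tail G \<rparr>"
  have inj_g: "inj_on g (parcs H)"
  proof (rule inj_onI)
    fix a b assume ab: "a \<in> parcs H" "b \<in> parcs H" "g a = g b"
    with g[of a] g[of b] have "f (fst a) = f (fst b)" "f (snd a) = f (snd b)" by auto
    with ab inj show "a = b"
      by (auto intro!: prod_eqI dest: inj_onD H.arc_fst_in_verts H.arc_snd_in_verts)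
  qed
  have iso: "pre_digraph.digraph_isomorphism (with_proj H) h"
    using inj inj_g g H.wf_digraph by (auto simp: pre_digraph.digraph_isomorphism_def h_def)
  have "wf_digraph (app_iso h (with_proj H))"
    using g by unfold_locales (auto simp: h_def dest: H.in_arcsD1 H.in_arcsD2)
  moreover have "e \<in> g ` parcs H"
    if e: "e \<in> arcs G" "tail G e \<in> f ` pverts H" "head G e \<in> f ` pverts H" for e
  proof -
    from e obtain u v where uv: "u \<in> pverts H" "v \<in> pverts H" "tail G e = f u" "head G e = f v"
      by auto
    with e have "f u \<rightarrow>\<^bsub>G\<^esub> f v" by (force simp: arcs_ends_conv)
    with adj uv have a: "(u, v) \<in> parcs H" by simp
    with g[OF a] e uv have "g (u, v) = e" by (auto intro!: G.no_multi_arcs simp: arc_to_ends_def)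
    with a show ?thesis by blast
  qed
  ultimately have "induced_subgraph (app_iso h (with_proj H)) G"
    using vs g G.wf_digraph
    by (auto simp: induced_subgraph_def subgraph_def compatible_def h_def dest: H.in_arcsD1 H.in_arcsD2)
  with iso show ?L by (auto simp: free_of_def digraph_iso_def)
qed

end

theory Submission
  imports Defs
begin

text \<open>
  We work in the complement \<open>H\<close> of the graph: it has no induced gem and no independent set of size
  four, and the claim is that its vertices are covered by four cliques. Suppose not, and take a minimal
  counterexample. Neighbourhoods in \<open>H\<close> are \<open>P\<^sub>4\<close>-free, hence perfect cographs, and minimality forces
  the neighbourhood of every vertex to be disconnected: a connected one would be a join, and as there
  are no homogeneous sets the parts of the join would be separated by distant vertices, which yields a
  cover.

  If \<open>H\<close> contains a diamond with middle edge \<open>u d\<close> and nonadjacent tips \<open>p\<close>, \<open>q\<close>, then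
  there is no induced 4-wheel, and the diamond extends to a core: cliques \<open>Z\<close>, \<open>P\<close>, \<open>Q\<close> with
  \<open>u\<close>, \<open>d\<close> in \<open>Z\<close>, \<open>p\<close> in \<open>P\<close>, \<open>q\<close> in \<open>Q\<close>, where \<open>Z\<close> is complete to \<open>P\<close> and \<open>Q\<close>, these are
  anticomplete to each other, and every vertex of \<open>Z\<close> has private neighbours outside. All private
  neighbours together form a clique, every remaining vertex is complete to it or to \<open>P\<close> or to \<open>Q\<close>, and
  four cliques can be arranged around the core. So \<open>H\<close> is diamond-free, every neighbourhood is a disjoint
  union of two or three cliques, and the two cases are finished by hand: with two cliques the
  nonneighbours form two cliques or a pentagon, with three the graph turns out to be cubic and
  triangle-free.
\<close>

section \<open>P4-free relations\<close>

text \<open>Perfection covers any neighbourhood by three cliques, so the difficulty is to reach the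
  nonneighbours with only one clique more. Independence number three is mostly applied in local
  forms: the common nonneighbours of a nonadjacent pair form a clique, and the nonneighbours of a
  vertex contain no independent triple. This is also why disconnected neighbourhoods are worth the
  effort: a union of components that omits some vertex \<open>w\<close> of the neighbourhood has no
  independent triple, as \<open>w\<close> would be the fourth vertex, and perfection then covers it
  by two cliques. Deleting vertices from the minimal counterexample serves two purposes only, to
  exclude dominated vertices and homogeneous sets. The later contradictions are explicit covers or
  forbidden configurations; often the failure of an attempted cover supplies the vertices of the
  next gem or diamond.\<close>

definition decomposable :: "('a \<Rightarrow> 'a \<Rightarrow> bool) \<Rightarrow> 'a set \<Rightarrow> bool" where
  "decomposable R N \<longleftrightarrow> (\<exists>X Y. X \<noteq> {} \<and> Y \<noteq> {} \<and> X \<inter> Y = {} \<and> X \<union> Y = N \<and>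
    ((\<forall>x\<in>X. \<forall>y\<in>Y. R x y) \<or> (\<forall>x\<in>X. \<forall>y\<in>Y. \<not> R x y)))"

lemma decomposableI:
  assumes "X \<noteq> {}" "X \<subset> N" "(\<forall>x\<in>X. \<forall>y\<in>N - X. R x y) \<or> (\<forall>x\<in>X. \<forall>y\<in>N - X. \<not> R x y)"
  shows "decomposable R N"
  unfolding decomposable_def using assms by (intro exI[of _ X] exI[of _ "N - X"]) auto

lemma decomposableE:
  assumes "decomposable R N"
  obtains X Y where "X \<noteq> {}" "Y \<noteq> {}" "X \<inter> Y = {}" "X \<union> Y = N"
    "(\<forall>x\<in>X. \<forall>y\<in>Y. R x y) \<or> (\<forall>x\<in>X. \<forall>y\<in>Y. \<not> R x y)"
  using assms unfolding decomposable_def by metis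

lemma decomposable_complement: "decomposable (\<lambda>x y. \<not> R x y) N \<longleftrightarrow> decomposable R N"
  unfolding decomposable_def by (simp add: disj_commute)

text \<open>The inductive step for the classical fact that a \<open>P4\<close>-free graph or its
  complement is disconnected. In the main case \<open>x\<close> has neighbours on both sides but
  misses some \<open>w\<close>; then the nonneighbours of \<open>x\<close> on the side of
  \<open>w\<close> split off.\<close>

lemma decomposable_insert:
  assumes S: "\<And>x y. S x y \<Longrightarrow> S y x" and x: "x \<notin> N"
    and P4: "\<And>a b c d. \<lbrakk>{a, b, c, d} \<subseteq> insert x N; distinct [a, b, c, d]; S a b; S b c; S c d\<rbrakk>
      \<Longrightarrow> S a c \<or> S a d \<or> S b d"
    and XY: "X \<noteq> {}" "Y \<noteq> {}" "X \<inter> Y = {}" "X \<union> Y = N" "\<forall>x\<in>X. \<forall>y\<in>Y. \<not> S x y"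
  shows "decomposable S (insert x N)"
proof -
  have *: "decomposable S (insert x N)"
    if AB: "A \<inter> B = {}" "A \<union> B = N" "\<forall>a\<in>A. \<forall>b\<in>B. \<not> S a b"
      and w: "w \<in> A" "\<not> S x w" and t: "t \<in> B" "S x t" for A B w t
  proof (rule decomposableI)
    let ?A = "{w\<in>A. \<not> S x w}"
    \<comment> \<open>Such an edge would make \<open>t\<close>, \<open>x\<close>, \<open>u\<close>,
      \<open>w'\<close> an induced path, as \<open>t\<close> lies on the other side.\<close>
    have "\<not> S w' u" if "w' \<in> ?A" "u \<in> A" "S x u" for u w'
    proof
      assume "S w' u"
      then have "S u w'" by (rule S)
      have "{t, x, u, w'} \<subseteq> insert x N" using that t AB by auto
      moreover have "distinct [t, x, u, w']" using that t AB x by auto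
      moreover have "S t x" using t S by blast
      ultimately have "S t u \<or> S t w' \<or> S x w'" using P4 that \<open>S u w'\<close> by blast
      then show False using that t AB S by blast
    qed
    then have "\<forall>a\<in>?A. \<forall>b\<in>insert x N - ?A. \<not> S a b" using AB S by blast
    then show "(\<forall>a\<in>?A. \<forall>b\<in>insert x N - ?A. S a b) \<or> (\<forall>a\<in>?A. \<forall>b\<in>insert x N - ?A. \<not> S a b)" ..
    show "?A \<noteq> {}" using w by auto
    show "?A \<subset> insert x N" using x AB by auto
  qed
  show ?thesis
  proof (cases "\<forall>y\<in>N. S x y")
    case True
    then show ?thesis using x XY by (intro decomposableI[of "{x}"]) auto
  next
    case False
    then obtain w where w: "\<not> S x w" "w \<in> X \<or> w \<in> Y" using XY by auto
    consider "\<forall>t\<in>X. \<not> S x t" | "\<forall>t\<in>Y. \<not> S x t" | t u where "t \<in> X" "S x t" "u \<in> Y" "S x u" by blast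
    then show ?thesis
    proof cases
      case 1 then show ?thesis using XY x S by (intro decomposableI[of X]) blast+
    next
      case 2 then show ?thesis using XY x S by (intro decomposableI[of Y]) blast+
    next
      case 3
      from w(2) show ?thesis
      proof
        assume "w \<in> X" then show ?thesis using *[of X Y w u] 3 XY w by blast
      next
        assume "w \<in> Y"
        moreover have "\<forall>a\<in>Y. \<forall>b\<in>X. \<not> S a b" using XY S by blast
        ultimately show ?thesis using *[of Y X w t] 3 XY w by (metis Int_commute Un_commute)
      qed
    qed
  qed
qed

text \<open>Induction on the vertex set. Both \<open>P4\<close> and the conclusion are invariant
  under complementation, so it suffices to extend a partition without crossing pairs.\<close>

lemma P4_free_decomposable:
  fixes R :: "'a \<Rightarrow> 'a \<Rightarrow> bool"
  assumes "finite N" "N \<noteq> {}" "\<not> is_singleton N" and sym: "\<And>x y. R x y \<Longrightarrow> R y x"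
    and "\<And>a b c d. \<lbrakk>{a, b, c, d} \<subseteq> N; distinct [a, b, c, d]; R a b; R b c; R c d\<rbrakk> \<Longrightarrow> R a c \<or> R a d \<or> R b d"
  shows "decomposable R N"
  using assms(1-3,5)
proof (induction N rule: finite_induct)
  case empty
  then show ?case by simp
next
  case (insert x N)
  note P4 = insert.prems(3)
  consider "is_singleton N" | "\<not> is_singleton N" by blast
  then show ?case
  proof cases
    case 1
    then obtain y where "N = {y}" by (auto simp: is_singleton_def)
    then show ?thesis using insert.hyps by (intro decomposableI[of "{x}"]) auto
  next
    case 2
    have "N \<noteq> {}" using insert.prems by (auto simp: is_singleton_def)
    moreover have "\<And>a b c d. \<lbrakk>{a, b, c, d} \<subseteq> N; distinct [a, b, c, d]; R a b; R b c; R c d\<rbrakk> \<Longrightarrow> R a c \<or> R a d \<or> R b d"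
      using P4 by (meson subset_insertI2)
    ultimately have "decomposable R N" using insert.IH 2 by blast
    then obtain X Y where XY: "X \<noteq> {}" "Y \<noteq> {}" "X \<inter> Y = {}" "X \<union> Y = N"
      "(\<forall>x\<in>X. \<forall>y\<in>Y. R x y) \<or> (\<forall>x\<in>X. \<forall>y\<in>Y. \<not> R x y)"
      by (rule decomposableE)
    from XY(5) show ?thesis
    proof
      assume "\<forall>x\<in>X. \<forall>y\<in>Y. \<not> R x y"
      then show ?thesis using decomposable_insert[of R x N X Y, OF sym insert.hyps(2) P4 XY(1-4)] by blast
    next
      assume *: "\<forall>x\<in>X. \<forall>y\<in>Y. R x y"
      have "\<not> R a c \<or> \<not> R a d \<or> \<not> R b d"
        if "{a, b, c, d} \<subseteq> insert x N" "distinct [a, b, c, d]" "\<not> R a b" "\<not> R b c" "\<not> R c d" for a b c d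
      proof (rule ccontr)
        assume "\<not> ?thesis"
        \<comment> \<open>The complement of the path \<open>a b c d\<close> is the path
          \<open>c a d b\<close>.\<close>
        then have "R c a" "R a d" "R d b" using sym by auto
        moreover have "{c, a, d, b} \<subseteq> insert x N" "distinct [c, a, d, b]" using that by auto
        ultimately have "R c d \<or> R c b \<or> R a b" by (intro P4)
        then show False using that sym[of c b] by blast
      qed
      then have "decomposable (\<lambda>x y. \<not> R x y) (insert x N)"
        using * sym by (intro decomposable_insert[of "\<lambda>x y. \<not> R x y" x N X Y, OF _ insert.hyps(2) _ XY(1-4)]) auto
      then show ?thesis by (simp add: decomposable_complement)
    qed
  qed
qed

section \<open>Perfection of P4-free relations\<close>

definition P4_free :: "('a \<Rightarrow> 'a \<Rightarrow> bool) \<Rightarrow> 'a set \<Rightarrow> bool" where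
  "P4_free R N \<longleftrightarrow> (\<forall>a\<in>N. \<forall>b\<in>N. \<forall>c\<in>N. \<forall>d\<in>N. R a b \<longrightarrow> R b c \<longrightarrow> R c d \<longrightarrow> R a c \<or> R a d \<or> R b d)"

lemma P4_free_subset: "P4_free R N \<Longrightarrow> U \<subseteq> N \<Longrightarrow> P4_free R U"
  unfolding P4_free_def by (meson subsetD)

lemma P4_freeD:
  "\<lbrakk>P4_free R N; a \<in> N; b \<in> N; c \<in> N; d \<in> N; R a b; R b c; R c d\<rbrakk> \<Longrightarrow> R a c \<or> R a d \<or> R b d"
  unfolding P4_free_def by simp

text \<open>The map \<open>f\<close> labels the cliques of a cover by elements of the independent
  set \<open>I\<close>, so that at most \<open>card I\<close> cliques occur: a certificate that
  clique cover number and independence number agree. It may move the elements of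
  \<open>I\<close>.\<close>

definition transversal_cover :: "('a \<Rightarrow> 'a \<Rightarrow> bool) \<Rightarrow> 'a set \<Rightarrow> 'a set \<Rightarrow> ('a \<Rightarrow> 'a) \<Rightarrow> bool" where
  "transversal_cover R N I f \<longleftrightarrow> I \<subseteq> N \<and> (\<forall>x\<in>I. \<forall>y\<in>I. R x y \<longrightarrow> x = y) \<and> f ` N \<subseteq> I \<and>
    (\<forall>x\<in>N. \<forall>y\<in>N. f x = f y \<longrightarrow> R x y)"

text \<open>In a join, a clique of one side and a clique of the other merge into one, so an
  injection of \<open>J\<close> into \<open>I\<close> absorbs the smaller family.\<close>

lemma transversal_cover_join:
  assumes sym: "\<And>x y. R x y \<Longrightarrow> R y x" and fin: "finite X" "finite Y"
    and c: "\<forall>x\<in>X. \<forall>y\<in>Y. R x y" and I: "transversal_cover R X I f"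
    and J: "transversal_cover R Y J g" and le: "card J \<le> card I"
  shows "\<exists>f. transversal_cover R (X \<union> Y) I f"
proof -
  have "finite I" "finite J" using I J fin by (auto simp: transversal_cover_def intro: finite_subset)
  then obtain h where h: "h ` J \<subseteq> I" "inj_on h J" using card_le_inj[OF _ _ le] by blast
  let ?f = "\<lambda>x. if x \<in> X then f x else h (g x)"
  have g: "g x \<in> J" if "x \<in> Y" for x using J that by (auto simp: transversal_cover_def)
  have "R x y" if xy: "x \<in> X \<union> Y" "y \<in> X \<union> Y" "?f x = ?f y" for x y
  proof -
    consider "x \<in> X" "y \<in> X" | "x \<in> X" "y \<in> Y" | "y \<in> X" "x \<in> Y" | "x \<notin> X" "y \<notin> X" "x \<in> Y" "y \<in> Y"
      using xy(1,2) by blast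
    then show ?thesis
    proof cases
      case 4
      then have "g x = g y" using xy(3) h(2) g by (simp add: inj_on_eq_iff)
      with 4 J show ?thesis by (simp add: transversal_cover_def)
    qed (use xy(3) c I sym in \<open>simp_all add: transversal_cover_def\<close>)
  qed
  moreover have "?f ` (X \<union> Y) \<subseteq> I" using I h g by (auto simp: transversal_cover_def)
  ultimately show ?thesis using I by (intro exI[of _ ?f]) (auto simp: transversal_cover_def)
qed

lemma transversal_cover_union:
  assumes sym: "\<And>x y. R x y \<Longrightarrow> R y x" and "X \<inter> Y = {}"
    and c: "\<forall>x\<in>X. \<forall>y\<in>Y. \<not> R x y" and I: "transversal_cover R X I f"
    and J: "transversal_cover R Y J g"
  shows "transversal_cover R (X \<union> Y) (I \<union> J) (\<lambda>x. if x \<in> X then f x else g x)" (is "transversal_cover R _ _ ?f")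
proof -
  have IJ: "I \<subseteq> X" "J \<subseteq> Y" "\<And>x. x \<in> X \<Longrightarrow> f x \<in> I" "\<And>x. x \<in> Y \<Longrightarrow> g x \<in> J"
    using I J by (auto simp: transversal_cover_def)
  have "R x y" if xy: "x \<in> X \<union> Y" "y \<in> X \<union> Y" "?f x = ?f y" for x y
  proof -
    consider "x \<in> X" "y \<in> X" | "x \<in> X" "y \<in> Y" "y \<notin> X" | "y \<in> X" "x \<in> Y" "x \<notin> X" | "x \<notin> X" "y \<notin> X" "x \<in> Y" "y \<in> Y"
      using xy(1,2) by blast
    then show ?thesis
    proof cases
      case 2
      then have "f x = g y" using xy(3) by simp
      then show ?thesis using IJ(1,2) IJ(3)[of x] IJ(4)[of y] 2 assms(2) by auto
    next
      case 3
      then have "g x = f y" using xy(3) by simp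
      then show ?thesis using IJ(1,2) IJ(3)[of y] IJ(4)[of x] 3 assms(2) by auto
    qed (use xy(3) I J in \<open>simp_all add: transversal_cover_def\<close>)
  qed
  moreover have "?f ` (X \<union> Y) \<subseteq> I \<union> J" using IJ by auto
  moreover have "x = y" if "x \<in> I \<union> J" "y \<in> I \<union> J" "R x y" for x y
  proof -
    have "\<not> (x \<in> I \<and> y \<in> J)" "\<not> (x \<in> J \<and> y \<in> I)" using that c IJ sym[of x y] by auto
    then have "x \<in> I \<and> y \<in> I \<or> x \<in> J \<and> y \<in> J" using that by blast
    then show ?thesis using I J that(3) by (auto simp: transversal_cover_def)
  qed
  ultimately show ?thesis using IJ(1,2) unfolding transversal_cover_def
    by (intro conjI ballI impI Un_mono)
qed

text \<open>Follows the cograph decomposition: joins merge the cliques of the two sides, disjoint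
  unions add up both the cliques and the independent sets.\<close>

lemma P4_free_transversal_cover:
  assumes "finite N" and sym: "\<And>x y. R x y \<Longrightarrow> R y x" and "\<forall>x\<in>N. R x x" and "P4_free R N"
  shows "\<exists>I f. transversal_cover R N I f"
  using assms(1,3,4)
proof (induction N rule: finite_psubset_induct)
  case (psubset N)
  show ?case
  proof (cases "N = {} \<or> is_singleton N")
    case True
    then have "transversal_cover R N N id"
      using psubset.prems(1) by (auto simp: is_singleton_def transversal_cover_def)
    then show ?thesis by blast
  next
    case False
    then have "decomposable R N"
      using psubset.hyps(1) sym P4_freeD[OF psubset.prems(2)] by (intro P4_free_decomposable) auto
    then obtain X Y where XY: "X \<noteq> {}" "Y \<noteq> {}" "X \<inter> Y = {}" "X \<union> Y = N"
      and split: "(\<forall>x\<in>X. \<forall>y\<in>Y. R x y) \<or> (\<forall>x\<in>X. \<forall>y\<in>Y. \<not> R x y)"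
      by (rule decomposableE)
    have IH: "\<exists>I f. transversal_cover R U I f" if "U \<subset> N" for U
      using psubset.IH[OF that] psubset.prems P4_free_subset that by blast
    have "X \<subset> N" "Y \<subset> N" using XY by auto
    then obtain I f J g where IJ: "transversal_cover R X I f" "transversal_cover R Y J g"
      using IH by meson
    have fin: "finite X" "finite Y" using psubset.hyps XY(4) by auto
    from split show ?thesis
    proof
      assume c: "\<forall>x\<in>X. \<forall>y\<in>Y. R x y"
      then have c': "\<forall>x\<in>Y. \<forall>y\<in>X. R x y" using sym by auto
      show ?thesis
      proof (cases "card J \<le> card I")
        case True
        then show ?thesis using transversal_cover_join[OF sym fin c IJ] XY(4) by auto
      next
        case False
        then show ?thesis using transversal_cover_join[OF sym fin(2,1) c' IJ(2,1)] XY(4) by (auto simp: Un_commute)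
      qed
    next
      assume "\<forall>x\<in>X. \<forall>y\<in>Y. \<not> R x y"
      from transversal_cover_union[OF sym XY(3) this IJ] XY(4) show ?thesis by auto
    qed
  qed
qed

lemma subset_two:
  assumes "\<And>a b c. \<lbrakk>a \<in> I; b \<in> I; c \<in> I\<rbrakk> \<Longrightarrow> \<not> distinct [a, b, c]"
  shows "\<exists>x y. I \<subseteq> {x, y}"
proof (cases "\<exists>x y. x \<in> I \<and> y \<in> I \<and> x \<noteq> y")
  case True
  then obtain x y where *: "x \<in> I" "y \<in> I" "x \<noteq> y" by auto
  have "w \<in> {x, y}" if "w \<in> I" for w using assms[OF *(1,2) that] *(3) by auto
  then have "I \<subseteq> {x, y}" by (rule subsetI)
  then show ?thesis by (intro exI)
next
  case False
  then have "I \<subseteq> {x, x}" if "x \<in> I" for x using that by (metis insertI1 subsetI)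
  then show ?thesis by (metis subsetI)
qed

lemma subset_three:
  assumes "\<And>a b c d. \<lbrakk>a \<in> I; b \<in> I; c \<in> I; d \<in> I\<rbrakk> \<Longrightarrow> \<not> distinct [a, b, c, d]"
  shows "\<exists>x y z. I \<subseteq> {x, y, z}"
proof (cases "\<exists>x y z. x \<in> I \<and> y \<in> I \<and> z \<in> I \<and> distinct [x, y, z]")
  case True
  then obtain x y z where *: "x \<in> I" "y \<in> I" "z \<in> I" "distinct [x, y, z]" by blast
  have "w \<in> {x, y, z}" if "w \<in> I" for w using assms[OF *(1-3) that] *(4) by auto
  then have "I \<subseteq> {x, y, z}" by (rule subsetI)
  then show ?thesis by (intro exI)
next
  case False
  then have "\<And>a b c. \<lbrakk>a \<in> I; b \<in> I; c \<in> I\<rbrakk> \<Longrightarrow> \<not> distinct [a, b, c]" by blast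
  then have "\<exists>x y. I \<subseteq> {x, y}" by (rule subset_two)
  then obtain x y where "I \<subseteq> {x, y}" by (elim exE)
  then have "I \<subseteq> {x, y, y}" by simp
  then show ?thesis by (intro exI)
qed

section \<open>Complements of minimal counterexamples\<close>

text \<open>The relation is reflexive on \<open>V\<close>, so that \<open>\<not> x \<approx> y\<close> means distinct and nonadjacent. With this
  convention \<open>gem_free\<close> and \<open>alpha\<close> need no distinctness hypotheses: their degenerate instances hold
  trivially.\<close>

locale cogem_complement =
  fixes V :: "'a set" and adj :: "'a \<Rightarrow> 'a \<Rightarrow> bool" (infix "\<approx>" 50)
  assumes finite_V: "finite V"
    and adj_in_V: "x \<approx> y \<Longrightarrow> x \<in> V"
    and refl: "x \<in> V \<Longrightarrow> x \<approx> x"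
    and sym: "x \<approx> y \<Longrightarrow> y \<approx> x"
    and gem_free: "\<lbrakk>a \<approx> e; b \<approx> e; c \<approx> e; d \<approx> e; a \<approx> b; b \<approx> c; c \<approx> d\<rbrakk> \<Longrightarrow> a \<approx> c \<or> a \<approx> d \<or> b \<approx> d"
    and alpha: "\<lbrakk>a \<in> V; b \<in> V; c \<in> V; d \<in> V\<rbrakk> \<Longrightarrow>
      a \<approx> b \<or> a \<approx> c \<or> a \<approx> d \<or> b \<approx> c \<or> b \<approx> d \<or> c \<approx> d"
begin

definition clique :: "'a set \<Rightarrow> bool" where
  "clique K \<longleftrightarrow> (\<forall>x\<in>K. \<forall>y\<in>K. x \<approx> y)"

definition covered :: "'a set \<Rightarrow> bool" where
  "covered W \<longleftrightarrow> (\<exists>g :: 'a \<Rightarrow> nat. (\<forall>x\<in>W. g x < 4) \<and> (\<forall>x\<in>W. \<forall>y\<in>W. g x = g y \<longrightarrow> x \<approx> y))"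

definition nbh :: "'a \<Rightarrow> 'a set" where
  "nbh v = {x. x \<approx> v \<and> x \<noteq> v}"

definition far :: "'a \<Rightarrow> 'a set" where
  "far v = {x \<in> V. \<not> x \<approx> v}"

lemma in_V: "x \<approx> y \<Longrightarrow> x \<in> V" "x \<approx> y \<Longrightarrow> y \<in> V"
  using adj_in_V sym by blast+

lemma cliqueI: "(\<And>x y. x \<in> K \<Longrightarrow> y \<in> K \<Longrightarrow> x \<approx> y) \<Longrightarrow> clique K"
  by (simp add: clique_def)

lemma cliqueD: "clique K \<Longrightarrow> x \<in> K \<Longrightarrow> y \<in> K \<Longrightarrow> x \<approx> y"
  by (simp add: clique_def)

lemma clique_subset: "clique K \<Longrightarrow> L \<subseteq> K \<Longrightarrow> clique L"
  by (auto simp: clique_def)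

lemma clique_subset_V: "clique K \<Longrightarrow> K \<subseteq> V"
  using cliqueD adj_in_V by blast

lemma clique_Un:
  assumes "clique K" "clique L" "\<And>x y. x \<in> K \<Longrightarrow> y \<in> L \<Longrightarrow> x \<approx> y"
  shows "clique (K \<union> L)"
proof (rule cliqueI)
  fix x y assume "x \<in> K \<union> L" "y \<in> K \<union> L"
  then show "x \<approx> y" using assms(3) sym[of y x] cliqueD[OF assms(1)] cliqueD[OF assms(2)] by blast
qed

lemma clique_insert:
  assumes "clique K" "v \<in> V" "\<And>x. x \<in> K \<Longrightarrow> x \<approx> v"
  shows "clique (insert v K)"
proof (rule cliqueI)
  fix x y assume "x \<in> insert v K" "y \<in> insert v K"
  then show "x \<approx> y" using assms(3)[of x] assms(3)[of y] sym[of y v] refl[OF assms(2)] cliqueD[OF assms(1)] by blast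
qed

lemma clique_empty [simp]: "clique {}"
  by (simp add: clique_def)

lemma clique_singleton [simp]: "clique {x} \<longleftrightarrow> x \<in> V"
  using refl in_V by (auto simp: clique_def)

lemma coveredI:
  assumes "clique A" "clique B" "clique C" "clique D" "W \<subseteq> A \<union> B \<union> C \<union> D"
  shows "covered W"
proof -
  define g :: "'a \<Rightarrow> nat" where "g x = (if x \<in> A then 0 else if x \<in> B then 1 else if x \<in> C then 2 else 3)" for x
  have "x \<approx> y" if xy: "x \<in> W" "y \<in> W" "g x = g y" for x y
  proof -
    have "x \<in> A \<and> y \<in> A \<or> x \<in> B \<and> y \<in> B \<or> x \<in> C \<and> y \<in> C \<or> x \<in> D \<and> y \<in> D"
      using subsetD[OF assms(5) xy(1)] subsetD[OF assms(5) xy(2)] xy(3) unfolding g_def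
      by (auto split: if_splits)
    then show ?thesis using assms(1-4) by (auto dest: cliqueD)
  qed
  moreover have "\<forall>x\<in>W. g x < 4" by (simp add: g_def)
  ultimately show ?thesis unfolding covered_def by (intro exI[of _ g]) simp
qed

lemma P4_free_nbh: "N \<subseteq> {x. x \<approx> v} \<Longrightarrow> P4_free (\<approx>) N"
  unfolding P4_free_def by (intro ballI impI gem_free[of _ v]) auto

lemma P4_free_two_cliques:
  assumes "N \<subseteq> V" "P4_free (\<approx>) N"
    and a: "\<And>a b c. \<lbrakk>a \<in> N; b \<in> N; c \<in> N\<rbrakk> \<Longrightarrow> a \<approx> b \<or> a \<approx> c \<or> b \<approx> c"
  obtains K L where "clique K" "clique L" "K \<union> L = N"
proof -
  have "\<forall>x\<in>N. x \<approx> x" using assms(1) refl by auto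
  then obtain I f where If: "transversal_cover (\<approx>) N I f"
    using P4_free_transversal_cover[OF _ sym _ assms(2)] finite_subset[OF assms(1) finite_V] by blast
  then have I: "I \<subseteq> N" "\<And>x y. x \<in> I \<Longrightarrow> y \<in> I \<Longrightarrow> x \<approx> y \<Longrightarrow> x = y" "\<And>x. x \<in> N \<Longrightarrow> f x \<in> I"
    and f: "\<And>x y. x \<in> N \<Longrightarrow> y \<in> N \<Longrightarrow> f x = f y \<Longrightarrow> x \<approx> y"
    by (auto simp: transversal_cover_def)
  have "\<not> distinct [x, y, z]" if xyz: "x \<in> I" "y \<in> I" "z \<in> I" for x y z
    using a[of x y z] I(1) I(2)[of x y] I(2)[of x z] I(2)[of y z] xyz by auto
  then obtain x y where xy: "I \<subseteq> {x, y}" using subset_two[of I] by blast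
  show thesis
  proof
    show "clique {u \<in> N. f u = x}" "clique {u \<in> N. f u = y}" using f by (auto intro!: cliqueI)
    show "{u \<in> N. f u = x} \<union> {u \<in> N. f u = y} = N" using xy I(3) by auto
  qed
qed

lemma P4_free_three_cliques:
  assumes "N \<subseteq> V" "P4_free (\<approx>) N"
  obtains K L M where "clique K" "clique L" "clique M" "K \<union> L \<union> M = N"
proof -
  have "\<forall>x\<in>N. x \<approx> x" using assms(1) refl by auto
  then obtain I f where If: "transversal_cover (\<approx>) N I f"
    using P4_free_transversal_cover[OF _ sym _ assms(2)] finite_subset[OF assms(1) finite_V] by blast
  then have I: "I \<subseteq> N" "\<And>x y. x \<in> I \<Longrightarrow> y \<in> I \<Longrightarrow> x \<approx> y \<Longrightarrow> x = y" "\<And>x. x \<in> N \<Longrightarrow> f x \<in> I"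
    and f: "\<And>x y. x \<in> N \<Longrightarrow> y \<in> N \<Longrightarrow> f x = f y \<Longrightarrow> x \<approx> y"
    by (auto simp: transversal_cover_def)
  have "\<not> distinct [x, y, z, w]" if xyz: "x \<in> I" "y \<in> I" "z \<in> I" "w \<in> I" for x y z w
  proof -
    have "{x, y, z, w} \<subseteq> V" using xyz I(1) assms(1) by auto
    then show ?thesis using alpha[of x y z w] I(2) xyz by auto
  qed
  then obtain x y z where xyz: "I \<subseteq> {x, y, z}" using subset_three[of I] by blast
  show thesis
  proof
    show "clique {u \<in> N. f u = x}" "clique {u \<in> N. f u = y}" "clique {u \<in> N. f u = z}"
      using f by (auto intro!: cliqueI)
    show "{u \<in> N. f u = x} \<union> {u \<in> N. f u = y} \<union> {u \<in> N. f u = z} = N" using xyz I(3) by auto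
  qed
qed

end

locale critical_cogem_complement = cogem_complement +
  assumes critical: "W \<subset> V \<Longrightarrow> covered W"
    and not_covered: "\<not> covered V"
begin

lemma no_clique_cover: "\<lbrakk>clique A; clique B; clique C; clique D; V \<subseteq> A \<union> B \<union> C \<union> D\<rbrakk> \<Longrightarrow> False"
  using coveredI not_covered by blast

lemma no_colouring:
  fixes g :: "'a \<Rightarrow> nat"
  assumes "\<And>x. x \<in> V \<Longrightarrow> g x < 4" "\<And>x y. \<lbrakk>x \<in> V; y \<in> V; g x = g y\<rbrakk> \<Longrightarrow> x \<approx> y"
  shows False
proof -
  have "covered V" unfolding covered_def using assms by (intro exI[of _ g]) simp
  then show False using not_covered by simp
qed

text \<open>Otherwise delete \<open>u\<close>, cover the rest and put \<open>u\<close> into the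
  clique of \<open>v\<close>, all of whose members are adjacent to \<open>u\<close>.\<close>

lemma not_dominated:
  assumes "u \<approx> v" "u \<noteq> v"
  obtains x where "x \<approx> v" "\<not> x \<approx> u"
proof (rule ccontr)
  assume "\<not> thesis"
  with that have dom: "\<And>x. x \<approx> v \<Longrightarrow> x \<approx> u" by blast
  have "V - {u} \<subset> V" using in_V[OF assms(1)] by auto
  then obtain g :: "'a \<Rightarrow> nat" where g: "\<forall>x\<in>V - {u}. g x < 4" "\<forall>x\<in>V - {u}. \<forall>y\<in>V - {u}. g x = g y \<longrightarrow> x \<approx> y"
    using critical unfolding covered_def by metis
  have v: "v \<in> V - {u}" using assms in_V by auto
  let ?g = "g(u := g v)"
  have *: "x \<approx> u" if "x \<in> V - {u}" "g x = g v" for x using g(2) v that dom by blast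
  have "x \<approx> y" if "x \<in> V" "y \<in> V" "?g x = ?g y" for x y
    using that g(2) *[of x] *[of y] sym[of y u] refl[of u] by (cases "x = u"; cases "y = u") auto
  moreover have "?g x < 4" if "x \<in> V" for x using g(1) v that by auto
  ultimately show False by (rule no_colouring[rotated])
qed

text \<open>In a homogeneous set, everything outside an independent transversal could be
  coloured like the transversal.\<close>

lemma no_homogeneous_set:
  assumes C: "C \<subset> V" "\<not> is_singleton C" "C \<noteq> {}" "P4_free (\<approx>) C"
    and hom: "\<And>x y z. \<lbrakk>x \<in> V - C; y \<in> C; z \<in> C; y \<approx> x\<rbrakk> \<Longrightarrow> z \<approx> x"
  shows False
proof -
  have "\<forall>x\<in>C. x \<approx> x" using C(1) refl by auto
  then obtain I f where "transversal_cover (\<approx>) C I f"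
    using P4_free_transversal_cover[OF _ sym _ C(4)] finite_subset[OF psubset_imp_subset[OF C(1)] finite_V] by blast
  then have I: "I \<subseteq> C" "\<And>x y. x \<in> I \<Longrightarrow> y \<in> I \<Longrightarrow> x \<approx> y \<Longrightarrow> x = y" "\<And>x. x \<in> C \<Longrightarrow> f x \<in> I"
    and f: "\<And>x y. x \<in> C \<Longrightarrow> y \<in> C \<Longrightarrow> f x = f y \<Longrightarrow> x \<approx> y"
    by (auto simp: transversal_cover_def)
  have IC: "I = C"
  proof (rule ccontr)
    assume "I \<noteq> C"
    let ?W = "V - (C - I)"
    have "?W \<subset> V" using \<open>I \<noteq> C\<close> I(1) C(1) by auto
    then obtain g :: "'a \<Rightarrow> nat" where g: "\<forall>x\<in>?W. g x < 4" "\<forall>x\<in>?W. \<forall>y\<in>?W. g x = g y \<longrightarrow> x \<approx> y"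
      using critical unfolding covered_def by metis
    let ?g = "\<lambda>x. if x \<in> C then g (f x) else g x"
    have fW: "f x \<in> ?W" if "x \<in> C" for x using I(1) I(3)[OF that] C(1) by blast
    have "x \<approx> y" if xy: "x \<in> V" "y \<in> V" "?g x = ?g y" for x y
    proof -
      consider "x \<in> C" "y \<in> C" | "x \<in> C" "y \<notin> C" | "x \<notin> C" "y \<in> C" | "x \<notin> C" "y \<notin> C" by blast
      then show ?thesis
      proof cases
        case 1
        then have "f x \<approx> f y" using g(2) fW xy by auto
        then show ?thesis using I(2,3) f 1 by auto
      next
        case 2
        then have "f x \<approx> y" using g(2) fW xy by auto
        then show ?thesis using hom[of y "f x" x] 2 xy I by blast
      next
        case 3
        then have "f y \<approx> x" using g(2) fW xy by auto
        then show ?thesis using hom[of x "f y" y] 3 xy I sym by blast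
      next
        case 4
        then show ?thesis using g(2) xy by auto
      qed
    qed
    moreover have "?g x < 4" if "x \<in> V" for x using g(1) fW that by auto
    ultimately show False by (rule no_colouring[rotated])
  qed
  have indep: "x = y" if "x \<in> C" "y \<in> C" "x \<approx> y" for x y using I(2)[of x y] IC that by simp
  have "\<exists>c\<in>C. \<exists>c'\<in>C. c \<noteq> c'" using is_singletonI'[of C] C(2,3) by auto
  then obtain c c' where c: "c \<in> C" "c' \<in> C" "c \<noteq> c'" by auto
  then have cc': "\<not> c \<approx> c'" using indep by blast
  have "\<not> distinct [x, y, z, w]" if xyz: "x \<in> C" "y \<in> C" "z \<in> C" "w \<in> C" for x y z w
  proof -
    have "{x, y, z, w} \<subseteq> V" using xyz C(1) by auto
    then show ?thesis using alpha[of x y z w] indep xyz by auto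
  qed
  then obtain c1 c2 c3 where c123: "C \<subseteq> {c1, c2, c3}" using subset_three[of C] by blast
  \<comment> \<open>By now \<open>C\<close> is an independent set of two or three vertices, and a
    vertex outside misses it entirely or is complete to it. The former vertices form a clique
    because of \<open>c\<close> and \<open>c'\<close>; the latter are covered by three cliques, each
    of which can take one vertex of \<open>C\<close>.\<close>
  let ?S = "{x \<in> V - C. \<not> x \<approx> c}" and ?R = "{x \<in> V - C. x \<approx> c}"
  have S: "clique ?S"
  proof (rule cliqueI)
    fix x y assume x: "x \<in> ?S" and y: "y \<in> ?S"
    have "\<not> x \<approx> c'" "\<not> y \<approx> c'" using hom[of x c' c] hom[of y c' c] x y c sym by blast+
    then show "x \<approx> y" using alpha[of x y c c'] x y c C(1) cc' by blast
  qed
  have "?R \<subseteq> V" by auto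
  moreover have "P4_free (\<approx>) ?R" by (rule P4_free_nbh[of _ c]) auto
  ultimately obtain K1 K2 K3 where K: "clique K1" "clique K2" "clique K3" "K1 \<union> K2 \<union> K3 = ?R"
    by (rule P4_free_three_cliques)
  have R: "x \<approx> z" if "x \<in> ?R" "z \<in> C" for x z using hom[of x c z] that c sym by blast
  have add: "clique (K \<union> (C \<inter> {z}))" if "clique K" "K \<subseteq> ?R" for K z
  proof (rule clique_Un)
    show "clique (C \<inter> {z})" using C(1) refl by (auto simp: clique_def)
    show "x \<approx> y" if "x \<in> K" "y \<in> C \<inter> {z}" for x y
      using R[of x y] subsetD[OF \<open>K \<subseteq> ?R\<close> that(1)] that(2) by blast
    show "clique K" by fact
  qed
  have "K1 \<subseteq> ?R" "K2 \<subseteq> ?R" "K3 \<subseteq> ?R" unfolding K(4)[symmetric] by auto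
  note add[OF K(1) this(1), of c1] add[OF K(2) this(2), of c2] add[OF K(3) this(3), of c3]
  moreover have "V \<subseteq> (K1 \<union> (C \<inter> {c1})) \<union> (K2 \<union> (C \<inter> {c2})) \<union> (K3 \<union> (C \<inter> {c3})) \<union> ?S"
  proof
    fix x assume "x \<in> V"
    then have "x \<in> C \<or> x \<in> ?S \<or> x \<in> K1 \<union> K2 \<union> K3" unfolding K(4) by blast
    then show "x \<in> (K1 \<union> (C \<inter> {c1})) \<union> (K2 \<union> (C \<inter> {c2})) \<union> (K3 \<union> (C \<inter> {c3})) \<union> ?S"
      using subsetD[OF c123, of x] by blast
  qed
  ultimately show False using S by (intro no_clique_cover)
qed

end

section \<open>Neighbourhoods are disconnected\<close>

context cogem_complement
begin

lemma in_nbh: "x \<in> nbh v \<longleftrightarrow> x \<approx> v \<and> x \<noteq> v"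
  by (simp add: nbh_def)

lemma in_far: "x \<in> far v \<longleftrightarrow> x \<in> V \<and> \<not> x \<approx> v"
  by (simp add: far_def)

lemma nbh_subset: "nbh v \<subseteq> V"
  using in_V by (auto simp: in_nbh)

lemma V_cases: "x \<in> V \<Longrightarrow> x = v \<or> x \<in> nbh v \<or> x \<in> far v"
  by (auto simp: in_nbh in_far)

text \<open>Otherwise \<open>x\<close>, \<open>m\<close>, \<open>v\<close>, \<open>m'\<close> is an
  induced path in the neighbourhood of \<open>w\<close>. This carries adjacency to a distant vertex
  across a nonadjacent pair with a common neighbour.\<close>

lemma gem_far:
  assumes "\<not> x \<approx> v" "m \<approx> v" "m' \<approx> v" "w \<approx> v" "m \<approx> w" "m' \<approx> w" "\<not> m \<approx> m'" "m \<approx> x" "w \<approx> x"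
  shows "m' \<approx> x"
proof (rule ccontr)
  assume "\<not> m' \<approx> x"
  then have "\<not> x \<approx> m'" using sym by blast
  moreover have "x \<approx> w" "v \<approx> w" "x \<approx> m" "v \<approx> m'" using assms by (simp_all add: sym)
  ultimately show False using gem_free[of x w m v m'] assms by blast
qed

lemma far_alpha:
  assumes "a \<in> far v" "b \<in> far v" "c \<in> far v" "v \<in> V"
  shows "a \<approx> b \<or> a \<approx> c \<or> b \<approx> c"
proof -
  have "a \<in> V" "b \<in> V" "c \<in> V" "\<not> a \<approx> v" "\<not> b \<approx> v" "\<not> c \<approx> v" using assms by (simp_all add: in_far)
  then show ?thesis using alpha[of a b c v] assms(4) by simp
qed

end

context critical_cogem_complement
begin

lemma nonneighbour_in_nbh:
  assumes "w \<in> nbh v"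
  obtains w' where "w' \<in> nbh v" "\<not> w' \<approx> w"
proof -
  have "w \<approx> v" "w \<noteq> v" using assms by (auto simp: in_nbh)
  then obtain x where "x \<approx> v" "\<not> x \<approx> w" by (rule not_dominated)
  moreover have "x \<noteq> v" using sym[OF \<open>w \<approx> v\<close>] \<open>\<not> x \<approx> w\<close> by blast
  ultimately show thesis using that by (simp add: in_nbh)
qed

section \<open>Co-components of a neighbourhood\<close>

definition joined :: "'a \<Rightarrow> 'a set \<Rightarrow> bool" where
  "joined v C \<longleftrightarrow> C \<noteq> {} \<and> C \<subseteq> nbh v \<and> (\<forall>x\<in>C. \<forall>y\<in>nbh v - C. x \<approx> y)"

text \<open>Minimality makes \<open>C\<close> a connected component of the complement of the
  neighbourhood; connectedness is expressed by the absence of a smaller joined set.\<close>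

definition co_component :: "'a \<Rightarrow> 'a set \<Rightarrow> bool" where
  "co_component v C \<longleftrightarrow> joined v C \<and> (\<forall>D. joined v D \<longrightarrow> D \<subseteq> C \<longrightarrow> D = C)"

lemma co_componentD:
  assumes "co_component v C"
  shows "C \<noteq> {}" "C \<subseteq> nbh v" "\<And>x y. x \<in> C \<Longrightarrow> y \<in> nbh v \<Longrightarrow> y \<notin> C \<Longrightarrow> x \<approx> y"
  using assms unfolding co_component_def joined_def by simp_all

lemma ex_co_component:
  assumes "joined v A"
  obtains C where "co_component v C" "C \<subseteq> A"
proof -
  obtain C where C: "joined v C \<and> C \<subseteq> A"
    and least: "\<And>D. joined v D \<and> D \<subseteq> A \<Longrightarrow> card C \<le> card D"
    using ex_has_least_nat[of "\<lambda>D. joined v D \<and> D \<subseteq> A" A card] assms(1) by auto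
  have "C \<subseteq> V" using C nbh_subset by (auto simp: joined_def)
  then have finC: "finite C" using finite_V finite_subset by blast
  have "D = C" if "joined v D" "D \<subseteq> C" for D
    using card_seteq[OF finC that(2)] least[of D] C that by blast
  then show thesis using that[of C] C by (simp add: co_component_def)
qed

text \<open>If \<open>x\<close> separated no nonadjacent pair of \<open>C\<close>, its neighbours in
  \<open>C\<close> would be a smaller joined set.\<close>

lemma co_component_mixed_pair:
  assumes C: "co_component v C" and x: "s \<in> C" "t \<in> C" "s \<approx> x" "\<not> t \<approx> x"
  obtains m m' where "m \<in> C" "m' \<in> C" "\<not> m \<approx> m'" "m \<approx> x" "\<not> m' \<approx> x"
proof -
  let ?S = "{s \<in> C. s \<approx> x}"
  note CN = co_componentD[OF C]
  have "?S \<noteq> C" "?S \<subseteq> C" using x by auto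
  then have "\<not> joined v ?S" using C unfolding co_component_def by metis
  moreover have "?S \<noteq> {}" "?S \<subseteq> nbh v" using x CN(2) by auto
  ultimately have "\<not> (\<forall>m\<in>?S. \<forall>y\<in>nbh v - ?S. m \<approx> y)" unfolding joined_def by argo
  then obtain m m' where m: "m \<in> ?S" "m' \<in> nbh v - ?S" "\<not> m \<approx> m'" by auto
  then have "m' \<in> C" using CN(3)[of m m'] by auto
  with m show thesis using that[of m m'] by simp
qed

text \<open>Without such an \<open>x\<close> the set \<open>C\<close> would be homogeneous, since
  \<open>v\<close> and the rest of the neighbourhood are complete to it. A singleton is excluded
  because every neighbour of \<open>v\<close> misses another one.\<close>

lemma co_component_mixed:
  assumes C: "co_component v C" and v: "v \<in> V"
  obtains x m m' where "x \<in> far v" "m \<in> C" "m' \<in> C" "\<not> m \<approx> m'" "m \<approx> x" "\<not> m' \<approx> x"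
proof -
  note CN = co_componentD[OF C]
  have CV: "C \<subseteq> V" using CN(2) nbh_subset by blast
  have "\<exists>x\<in>far v. \<exists>s\<in>C. \<exists>t\<in>C. s \<approx> x \<and> \<not> t \<approx> x"
  proof (rule ccontr)
    assume neg: "\<not> ?thesis"
    have "v \<notin> C" using CN(2) by (auto simp: in_nbh)
    then have "C \<subset> V" using CV v by blast
    moreover have "\<not> is_singleton C"
    proof
      assume "is_singleton C"
      then obtain w where w: "C = {w}" by (auto simp: is_singleton_def)
      obtain w' where w': "w' \<in> nbh v" "\<not> w' \<approx> w" using nonneighbour_in_nbh[of w v] CN(2) w by auto
      then show False using CN(3)[of w w'] sym[of w w'] w refl[of w] nbh_subset by auto
    qed
    moreover have "P4_free (\<approx>) C" using CN(2) by (intro P4_free_nbh[of _ v]) (auto simp: in_nbh)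
    moreover have "z \<approx> x" if x: "x \<in> V - C" and yz: "y \<in> C" "z \<in> C" and yx: "y \<approx> x" for x y z
    proof -
      have "x = v \<or> x \<in> nbh v \<or> x \<in> far v" using V_cases x by blast
      then show ?thesis
      proof (elim disjE)
        assume "x = v" then show ?thesis using CN(2) yz by (auto simp: in_nbh)
      next
        assume "x \<in> nbh v" then show ?thesis using CN(3)[OF yz(2)] x by blast
      next
        assume "x \<in> far v" then show ?thesis using neg yz yx by blast
      qed
    qed
    ultimately show False using no_homogeneous_set[of C] CN(1) by blast
  qed
  then obtain x s t where x: "x \<in> far v" "s \<in> C" "t \<in> C" "s \<approx> x" "\<not> t \<approx> x" by blast
  from x(1) co_component_mixed_pair[OF C x(2-5)] show thesis using that[of x] by metis
qed

text \<open>The vertex \<open>w\<close> is a common neighbour of a nonadjacent pair of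
  \<open>C\<close> that \<open>x\<close> separates, so \<open>gem_far\<close> would carry the
  adjacency to \<open>x\<close> from one vertex of the pair to the other.\<close>

lemma co_component_mixed_anti:
  assumes C: "co_component v C" and x: "x \<in> far v" "s \<in> C" "t \<in> C" "s \<approx> x" "\<not> t \<approx> x"
    and w: "w \<in> nbh v" "w \<notin> C"
  shows "\<not> w \<approx> x"
proof
  assume "w \<approx> x"
  obtain m m' where m: "m \<in> C" "m' \<in> C" "\<not> m \<approx> m'" "m \<approx> x" "\<not> m' \<approx> x"
    using co_component_mixed_pair[OF C x(2-5)] .
  have "m \<approx> v" "m' \<approx> v" "w \<approx> v" "\<not> x \<approx> v"
    using m w x(1) co_componentD(2)[OF C] by (auto simp: in_nbh in_far)
  moreover have "m \<approx> w" "m' \<approx> w" using co_componentD(3)[OF C _ w] m(1,2) by simp_all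
  ultimately have "m' \<approx> x" using gem_far[of x v m m' w] m(3,4) \<open>w \<approx> x\<close> by simp
  then show False using m(5) by simp
qed

text \<open>If the neighbourhood of \<open>v\<close> were a join, then by primality every co-component would have a
  distant vertex that is mixed on it, hence anticomplete to the other co-components.\<close>

lemma nbh_not_join:
  assumes v: "v \<in> V" and ne: "A \<noteq> {}" "B \<noteq> {}" and AB: "A \<inter> B = {}" "A \<union> B = nbh v"
    and complete: "\<forall>x\<in>A. \<forall>y\<in>B. x \<approx> y"
  shows False
proof -
  have "nbh v - A = B" "nbh v - B = A" using AB by auto
  then have "joined v A" "joined v B"
    using ne AB complete sym unfolding joined_def by auto
  then obtain C D where C: "co_component v C" "C \<subseteq> A" and D: "co_component v D" "D \<subseteq> B"
    using ex_co_component by metis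
  obtain x m m' where x: "x \<in> far v" and m: "m \<in> C" "m' \<in> C" "\<not> m \<approx> m'" "m \<approx> x" "\<not> m' \<approx> x"
    using co_component_mixed[OF C(1) v] .
  obtain y n n' where y: "y \<in> far v" and n: "n \<in> D" "n' \<in> D" "\<not> n \<approx> n'" "n \<approx> y" "\<not> n' \<approx> y"
    using co_component_mixed[OF D(1) v] .
  note CN = co_componentD[OF C(1)] and DN = co_componentD[OF D(1)]
  note anti = co_component_mixed_anti
  have CD: "C \<inter> D = {}" using C D AB by blast
  have xa: "\<not> w \<approx> x" if "w \<in> nbh v" "w \<notin> C" for w using anti[OF C(1) x m(1,2,4,5) that] .
  have ya: "\<not> w \<approx> y" if "w \<in> nbh v" "w \<notin> D" for w using anti[OF D(1) y n(1,2,4,5) that] .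
  have sub: "nbh v \<subseteq> V" "x \<in> V" "y \<in> V" using nbh_subset x y by (auto simp: in_far)
  \<comment> \<open>Nonadjacency does not cross the boundary of \<open>C\<close>, so an independent
    triple lies inside \<open>C\<close> or avoids it. In the first case \<open>y\<close> is a fourth
    independent vertex, in the second \<open>x\<close>.\<close>
  have alpha2: "a \<approx> b \<or> a \<approx> c \<or> b \<approx> c" if abc: "a \<in> nbh v" "b \<in> nbh v" "c \<in> nbh v" for a b c
  proof (rule ccontr)
    assume neg: "\<not> ?thesis"
    have V: "a \<in> V" "b \<in> V" "c \<in> V" using abc sub by auto
    have *: "e \<in> C" if "e \<in> nbh v" "f \<in> C" "\<not> e \<approx> f \<or> \<not> f \<approx> e" for e f
      using CN(3)[of f e] sym[of f e] that by blast
    show False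
    proof (cases "a \<in> C \<or> b \<in> C \<or> c \<in> C")
      case True
      then have "a \<in> C \<and> b \<in> C \<and> c \<in> C" using * abc neg by metis
      then have "\<not> a \<approx> y" "\<not> b \<approx> y" "\<not> c \<approx> y" using ya abc CD by auto
      then show False using alpha[OF V sub(3)] neg by simp
    next
      case False
      then have "\<not> a \<approx> x" "\<not> b \<approx> x" "\<not> c \<approx> x" using xa abc by auto
      then show False using alpha[OF V sub(2)] neg by simp
    qed
  qed
  have "P4_free (\<approx>) (nbh v)" by (intro P4_free_nbh[of _ v]) (auto simp: in_nbh)
  from P4_free_two_cliques[OF sub(1) this] alpha2
  obtain K L where KL: "clique K" "clique L" "K \<union> L = nbh v" by metis
  \<comment> \<open>The distant vertices are sorted by whether they miss \<open>C\<close>, miss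
    \<open>D\<close>, or meet both. The pairs \<open>m\<close>, \<open>m'\<close> and
    \<open>n\<close>, \<open>n'\<close> make the first two classes cliques; the third is complete to
    the neighbourhood and can be added to \<open>L\<close>.\<close>
  let ?P = "{z \<in> far v. \<forall>w\<in>C. \<not> w \<approx> z}" and ?Q = "{z \<in> far v. \<forall>w\<in>D. \<not> w \<approx> z}"
  let ?R = "far v - ?P - ?Q"
  have mV: "m \<in> V" "m' \<in> V" "n \<in> V" "n' \<in> V" using m n CN(2) DN(2) sub by auto
  have P: "clique ?P"
  proof (rule cliqueI)
    fix a b assume "a \<in> ?P" "b \<in> ?P"
    then show "a \<approx> b" using alpha[of m m' a b] m mV by (auto simp: in_far)
  qed
  have Q: "clique ?Q"
  proof (rule cliqueI)
    fix a b assume "a \<in> ?Q" "b \<in> ?Q"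
    then show "a \<approx> b" using alpha[of n n' a b] n mV by (auto simp: in_far)
  qed
  have RC: "w \<approx> r" and Rx: "\<not> x \<approx> r" if r: "r \<in> ?R" "w \<in> C \<or> w \<in> D" for r w
  proof -
    from r obtain c d where cd: "c \<in> C" "c \<approx> r" "d \<in> D" "d \<approx> r" by blast
    have N: "d \<in> nbh v" "d \<notin> C" "c \<in> nbh v" "c \<notin> D" using cd CN(2) DN(2) CD by auto
    have rf: "r \<in> far v" using r by simp
    have c': "w \<approx> r" if "w \<in> C" for w
      using anti[OF C(1) rf cd(1) that cd(2) _ N(1,2)] cd by blast
    then show "w \<approx> r"
      using anti[OF D(1) rf cd(3) _ cd(4) _ N(3,4)] cd r(2) by blast
    show "\<not> x \<approx> r"
    proof
      assume xr: "x \<approx> r"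
      have "m \<approx> d" "m' \<approx> d" using CN(3) m N by blast+
      moreover have "\<not> d \<approx> x" using xa N by blast
      moreover have "m \<approx> r" "m' \<approx> r" using c' m by blast+
      moreover have "x \<approx> m" "d \<approx> m'" using sym m(4) calculation(2) by blast+
      ultimately show False using gem_free[of x r m d m'] xr cd(4) m sym by blast
    qed
  qed
  \<comment> \<open>A nonneighbour \<open>w'\<close> of \<open>w\<close> also lies outside
    \<open>C\<close>, and \<open>gem_far\<close> through \<open>m\<close> forces it to miss
    \<open>r\<close> as well. Then \<open>w\<close>, \<open>w'\<close>, \<open>x\<close>,
    \<open>r\<close> are independent.\<close>
  have RN: "w \<approx> r" if r: "r \<in> ?R" and w: "w \<in> nbh v" for r w
  proof (rule ccontr)
    assume neg: "\<not> w \<approx> r"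
    then have wC: "w \<notin> C" using RC[OF r] by blast
    obtain w' where w': "w' \<in> nbh v" "\<not> w' \<approx> w" using nonneighbour_in_nbh[OF w] .
    have w'C: "w' \<notin> C" using CN(3)[of w' w] w' w wC by blast
    have "\<not> w' \<approx> r"
    proof
      assume "w' \<approx> r"
      have "m \<approx> w" "m \<approx> w'" using CN(3) m w w' wC w'C by blast+
      then have "w \<approx> m" "w' \<approx> m" by (simp_all add: sym)
      moreover have "m \<in> nbh v" "m \<approx> r" using m CN(2) RC[OF r] by auto
      ultimately have "w \<approx> r"
        using gem_far[of r v w' w m] \<open>w' \<approx> r\<close> w w' r by (simp add: in_nbh in_far)
      then show False using neg by blast
    qed
    moreover have "\<not> w \<approx> x" "\<not> w' \<approx> x" using xa w w' wC w'C by blast+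
    moreover have "\<not> x \<approx> r" using Rx[OF r] m by blast
    moreover have "w \<in> V" "w' \<in> V" "r \<in> V" using w w' sub r by (auto simp: in_far)
    ultimately show False using alpha[of w' w x r] neg w' sub(2) by blast
  qed
  have R: "clique ?R"
  proof (rule cliqueI)
    fix a b assume ab: "a \<in> ?R" "b \<in> ?R"
    then have "\<not> x \<approx> a" "\<not> x \<approx> b" using Rx m by blast+
    then show "a \<approx> b" using far_alpha[of x v a b] ab x v by blast
  qed
  have LN: "L \<subseteq> nbh v" "K \<subseteq> nbh v" using KL(3) by auto
  have "clique (insert v K)" using KL(1) v LN(2) by (intro clique_insert) (auto simp: in_nbh)
  moreover have "clique (L \<union> ?R)"
    by (intro clique_Un KL R) (use LN RN in blast)
  moreover have "V \<subseteq> insert v K \<union> (L \<union> ?R) \<union> ?P \<union> ?Q"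
  proof
    fix z assume "z \<in> V"
    then consider "z = v" | "z \<in> K \<union> L" | "z \<in> far v" using V_cases KL(3) by metis
    then show "z \<in> insert v K \<union> (L \<union> ?R) \<union> ?P \<union> ?Q" by cases auto
  qed
  ultimately show False using no_clique_cover P Q by blast
qed

text \<open>Apart from an isolated \<open>v\<close> there is no independent triple, so the closed
  neighbourhood of any other \<open>u\<close> takes two cliques, its nonneighbours a third, and
  \<open>v\<close> the fourth.\<close>

lemma no_isolated_vertex:
  assumes v: "v \<in> V" shows "nbh v \<noteq> {}"
proof
  assume empty: "nbh v = {}"
  then have V: "V \<subseteq> insert v (far v)" using V_cases by blast
  show False
  proof (cases "far v = {}")
    case True
    then have "V \<subseteq> {v} \<union> {} \<union> {} \<union> {}" using V by simp
    then show False using v by (intro no_clique_cover[of "{v}" "{}" "{}" "{}"]) simp_all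
  next
    case False
    then obtain u where u: "u \<in> far v" by auto
    have a: "a \<approx> b \<or> a \<approx> c \<or> b \<approx> c" if "a \<in> far v" "b \<in> far v" "c \<in> far v" for a b c
      using far_alpha that v by blast
    have "P4_free (\<approx>) {x \<in> far v. x \<approx> u}" by (rule P4_free_nbh[of _ u]) auto
    moreover have "{x \<in> far v. x \<approx> u} \<subseteq> V" by (auto simp: in_far)
    ultimately obtain K L where KL: "clique K" "clique L" "K \<union> L = {x \<in> far v. x \<approx> u}"
      using P4_free_two_cliques[of "{x \<in> far v. x \<approx> u}"] a by (metis (no_types, lifting) mem_Collect_eq)
    have "clique {x \<in> far v. \<not> x \<approx> u}" using a[OF _ _ u] by (auto intro!: cliqueI)
    moreover have "clique {v}" using v by simp
    moreover have "V \<subseteq> K \<union> L \<union> {x \<in> far v. \<not> x \<approx> u} \<union> {v}" unfolding KL(3) using V by blast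
    ultimately show False using no_clique_cover KL by blast
  qed
qed

lemma nbh_split:
  assumes v: "v \<in> V"
  obtains X Y where "X \<noteq> {}" "Y \<noteq> {}" "X \<inter> Y = {}" "X \<union> Y = nbh v"
    "\<And>x y. x \<in> X \<Longrightarrow> y \<in> Y \<Longrightarrow> \<not> x \<approx> y"
proof -
  have "\<not> is_singleton (nbh v)"
  proof
    assume "is_singleton (nbh v)"
    then obtain w where w: "nbh v = {w}" by (auto simp: is_singleton_def)
    then have "w \<in> nbh v" by simp
    then obtain w' where "w' \<in> nbh v" "\<not> w' \<approx> w" by (rule nonneighbour_in_nbh)
    then show False using w refl[of w] nbh_subset by auto
  qed
  moreover have "P4_free (\<approx>) (nbh v)" by (intro P4_free_nbh[of _ v]) (auto simp: in_nbh)
  moreover have "finite (nbh v)" using nbh_subset finite_V finite_subset by blast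
  ultimately have "decomposable (\<approx>) (nbh v)"
    using no_isolated_vertex[OF v] sym P4_freeD[of "(\<approx>)" "nbh v"] by (intro P4_free_decomposable) auto
  then obtain X Y where XY: "X \<noteq> {}" "Y \<noteq> {}" "X \<inter> Y = {}" "X \<union> Y = nbh v"
    "(\<forall>x\<in>X. \<forall>y\<in>Y. x \<approx> y) \<or> (\<forall>x\<in>X. \<forall>y\<in>Y. \<not> x \<approx> y)"
    by (rule decomposableE)
  then have "\<forall>x\<in>X. \<forall>y\<in>Y. \<not> x \<approx> y" using nbh_not_join[OF v XY(1-4)] by blast
  then show thesis by (intro that[of X Y] XY(1-4)) simp
qed

end

section \<open>Diamonds and cores\<close>

context critical_cogem_complement
begin

text \<open>The set \<open>X\<close> is one side of a splitting, a union of components rather than a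
  single one; \<open>w\<close> witnesses that it is proper.\<close>

lemma nbh_component:
  assumes "d \<in> nbh u"
  obtains X w where "d \<in> X" "X \<subseteq> nbh u" "w \<in> nbh u" "w \<notin> X" "\<forall>x\<in>X. \<forall>y\<in>nbh u. y \<approx> x \<longrightarrow> y \<in> X"
proof -
  note result = that
  have "u \<in> V" using assms in_V by (auto simp: in_nbh)
  then obtain X Y where XY: "X \<noteq> {}" "Y \<noteq> {}" "X \<inter> Y = {}" "X \<union> Y = nbh u"
    "\<And>x y. x \<in> X \<Longrightarrow> y \<in> Y \<Longrightarrow> \<not> x \<approx> y" using nbh_split by metis
  have *: thesis if Z: "d \<in> Z" "W \<noteq> {}" "Z \<inter> W = {}" "Z \<union> W = nbh u" "\<And>x y. x \<in> Z \<Longrightarrow> y \<in> W \<Longrightarrow> \<not> y \<approx> x" for Z W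
  proof -
    obtain w where w: "w \<in> W" using Z(2) by auto
    have "y \<in> Z" if "x \<in> Z" "y \<in> nbh u" "y \<approx> x" for x y
      using Z(5)[OF that(1), of y] that(2,3) Z(4) by blast
    then have "\<forall>x\<in>Z. \<forall>y\<in>nbh u. y \<approx> x \<longrightarrow> y \<in> Z" by simp
    moreover have "Z \<subseteq> nbh u" "w \<in> nbh u" "w \<notin> Z" using w Z(3,4) by auto
    ultimately show thesis using result[of Z w] Z(1) by simp
  qed
  have "\<not> y \<approx> x" if "x \<in> X" "y \<in> Y" for x y using XY(5)[OF that] sym[of y x] by auto
  moreover have "d \<in> X \<or> d \<in> Y" using assms XY(4) by auto
  moreover have "\<not> y \<approx> x" if "x \<in> Y" "y \<in> X" for x y using XY(5)[OF that(2,1)] .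
  moreover have "Y \<inter> X = {}" "Y \<union> X = nbh u" using XY(3,4) by auto
  ultimately show thesis using *[of X Y] *[of Y X] XY(1-4) by blast
qed

lemma component_alpha:
  assumes X: "X \<subseteq> nbh u" "w \<in> nbh u" "w \<notin> X" "\<forall>x\<in>X. \<forall>y\<in>nbh u. y \<approx> x \<longrightarrow> y \<in> X"
    and abc: "a \<in> X" "b \<in> X" "c \<in> X"
  shows "a \<approx> b \<or> a \<approx> c \<or> b \<approx> c"
proof -
  have "\<not> w \<approx> a" "\<not> w \<approx> b" "\<not> w \<approx> c" using X(2-4) abc by auto
  moreover have "a \<in> V" "b \<in> V" "c \<in> V" "w \<in> V" using X(1,2) abc nbh_subset by blast+
  ultimately show ?thesis using alpha[of w a b c] by simp
qed

text \<open>All three vertices lie on the same side as \<open>d\<close>, where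
  \<open>component_alpha\<close> excludes independent triples.\<close>

lemma no_star_in_nbh:
  assumes "d \<in> nbh u" and x: "x \<in> nbh u" "x \<approx> d" and y: "y \<in> nbh u" "y \<approx> d" and z: "z \<in> nbh u" "z \<approx> d"
  shows "x \<approx> y \<or> x \<approx> z \<or> y \<approx> z"
proof -
  obtain X w where X: "d \<in> X" "X \<subseteq> nbh u" "w \<in> nbh u" "w \<notin> X" "\<forall>x\<in>X. \<forall>y\<in>nbh u. y \<approx> x \<longrightarrow> y \<in> X"
    by (rule nbh_component[OF assms(1)])
  then have XC: "\<And>x y. \<lbrakk>x \<in> X; y \<approx> u; y \<noteq> u; y \<approx> x\<rbrakk> \<Longrightarrow> y \<in> X"
    by (simp add: in_nbh)
  have "x \<in> X" "y \<in> X" "z \<in> X" using XC[OF X(1)] x y z by (auto simp: in_nbh)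
  then show ?thesis using component_alpha[OF X(2-5)] by blast
qed

text \<open>The neighbours of \<open>v\<close> outside the side \<open>X\<close> of the 4-cycle form
  a clique \<open>A\<close>. Distant vertices that are not complete to \<open>A\<close> must see the
  cycle and then every vertex of \<open>X\<close> not universal in \<open>X\<close>, so they form a
  clique that joins one of the two cliques covering those vertices. The distant vertices complete to
  \<open>A\<close> take two cliques, one of which is merged with \<open>A\<close>.\<close>

lemma no_wheel:
  assumes v: "p \<in> nbh v" "q \<in> nbh v" "r \<in> nbh v" "s \<in> nbh v"
    and e: "p \<approx> r" "r \<approx> q" "q \<approx> s" "s \<approx> p" and ne: "\<not> p \<approx> q" "\<not> r \<approx> s"
  shows False
proof -
  obtain X w where X: "p \<in> X" "X \<subseteq> nbh v" "w \<in> nbh v" "w \<notin> X" "\<forall>x\<in>X. \<forall>y\<in>nbh v. y \<approx> x \<longrightarrow> y \<in> X"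
    by (rule nbh_component[OF v(1)])
  then have XC: "\<And>x y. \<lbrakk>x \<in> X; y \<approx> v; y \<noteq> v; y \<approx> x\<rbrakk> \<Longrightarrow> y \<in> X"
    by (simp add: in_nbh)
  have vV: "v \<in> V" using v(1) in_V by (auto simp: in_nbh)
  have rX: "r \<in> X" "s \<in> X" using XC[OF X(1)] v(3,4) e sym[of p r] by (auto simp: in_nbh)
  then have qX: "q \<in> X" using XC[of r q] v(2) e sym[of r q] by (auto simp: in_nbh)
  have XV: "X \<subseteq> V" using X(2) nbh_subset by blast
  have pqrsV: "p \<in> V" "q \<in> V" "r \<in> V" "s \<in> V" using X(1) rX qX XV by auto
  have a2: "a \<approx> b \<or> a \<approx> c \<or> b \<approx> c" if "a \<in> X" "b \<in> X" "c \<in> X" for a b c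
    using component_alpha[OF X(2-5) that] .
  define A where "A = nbh v - X"
  have AX: "\<not> a \<approx> x" if "a \<in> A" "x \<in> X" for a x
    using XC[OF that(2), of a] that(1) unfolding A_def by (auto simp: in_nbh)
  have AV: "A \<subseteq> V" using nbh_subset unfolding A_def by blast
  have wA: "w \<in> A" using X by (simp add: A_def)
  have A: "clique A"
  proof (rule cliqueI)
    fix a b assume ab: "a \<in> A" "b \<in> A"
    have "\<not> a \<approx> p" "\<not> a \<approx> q" "\<not> b \<approx> p" "\<not> b \<approx> q" using AX ab X(1) qX by blast+
    then show "a \<approx> b" using alpha[of a b p q] ab AV pqrsV ne(1) by auto
  qed
  define MA where "MA = {m \<in> far v. \<forall>a\<in>A. a \<approx> m}"
  define MB where "MB = far v - MA"
  have hit: "x \<approx> m \<or> y \<approx> m" if m: "m \<in> MB" and xy: "x \<in> X" "y \<in> X" "\<not> x \<approx> y" for m x y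
  proof -
    obtain a where a: "a \<in> A" "\<not> a \<approx> m" using m by (auto simp: MA_def MB_def)
    have "m \<in> V" using m by (auto simp: MB_def in_far)
    then show ?thesis using alpha[of a m x y] a AX[OF a(1)] xy AV XV sym[of m x] sym[of m y] by blast
  qed
  have g: "y \<approx> m" if "m \<in> MB" "x \<in> X" "y \<in> X" "d \<in> X" "x \<approx> d" "y \<approx> d" "\<not> x \<approx> y" "x \<approx> m" "d \<approx> m" for m x y d
  proof -
    have "x \<approx> v" "y \<approx> v" "d \<approx> v" "\<not> m \<approx> v" using that X(2) by (auto simp: in_nbh MB_def in_far)
    then show ?thesis using gem_far[of m v x y d] that by simp
  qed
  have e': "r \<approx> p" "q \<approx> r" "s \<approx> q" "p \<approx> s" "\<not> q \<approx> p" "\<not> s \<approx> r" using e ne sym by blast+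
  have pqrs: "p \<approx> m" "q \<approx> m" "r \<approx> m" "s \<approx> m" if m: "m \<in> MB" for m
  proof -
    have 1: "p \<approx> m \<or> q \<approx> m" "r \<approx> m \<or> s \<approx> m" using hit[OF m] X(1) qX rX ne by blast+
    have "p \<approx> m \<and> q \<approx> m"
      using 1 g[OF m X(1) qX rX(1)] g[OF m X(1) qX rX(2)] g[OF m qX X(1) rX(1)] g[OF m qX X(1) rX(2)] e e' ne by blast
    moreover have "r \<approx> m \<and> s \<approx> m"
      using 1 g[OF m rX X(1)] g[OF m rX qX] g[OF m rX(2,1) X(1)] g[OF m rX(2,1) qX] e e' ne by blast
    ultimately show "p \<approx> m" "q \<approx> m" "r \<approx> m" "s \<approx> m" by auto
  qed
  \<comment> \<open>Two nonadjacent vertices of \<open>MB\<close> and \<open>v\<close> would be an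
    independent triple of common neighbours of the adjacent vertices \<open>p\<close> and
    \<open>r\<close>.\<close>
  have MB: "clique MB"
  proof (rule cliqueI, rule ccontr)
    fix a b assume ab: "a \<in> MB" "b \<in> MB" "\<not> a \<approx> b"
    have f: "\<not> a \<approx> v" "\<not> b \<approx> v" using ab by (auto simp: MB_def in_far)
    have "a \<noteq> p" "b \<noteq> p" "v \<noteq> p" "r \<noteq> p" using f v e' ne by (auto simp: in_nbh)
    moreover have "a \<approx> p" "b \<approx> p" "v \<approx> p" "r \<approx> p" "a \<approx> r" "b \<approx> r" "v \<approx> r"
      using pqrs[OF ab(1)] pqrs[OF ab(2)] v e sym by (auto simp: in_nbh)
    ultimately show False using no_star_in_nbh[of r p a b v] f ab(3) by (auto simp: in_nbh)
  qed
  \<comment> \<open>Each of \<open>x\<close>, \<open>y\<close> sees \<open>p\<close> or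
    \<open>q\<close>, and \<open>r\<close> or \<open>s\<close>. If they share none of these, some
    edge of the cycle continues to an induced path from \<open>x\<close> to \<open>y\<close>, a gem
    with centre \<open>v\<close>.\<close>
  have common: "\<exists>d\<in>{p, q, r, s}. x \<approx> d \<and> y \<approx> d" if xy: "x \<in> X" "y \<in> X" "\<not> x \<approx> y" for x y
  proof (rule ccontr)
    assume neg: "\<not> ?thesis"
    have vv: "x \<approx> v" "y \<approx> v" "p \<approx> v" "q \<approx> v" "r \<approx> v" "s \<approx> v" using xy(1,2) X(2) v by (auto simp: in_nbh)
    have "x \<approx> p \<or> x \<approx> q" "y \<approx> p \<or> y \<approx> q" "x \<approx> r \<or> x \<approx> s" "y \<approx> r \<or> y \<approx> s"
      using a2[OF xy(1) X(1) qX] a2[OF xy(2) X(1) qX] a2[OF xy(1) rX] a2[OF xy(2) rX] ne by simp_all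
    moreover have "\<not> (x \<approx> a \<and> b \<approx> y \<and> a \<approx> b \<and> \<not> x \<approx> b \<and> \<not> a \<approx> y)" if "a \<approx> v" "b \<approx> v" for a b
      using gem_free[of x v a b y] vv that xy(3) by blast
    note this[of p r] this[of p s] this[of q r] this[of q s] this[of r p] this[of s p] this[of r q] this[of s q]
    ultimately show False using neg vv e e' sym[of _ y] sym[of y] by (smt (verit) insertCI)
  qed
  have MBX: "x \<approx> m" if m: "m \<in> MB" and xy: "x \<in> X" "y \<in> X" "\<not> x \<approx> y" for m x y
  proof (rule ccontr)
    assume n: "\<not> x \<approx> m"
    then have "y \<approx> m" using hit[OF m xy] by simp
    obtain d where d: "d \<in> {p, q, r, s}" "x \<approx> d" "y \<approx> d" using common[OF xy] by blast
    then have "d \<in> X" "d \<approx> m" using X(1) qX rX pqrs[OF m] by auto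
    then show False using g[OF m xy(2,1), of d] d \<open>y \<approx> m\<close> n sym[of y x] xy(3) by blast
  qed
  have "MA \<subseteq> {x. x \<approx> w}" "MA \<subseteq> V" using wA sym unfolding MA_def in_far by blast+
  then obtain K L where KL: "clique K" "clique L" "K \<union> L = MA"
    using P4_free_two_cliques[of MA] P4_free_nbh[of MA w] far_alpha[OF _ _ _ vV] unfolding MA_def
    by (metis (no_types, lifting) mem_Collect_eq)
  define Z where "Z = {x \<in> X. \<forall>y\<in>X. x \<approx> y}"
  have "P4_free (\<approx>) (X - Z)" using X(2) by (intro P4_free_nbh[of _ v]) (auto simp: in_nbh)
  moreover have "X - Z \<subseteq> V" using XV by auto
  ultimately obtain S T where ST: "clique S" "clique T" "S \<union> T = X - Z"
    using P4_free_two_cliques[of "X - Z"] a2 by (metis DiffD1)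
  have STX: "S \<subseteq> X" "T \<subseteq> X - Z" using ST(3) by auto
  have SZ: "clique (S \<union> Z)"
    using STX sym by (intro clique_Un ST) (auto simp: Z_def intro: cliqueI)
  have "clique (insert v (S \<union> Z))"
  proof (rule clique_insert[OF SZ vV])
    fix x assume "x \<in> S \<union> Z"
    then have "x \<in> X" using STX by (auto simp: Z_def)
    then show "x \<approx> v" using X(2) by (auto simp: in_nbh)
  qed
  moreover have "clique (T \<union> MB)"
  proof (rule clique_Un[OF ST(2) MB])
    fix t m assume t: "t \<in> T" and m: "m \<in> MB"
    then obtain y where "y \<in> X" "\<not> t \<approx> y" using STX by (auto simp: Z_def)
    then show "t \<approx> m" using MBX[OF m] t STX by blast
  qed
  moreover have "clique (A \<union> K)"
    by (rule clique_Un[OF A KL(1)]) (use KL(3) in \<open>auto simp: MA_def\<close>)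
  moreover have "V \<subseteq> insert v (S \<union> Z) \<union> (T \<union> MB) \<union> (A \<union> K) \<union> L"
  proof
    fix z assume "z \<in> V"
    then consider "z = v" | "z \<in> A" | "z \<in> X" | "z \<in> MA" | "z \<in> MB"
      using V_cases[of z v] unfolding A_def MB_def by blast
    then show "z \<in> insert v (S \<union> Z) \<union> (T \<union> MB) \<union> (A \<union> K) \<union> L"
    proof cases
      case 3 then have "z \<in> Z \<or> z \<in> S \<or> z \<in> T" using ST(3) by blast then show ?thesis by blast
    next
      case 4 then show ?thesis using KL(3) by blast
    qed simp_all
  qed
  ultimately show False using KL(2) no_clique_cover by blast
qed

end

section \<open>Cores built from diamonds\<close>

locale core = critical_cogem_complement +
  fixes Z P Q :: "'a set"
  assumes Z_clique: "clique Z" and P_clique: "clique P" and Q_clique: "clique Q"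
    and P_ne: "P \<noteq> {}" and Q_ne: "Q \<noteq> {}"
    and Z_two: "\<exists>z\<in>Z. \<exists>z'\<in>Z. z \<noteq> z'"
    and Z_P: "\<lbrakk>z \<in> Z; x \<in> P\<rbrakk> \<Longrightarrow> z \<approx> x" and Z_Q: "\<lbrakk>z \<in> Z; x \<in> Q\<rbrakk> \<Longrightarrow> z \<approx> x"
    and P_Q: "\<lbrakk>x \<in> P; y \<in> Q\<rbrakk> \<Longrightarrow> \<not> x \<approx> y"
    and private_ex: "z \<in> Z \<Longrightarrow> \<exists>m. m \<approx> z \<and> m \<notin> Z \<union> P \<union> Q"
    and private_anti: "\<lbrakk>z \<in> Z; m \<approx> z; m \<notin> Z \<union> P \<union> Q; x \<in> P \<union> Q\<rbrakk> \<Longrightarrow> \<not> m \<approx> x"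
    and private_unique: "\<lbrakk>z \<in> Z; z' \<in> Z; m \<approx> z; m \<approx> z'; m \<notin> Z \<union> P \<union> Q\<rbrakk> \<Longrightarrow> z = z'"

text \<open>The sets are defined by adjacency to \<open>u\<close>, \<open>p\<close>,
  \<open>q\<close>, although the axioms treat all of \<open>Z\<close> alike. Wheels make
  \<open>Z\<close> a clique, gems with centre \<open>u\<close> join it to \<open>P\<close> and
  \<open>Q\<close> and separate \<open>P\<close> from \<open>Q\<close>, and the splitting of
  neighbourhoods yields the private neighbours.\<close>

lemma (in critical_cogem_complement) diamond_core:
  assumes du: "d \<approx> u" "d \<noteq> u" and p: "p \<approx> u" "p \<approx> d" and q: "q \<approx> u" "q \<approx> d" and pq: "\<not> p \<approx> q"
  obtains Z P Q where "core V (\<approx>) Z P Q" "u \<in> Z" "d \<in> Z" "p \<in> P" "q \<in> Q"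
proof -
  have V: "u \<in> V" "d \<in> V" "p \<in> V" "q \<in> V" using du p q in_V by blast+
  have s: "u \<approx> d" "u \<approx> p" "u \<approx> q" "d \<approx> p" "d \<approx> q" "\<not> q \<approx> p" using du p q pq sym by blast+
  have d: "d \<in> nbh u" using du by (simp add: in_nbh)
  obtain X w where X: "d \<in> X" "X \<subseteq> nbh u" "w \<in> nbh u" "w \<notin> X" "\<forall>x\<in>X. \<forall>y\<in>nbh u. y \<approx> x \<longrightarrow> y \<in> X"
    by (rule nbh_component[OF d])
  then have XC: "\<And>x y. \<lbrakk>x \<in> X; y \<approx> u; y \<noteq> u; y \<approx> x\<rbrakk> \<Longrightarrow> y \<in> X"
    by (simp add: in_nbh)
  have ne: "p \<noteq> u" "q \<noteq> u" "p \<noteq> d" "q \<noteq> d" using s pq p q by auto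
  have pX: "p \<in> X" "q \<in> X" using XC[OF X(1)] p q ne by auto
  have a2: "a \<approx> b \<or> a \<approx> c \<or> b \<approx> c" if "a \<in> X" "b \<in> X" "c \<in> X" for a b c
    using component_alpha[OF X(2-5) that] .
  define Z where "Z = {x. x \<approx> u \<and> x \<approx> p \<and> x \<approx> q}"
  define P where "P = {x. x \<approx> u \<and> x \<approx> p \<and> \<not> x \<approx> q}"
  define Q where "Q = {x. x \<approx> u \<and> \<not> x \<approx> p \<and> x \<approx> q}"
  have PX: "P \<subseteq> X" using XC[OF pX(1)] s by (auto simp: P_def)
  have QX: "Q \<subseteq> X" using XC[OF pX(2)] s by (auto simp: Q_def)
  have ZX: "z = u \<or> z \<in> X" if "z \<in> Z" for z using XC[OF pX(1), of z] that by (auto simp: Z_def)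
  have Xcases: "x \<in> Z \<or> x \<in> P \<or> x \<in> Q" if "x \<in> X" for x
    using a2[OF that pX] pq that X(2) by (auto simp: Z_def P_def Q_def in_nbh)
  have mem: "u \<in> Z" "d \<in> Z" "p \<in> P" "q \<in> Q"
    using s du p q pq refl V by (auto simp: Z_def P_def Q_def)
  have wheel: "r = u \<or> t = u \<or> r \<approx> t" if "r \<in> Z" "t \<in> Z" for r t
  proof (rule ccontr)
    assume n: "\<not> ?thesis"
    have "r \<approx> u" "r \<approx> p" "r \<approx> q" "t \<approx> u" "t \<approx> p" "t \<approx> q" using that by (auto simp: Z_def)
    then show False using n no_wheel[of p u q r t] p q ne pq sym by (auto simp: in_nbh)
  qed
  have Z: "clique Z"
  proof (rule cliqueI)
    fix r t assume rt: "r \<in> Z" "t \<in> Z"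
    then have "r \<approx> u" "u \<approx> t" using sym by (auto simp: Z_def)
    then show "r \<approx> t" using wheel[OF rt] by auto
  qed
  have P: "clique P"
  proof (rule cliqueI)
    fix x y assume xy: "x \<in> P" "y \<in> P"
    then show "x \<approx> y" using a2[of x y q] PX pX by (auto simp: P_def)
  qed
  have Q: "clique Q"
  proof (rule cliqueI)
    fix x y assume xy: "x \<in> Q" "y \<in> Q"
    then show "x \<approx> y" using a2[of x y p] QX pX by (auto simp: Q_def)
  qed
  have PQ: "\<not> x \<approx> y" if "x \<in> P" "y \<in> Q" for x y
  proof
    assume "x \<approx> y"
    moreover have "p \<approx> x" "\<not> p \<approx> y" using that sym by (auto simp: P_def Q_def)
    ultimately show False using gem_free[of p u x y q] that p q pq by (auto simp: P_def Q_def)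
  qed
  have ZP: "z \<approx> x" if zx: "z \<in> Z" "x \<in> P" for z x
  proof (rule ccontr)
    assume "\<not> z \<approx> x"
    moreover from this have "\<not> x \<approx> z" using sym by blast
    moreover have "p \<approx> z" using zx sym by (auto simp: Z_def)
    ultimately show False using gem_free[of x u p z q] zx p q pq by (auto simp: P_def Z_def)
  qed
  have ZQ: "z \<approx> x" if zx: "z \<in> Z" "x \<in> Q" for z x
  proof (rule ccontr)
    assume "\<not> z \<approx> x"
    moreover from this have "\<not> x \<approx> z" using sym by blast
    moreover have "q \<approx> z" using zx sym by (auto simp: Z_def)
    ultimately show False using gem_free[of x u q z p] zx p q s by (auto simp: Q_def Z_def)
  qed
  \<comment> \<open>Adjacency of \<open>m\<close> to one vertex of \<open>P\<close> or
    \<open>Q\<close> spreads by \<open>gem_far\<close> to \<open>p\<close> and \<open>q\<close>;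
    then \<open>p\<close>, \<open>u\<close>, \<open>q\<close>, \<open>m\<close> is an induced
    4-cycle around \<open>z\<close>.\<close>
  have anti: "\<not> m \<approx> x" if m: "z \<in> Z" "m \<approx> z" "m \<notin> Z \<union> P \<union> Q" and x: "x \<in> P \<union> Q" for z m x
  proof
    assume mx: "m \<approx> x"
    have xX: "x \<in> X" using x PX QX by auto
    have mX: "m \<notin> X" using Xcases m by auto
    have "m \<noteq> u" using m mem by auto
    then have mu: "\<not> m \<approx> u" using XC[OF xX, of m] mX mx by auto
    have zu: "z \<noteq> u" using mu m by auto
    have z: "z \<approx> u" "p \<approx> z" "q \<approx> z" "z \<approx> m" "z \<approx> p" "z \<approx> q" using m sym by (auto simp: Z_def)
    have xm: "x \<approx> m" using mx sym by blast
    have xz: "x \<approx> z" "x \<approx> u" using x ZP[OF m(1)] ZQ[OF m(1)] sym by (auto simp: P_def Q_def)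
    have qp: "q \<approx> m \<or> p \<approx> m"
    proof (cases "x \<in> P")
      case True
      then have "\<not> x \<approx> q" by (auto simp: P_def)
      then show ?thesis using gem_far[of m u x q z] mu xz z q xm by blast
    next
      case False
      then have "\<not> x \<approx> p" using x by (auto simp: Q_def)
      then show ?thesis using gem_far[of m u x p z] mu xz z p xm by blast
    qed
    then have "p \<approx> m \<and> q \<approx> m"
      using gem_far[of m u p q z] gem_far[of m u q p z] mu z p q pq s by blast
    moreover have "m \<noteq> z" using mu z by auto
    moreover have "p \<noteq> z" "q \<noteq> z" using z pq sym[of q p] by auto
    ultimately show False
      using no_wheel[of p z q m u] m z zu s mu pq sym[of p m] sym[of q m] sym[OF z(1)] sym[of u q] p
      by (auto simp: in_nbh)
  qed
  have ex: "\<exists>m. m \<approx> z \<and> m \<notin> Z \<union> P \<union> Q" if z: "z \<in> Z" for z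
  proof (cases "z = u")
    case True
    have "w \<notin> Z \<union> P \<union> Q"
    proof
      assume "w \<in> Z \<union> P \<union> Q"
      then show False using ZX[of w] PX QX X(3,4) by (auto simp: in_nbh)
    qed
    then show ?thesis using X(3) True by (auto simp: in_nbh)
  next
    case False
    \<comment> \<open>All of \<open>Z\<close>, \<open>P\<close> and \<open>Q\<close> is adjacent to
      \<open>u\<close>, so a neighbour of \<open>z\<close> from a component without \<open>u\<close>
      is private.\<close>
    have "u \<in> nbh z" using False z sym by (auto simp: in_nbh Z_def)
    then obtain Y y where Y: "u \<in> Y" "Y \<subseteq> nbh z" "y \<in> nbh z" "y \<notin> Y" "\<forall>x\<in>Y. \<forall>y\<in>nbh z. y \<approx> x \<longrightarrow> y \<in> Y"
      by (rule nbh_component)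
    have "\<not> y \<approx> u" using Y(1,3,4,5) by blast
    then have "y \<notin> Z \<union> P \<union> Q" by (auto simp: Z_def P_def Q_def)
    then show ?thesis using Y(3) by (auto simp: in_nbh)
  qed
  \<comment> \<open>Otherwise \<open>m\<close>, \<open>p\<close>, \<open>q\<close> would be an
    independent triple of common neighbours of \<open>z\<close> and \<open>z'\<close>.\<close>
  have uniq: "z = z'" if z: "z \<in> Z" "z' \<in> Z" "m \<approx> z" "m \<approx> z'" "m \<notin> Z \<union> P \<union> Q" for z z' m
  proof (rule ccontr)
    assume "z \<noteq> z'"
    have n: "\<not> m \<approx> p" "\<not> m \<approx> q" using anti[OF z(1,3,5)] mem by auto
    have "m \<noteq> z" "z' \<approx> z" using z cliqueD[OF Z] by auto
    moreover have "p \<approx> z" "q \<approx> z" "p \<approx> z'" "q \<approx> z'" using z sym by (auto simp: Z_def)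
    moreover have "p \<noteq> z" "q \<noteq> z" using z pq sym[of q p] by (auto simp: Z_def)
    ultimately show False using no_star_in_nbh[of z' z m p q] z n pq \<open>z \<noteq> z'\<close> by (auto simp: in_nbh)
  qed
  have "core V (\<approx>) Z P Q"
    using Z P Q mem du(2) ZP ZQ PQ ex anti uniq by unfold_locales blast+
  then show thesis using that mem by blast
qed

section \<open>Private neighbours and remaining vertices of a core\<close>

context core
begin

definition privates :: "'a set" where
  "privates = {m. m \<notin> Z \<union> P \<union> Q \<and> (\<exists>z\<in>Z. m \<approx> z)}"

definition rest :: "'a set" where
  "rest = V - (Z \<union> P \<union> Q \<union> privates)"

definition rest_complete :: "'a set" where
  "rest_complete = {r \<in> rest. \<forall>a\<in>privates. a \<approx> r}"

lemma core_subsets: "Z \<subseteq> V" "P \<subseteq> V" "Q \<subseteq> V" "privates \<subseteq> V" "rest \<subseteq> V"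
  using clique_subset_V[OF Z_clique] clique_subset_V[OF P_clique] clique_subset_V[OF Q_clique] adj_in_V
  by (auto simp: privates_def rest_def)

lemma core_cases: "x \<in> V \<Longrightarrow> x \<in> Z \<or> x \<in> P \<or> x \<in> Q \<or> x \<in> privates \<or> x \<in> rest"
  by (auto simp: rest_def)

lemma core_swap: "core V (\<approx>) Z Q P"
proof
  show "\<not> m \<approx> x" if "z \<in> Z" "m \<approx> z" "m \<notin> Z \<union> Q \<union> P" "x \<in> Q \<union> P" for z m x
    using private_anti[OF that(1,2)] that(3,4) by auto
  show "z = z'" if "z \<in> Z" "z' \<in> Z" "m \<approx> z" "m \<approx> z'" "m \<notin> Z \<union> Q \<union> P" for z z' m
    using private_unique[OF that(1-4)] that(5) by auto
  show "\<exists>m. m \<approx> z \<and> m \<notin> Z \<union> Q \<union> P" if "z \<in> Z" for z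
    using private_ex[OF that] by auto
  show "\<not> x \<approx> y" if "x \<in> Q" "y \<in> P" for x y
    using P_Q[OF that(2,1)] sym[of x y] by auto
qed (use Z_clique P_clique Q_clique P_ne Q_ne Z_two Z_P Z_Q in auto)

lemma Q_P: "\<lbrakk>y \<in> Q; x \<in> P\<rbrakk> \<Longrightarrow> \<not> y \<approx> x"
  using P_Q sym by blast

lemma privates_P: "\<lbrakk>a \<in> privates; x \<in> P\<rbrakk> \<Longrightarrow> \<not> a \<approx> x"
  and privates_Q: "\<lbrakk>a \<in> privates; x \<in> Q\<rbrakk> \<Longrightarrow> \<not> a \<approx> x"
  using private_anti by (auto simp: privates_def)

lemma private_of: "z \<in> Z \<Longrightarrow> \<exists>a\<in>privates. a \<approx> z"
  using private_ex unfolding privates_def by blast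

lemma owner_unique: "\<lbrakk>a \<in> privates; z \<in> Z; z' \<in> Z; a \<approx> z; a \<approx> z'\<rbrakk> \<Longrightarrow> z = z'"
  using private_unique by (simp add: privates_def)

lemma non_owner: "a \<in> privates \<Longrightarrow> \<exists>z\<in>Z. \<not> a \<approx> z"
  using Z_two owner_unique by metis

lemma privates_clique: "clique privates"
proof (rule cliqueI)
  fix a b assume ab: "a \<in> privates" "b \<in> privates"
  obtain p q where "p \<in> P" "q \<in> Q" using P_ne Q_ne by blast
  then show "a \<approx> b"
    using alpha[of a b p q] ab privates_P privates_Q P_Q core_subsets by blast
qed

lemma rest_Z: "\<lbrakk>r \<in> rest; z \<in> Z\<rbrakk> \<Longrightarrow> \<not> r \<approx> z"
  by (auto simp: rest_def privates_def)

lemma rest_alpha: "\<lbrakk>a \<in> rest; b \<in> rest; c \<in> rest\<rbrakk> \<Longrightarrow> a \<approx> b \<or> a \<approx> c \<or> b \<approx> c"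
proof -
  assume abc: "a \<in> rest" "b \<in> rest" "c \<in> rest"
  obtain z where "z \<in> Z" using Z_two by blast
  then show ?thesis using alpha[of a b c z] abc rest_Z core_subsets by blast
qed

text \<open>A vertex of \<open>Z\<close> that does not own \<open>a\<close> would be the fourth
  vertex of an independent set.\<close>

lemma rest_private: 
  assumes a: "a \<in> privates" and r: "r \<in> rest" "r' \<in> rest" "\<not> a \<approx> r" "\<not> a \<approx> r'"
  shows "r \<approx> r'"
proof -
  obtain z where "z \<in> Z" "\<not> a \<approx> z" using non_owner[OF a] by blast
  then show ?thesis using alpha[of a z r r'] a r rest_Z sym core_subsets by blast
qed

text \<open>Missed vertices of \<open>P\<close>, of \<open>Q\<close> and of \<open>privates\<close>
  would form an independent set with \<open>r\<close>.\<close>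

lemma rest_cases:
  assumes r: "r \<in> rest" "r \<notin> rest_complete"
  shows "(\<forall>x\<in>P. x \<approx> r) \<or> (\<forall>x\<in>Q. x \<approx> r)"
proof (rule ccontr)
  assume "\<not> ?thesis"
  then obtain p q where "p \<in> P" "q \<in> Q" "\<not> p \<approx> r" "\<not> q \<approx> r" by blast
  moreover obtain a where "a \<in> privates" "\<not> a \<approx> r" using r by (auto simp: rest_complete_def)
  ultimately show False
    using alpha[of a r p q] r privates_P privates_Q P_Q sym core_subsets by blast
qed

lemma rest_disjoint: "r \<in> rest \<Longrightarrow> r \<notin> Z \<and> r \<notin> P \<and> r \<notin> Q \<and> r \<notin> privates"
  by (simp add: rest_def)

text \<open>Since \<open>Z\<close> is complete to \<open>P\<close>, it lies on the same side of the
  neighbourhood of \<open>p\<close> as a second vertex \<open>x\<close> of \<open>P\<close>. This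
  serves to refute the existence of a second vertex.\<close>

lemma nbh_P_component:
  assumes "p \<in> P" "x \<in> P" "x \<noteq> p"
  obtains X w where "Z \<subseteq> X" "X \<subseteq> nbh p" "w \<in> nbh p" "w \<notin> X" "\<forall>x\<in>X. \<forall>y\<in>nbh p. y \<approx> x \<longrightarrow> y \<in> X" "x \<in> X"
proof -
  have "x \<in> nbh p" using assms cliqueD[OF P_clique] by (auto simp: in_nbh)
  then obtain X w where X: "x \<in> X" "X \<subseteq> nbh p" "w \<in> nbh p" "w \<notin> X" "\<forall>x\<in>X. \<forall>y\<in>nbh p. y \<approx> x \<longrightarrow> y \<in> X"
    by (rule nbh_component)
  obtain q where "q \<in> Q" using Q_ne by blast
  then have "z \<in> nbh p" if "z \<in> Z" for z
    using Z_P[OF that assms(1)] Z_Q[OF that] P_Q[OF assms(1)] by (auto simp: in_nbh)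
  then have "Z \<subseteq> X" using X(1,5) Z_P[OF _ assms(2)] by blast
  then show thesis using that X by blast
qed

text \<open>Two nonadjacent vertices complete to all private neighbours would lie in a second core, whose
  axis \<open>Z'\<close> contains the private neighbours of the first one and vice versa. The vertices
  outside both cores form a clique, and a cover fails only if all four adjacency types towards
  \<open>P\<close>, \<open>Q\<close> and \<open>P'\<close>, \<open>Q'\<close> occur among them.\<close>

lemma rest_complete_clique: "clique rest_complete"
proof (rule cliqueI, rule ccontr)
  fix r r' assume rr: "r \<in> rest_complete" "r' \<in> rest_complete" "\<not> r \<approx> r'"
  have r: "r \<in> rest" "r' \<in> rest" "\<And>a. a \<in> privates \<Longrightarrow> a \<approx> r \<and> a \<approx> r'"
    using rr by (auto simp: rest_complete_def)
  obtain z1 z2 where z: "z1 \<in> Z" "z2 \<in> Z" "z1 \<noteq> z2" using Z_two by blast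
  obtain a1 a2 where a: "a1 \<in> privates" "a2 \<in> privates" "a1 \<approx> z1" "a2 \<approx> z2"
    using private_of z by metis
  have a12: "a2 \<approx> a1" "a2 \<noteq> a1" using cliqueD[OF privates_clique] a owner_unique z by auto
  \<comment> \<open>The second core comes from the diamond with axis \<open>a1\<close>,
    \<open>a2\<close> and tips \<open>r\<close>, \<open>r'\<close>.\<close>
  obtain Z' P' Q' where core': "core V (\<approx>) Z' P' Q'" "a1 \<in> Z'" "a2 \<in> Z'" "r \<in> P'" "r' \<in> Q'"
    using diamond_core[OF a12, of r r'] r a sym rr(3) by metis
  interpret c: core V "(\<approx>)" Z' P' Q' by fact
  have AZ: "a \<in> Z' \<and> a \<notin> P' \<and> a \<notin> Q'" if a': "a \<in> privates" for a
  proof -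
    have "a \<approx> r" "a \<approx> r'" "a \<approx> a1" using r a' cliqueD[OF privates_clique] a by auto
    then have "a \<notin> P'" "a \<notin> Q'" "a \<notin> c.privates" "a \<notin> c.rest"
      using c.P_Q c.Q_P c.privates_P c.rest_Z core'(2-5) by blast+
    moreover have "a \<in> V" using a' core_subsets by auto
    ultimately show ?thesis using c.core_cases by blast
  qed
  have Znot: "\<not> a1 \<approx> z \<or> \<not> a2 \<approx> z" if "z \<in> Z" for z
    using owner_unique[OF a(1) z(1) that a(3)] owner_unique[OF a(2) z(2) that a(4)] z(3) by auto
  have Z': "z \<notin> Z' \<union> P' \<union> Q'" if "z \<in> Z" for z
  proof -
    have "\<not> z \<approx> r" using rest_Z[OF r(1) that] sym by blast
    then show ?thesis using c.Z_P[of z r] c.Z_P[of a1 z] c.Z_P[of a2 z] c.Z_Q[of a1 z] c.Z_Q[of a2 z] Znot[OF that] core' by auto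
  qed
  have Zc: "z \<in> c.privates" if zZ: "z \<in> Z" for z
  proof -
    obtain a where "a \<in> privates" "a \<approx> z" using private_of[OF zZ] by blast
    then show ?thesis using Z'[OF zZ] AZ[of a] sym[of a z] by (auto simp: c.privates_def)
  qed
  have sub: "rest_complete \<subseteq> Z' \<union> P' \<union> Q'"
  proof
    fix s assume "s \<in> rest_complete"
    then have "s \<approx> a1" "s \<approx> a2" using a sym by (auto simp: rest_complete_def)
    then show "s \<in> Z' \<union> P' \<union> Q'" using c.private_unique[OF core'(2,3)] a12(2) by blast
  qed
  have sup: "Z' \<union> P' \<union> Q' \<subseteq> rest_complete \<union> privates"
  proof
    fix s assume s: "s \<in> Z' \<union> P' \<union> Q'"
    have adj: "a \<approx> s" if "a \<in> privates" for a
      using AZ[OF that] s cliqueD[OF c.Z_clique] c.Z_P c.Z_Q by blast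
    have "s \<in> V" using s c.core_subsets by blast
    then show "s \<in> rest_complete \<union> privates"
      using core_cases[of s] Z'[of s] s adj privates_P[OF a(1)] privates_Q[OF a(1)] a(1)
      by (auto simp: rest_complete_def)
  qed
  define S where "S = rest - rest_complete"
  have S1: "s \<in> rest" "s \<in> c.rest" if "s \<in> S" for s
  proof -
    show s: "s \<in> rest" using that by (simp add: S_def)
    have "s \<notin> Z' \<union> P' \<union> Q'" using sup that rest_disjoint[OF s] by (auto simp: S_def)
    moreover have "s \<notin> c.privates"
      using cliqueD[OF c.privates_clique _ Zc[OF z(1)], of s] rest_Z[OF s z(1)] by blast
    moreover have "s \<in> V" using s core_subsets by blast
    ultimately show "s \<in> c.rest" using c.core_cases by blast
  qed
  have SP: "(\<forall>x\<in>P. x \<approx> s) \<or> (\<forall>x\<in>Q. x \<approx> s)" if "s \<in> S" for s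
    using rest_cases[OF S1(1)[OF that]] that by (simp add: S_def)
  have SP': "(\<forall>x\<in>P'. x \<approx> s) \<or> (\<forall>x\<in>Q'. x \<approx> s)" if "s \<in> S" for s
  proof (rule c.rest_cases[OF S1(2)[OF that]])
    show "s \<notin> c.rest_complete" using Zc[OF z(1)] rest_Z[OF S1(1)[OF that] z(1)] sym by (auto simp: c.rest_complete_def)
  qed
  have Sc: "s \<approx> t" if "s \<in> S" "t \<in> S" for s t
  proof -
    have "\<not> a1 \<approx> s" "\<not> a1 \<approx> t" using c.rest_Z[OF S1(2) core'(2)] that sym by blast+
    then show ?thesis using rest_private[OF a(1)] S1(1) that by blast
  qed
  \<comment> \<open>Each axis takes one side of its own core; the two remaining sides
    \<open>X\<close> and \<open>X'\<close> absorb the vertices of \<open>S\<close> complete to them.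
    Some vertex of \<open>S\<close> must be left over, for each of the four choices.\<close>
  have cov: "\<exists>s\<in>S. \<not> (\<forall>x\<in>X. x \<approx> s) \<and> \<not> (\<forall>x\<in>X'. x \<approx> s)"
    if XY: "X = P \<and> Y = Q \<or> X = Q \<and> Y = P" and XY': "X' = P' \<and> Y' = Q' \<or> X' = Q' \<and> Y' = P'" for X Y X' Y'
  proof (rule ccontr)
    assume n: "\<not> ?thesis"
    have "clique (Z \<union> Y)" using XY Z_clique P_clique Q_clique Z_P Z_Q by (auto intro!: clique_Un)
    moreover have "clique (Z' \<union> Y')" using XY' c.Z_clique c.P_clique c.Q_clique c.Z_P c.Z_Q by (auto intro!: clique_Un)
    moreover have "clique {s \<in> S. \<forall>x\<in>E. x \<approx> s}" for E using Sc by (auto intro!: cliqueI)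
    moreover have "clique X" "clique X'" using XY XY' P_clique Q_clique c.P_clique c.Q_clique by auto
    ultimately have "clique (Z \<union> Y)" "clique (Z' \<union> Y')" "clique (X \<union> {s \<in> S. \<forall>x\<in>X. x \<approx> s})" "clique (X' \<union> {s \<in> S. \<forall>x\<in>X'. x \<approx> s})"
      by (auto intro!: clique_Un)
    moreover have "V \<subseteq> (Z \<union> Y) \<union> (Z' \<union> Y') \<union> (X \<union> {s \<in> S. \<forall>x\<in>X. x \<approx> s}) \<union> (X' \<union> {s \<in> S. \<forall>x\<in>X'. x \<approx> s})"
    proof
      fix v assume "v \<in> V"
      then have "v \<in> Z \<or> v \<in> X \<or> v \<in> Y \<or> v \<in> privates \<or> v \<in> rest_complete \<or> v \<in> S"
        using core_cases XY by (auto simp: S_def)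
      then have "v \<in> Z \<or> v \<in> X \<or> v \<in> Y \<or> v \<in> Z' \<or> v \<in> X' \<or> v \<in> Y' \<or> v \<in> S"
        using AZ sub XY' by blast
      then show "v \<in> (Z \<union> Y) \<union> (Z' \<union> Y') \<union> (X \<union> {s \<in> S. \<forall>x\<in>X. x \<approx> s}) \<union> (X' \<union> {s \<in> S. \<forall>x\<in>X'. x \<approx> s})"
        using n by blast
    qed
    ultimately show False by (rule no_clique_cover)
  qed
  obtain r1 where "r1 \<in> S" "\<not> (\<forall>x\<in>Q. x \<approx> r1)" "\<not> (\<forall>x\<in>Q'. x \<approx> r1)"
    using cov[of Q P Q' P'] by auto
  then obtain q1' where r1: "r1 \<in> S" "\<forall>x\<in>P. x \<approx> r1" "\<forall>x\<in>P'. x \<approx> r1" "q1' \<in> Q'" "\<not> q1' \<approx> r1"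
    using SP SP' by metis
  obtain r2 where "r2 \<in> S" "\<not> (\<forall>x\<in>Q. x \<approx> r2)" "\<not> (\<forall>x\<in>P'. x \<approx> r2)"
    using cov[of Q P P' Q'] by auto
  then obtain p2' where r2: "r2 \<in> S" "\<forall>x\<in>P. x \<approx> r2" "\<forall>x\<in>Q'. x \<approx> r2" "p2' \<in> P'" "\<not> p2' \<approx> r2"
    using SP SP' by metis
  obtain r3 where "r3 \<in> S" "\<not> (\<forall>x\<in>P. x \<approx> r3)" "\<not> (\<forall>x\<in>Q'. x \<approx> r3)"
    using cov[of P Q Q' P'] by auto
  then obtain p3 where r3: "r3 \<in> S" "\<forall>x\<in>P'. x \<approx> r3" "p3 \<in> P" "\<not> p3 \<approx> r3"
    using SP' by metis
  obtain r4 where "r4 \<in> S" "\<not> (\<forall>x\<in>P. x \<approx> r4)" "\<not> (\<forall>x\<in>P'. x \<approx> r4)"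
    using cov[of P Q P' Q'] by auto
  then obtain p4 where r4: "r4 \<in> S" "\<forall>x\<in>Q'. x \<approx> r4" "p4 \<in> P" "\<not> p4 \<approx> r4"
    using SP' by metis
  have G: "x \<approx> y" if s: "s1 \<in> S" "s2 \<in> S" "s3 \<in> S" and xy: "x \<approx> s1" "y \<approx> s1" "x \<approx> s2" "y \<approx> s3" "\<not> x \<approx> s3" "\<not> y \<approx> s2" for s1 s2 s3 x y
    using gem_free[of x s1 s2 s3 y] Sc[OF s(2,1)] Sc[OF s(3,1)] Sc[OF s(2,3)] xy sym[of y s3] sym[of s2 y] by blast
  have pp: "p3 \<approx> p2'" by (rule G[of r1 r2 r3]) (use r1 r2 r3 in auto)
  have pq: "p4 \<approx> q1'" by (rule G[of r2 r1 r4]) (use r1 r2 r4 in auto)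
  have p2'R: "p2' \<in> rest"
    using sup r2(4) AZ[of p2'] by (auto simp: rest_complete_def)
  \<comment> \<open>The two vertices were chosen independently. If they differed, \<open>z1\<close>,
    \<open>r2\<close>, \<open>p2'\<close> would be an independent triple on one side of the
    neighbourhood of \<open>p3\<close>.\<close>
  have "p4 = p3"
  proof (rule ccontr)
    assume ne: "p4 \<noteq> p3"
    obtain X w where X: "Z \<subseteq> X" "X \<subseteq> nbh p3" "w \<in> nbh p3" "w \<notin> X"
      "\<forall>x\<in>X. \<forall>y\<in>nbh p3. y \<approx> x \<longrightarrow> y \<in> X" "p4 \<in> X"
      using nbh_P_component[OF r3(3) r4(3) ne] by blast
    have "r1 \<noteq> p3" "r2 \<noteq> p3" "p2' \<noteq> p3" using rest_disjoint[OF S1(1)] rest_disjoint[OF p2'R] r1(1) r2(1) r3(3) by blast+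
    then have n: "r1 \<in> nbh p3" "r2 \<in> nbh p3" "p2' \<in> nbh p3"
      using r1(2) r2(2) r3(3) pp sym by (auto simp: in_nbh)
    have "r1 \<approx> p4" "r2 \<approx> p4" using r1(2) r2(2) r4(3) sym by auto
    then have "r1 \<in> X" "r2 \<in> X" using n X(5,6) by auto
    moreover from this have "p2' \<in> X" using n X(5) r1(3) r2(4) by auto
    ultimately have "z1 \<approx> r2 \<or> z1 \<approx> p2' \<or> r2 \<approx> p2'"
      using component_alpha[OF X(2-5), of z1 r2 p2'] X(1) z(1) by auto
    then show False using rest_Z[OF S1(1)[OF r2(1)] z(1)] rest_Z[OF p2'R z(1)] r2(5) sym by blast
  qed
  then have "p2' \<approx> p3" "r1 \<approx> p3" "r2 \<approx> p3" "q1' \<approx> p3" "p2' \<approx> r1" "r1 \<approx> r2" "r2 \<approx> q1'"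
    using pp pq r1 r2 r3(3) Sc sym by auto
  then show False using gem_free[of p2' p3 r1 r2 q1'] r2(4,5) r1(4,5) c.P_Q sym by blast
qed

section \<open>Nonadjacent remaining vertices complete to the same side\<close>

lemma rest_nonadjacent:
  assumes "s \<in> rest - rest_complete" "t \<in> rest - rest_complete" "\<not> s \<approx> t"
  obtains a b where "a \<in> privates" "b \<in> privates" "\<not> a \<approx> s" "a \<approx> t" "b \<approx> s" "\<not> b \<approx> t"
proof -
  obtain a b where ab: "a \<in> privates" "b \<in> privates" "\<not> a \<approx> s" "\<not> b \<approx> t"
    using assms(1,2) by (auto simp: rest_complete_def)
  have "a \<approx> t" "b \<approx> s"
    using rest_private[OF ab(1), of s t] rest_private[OF ab(2), of s t] ab assms by auto
  then show thesis using that ab by blast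
qed

text \<open>Private neighbours \<open>a\<close>, \<open>b\<close> that separate \<open>s\<close> and
  \<open>t\<close> make \<open>s\<close>, \<open>b\<close>, \<open>a\<close>, \<open>t\<close> an
  induced path around \<open>w\<close>.\<close>

lemma no_common_neighbour:
  assumes st: "s \<in> rest - rest_complete" "t \<in> rest - rest_complete" "\<not> s \<approx> t"
    and w: "s \<approx> w" "t \<approx> w" "\<And>a. a \<in> privates \<Longrightarrow> a \<approx> w"
  shows False
proof -
  obtain a b where ab: "a \<in> privates" "b \<in> privates" "\<not> a \<approx> s" "a \<approx> t" "b \<approx> s" "\<not> b \<approx> t"
    using rest_nonadjacent[OF st] .
  have "s \<approx> b" "b \<approx> a" "\<not> s \<approx> a" using ab cliqueD[OF privates_clique] sym by blast+
  then show False using gem_free[of s w b a t] w ab st(3) by blast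
qed

text \<open>Some vertex of \<open>Z\<close> misses \<open>m\<close>, and it misses
  \<open>rest\<close> anyway, so it would be the fourth independent vertex.\<close>

lemma nonadjacent_hit:
  assumes "m \<in> privates \<or> m \<in> rest" "t \<in> rest" "t' \<in> rest" "\<not> t \<approx> t'"
  shows "t \<approx> m \<or> t' \<approx> m"
proof -
  obtain z where z: "z \<in> Z" "\<not> m \<approx> z"
    using assms(1) non_owner[of m] rest_Z[of m] Z_two by blast
  have "m \<in> V" "z \<in> V" "t \<in> V" "t' \<in> V" using assms z core_subsets by blast+
  then show ?thesis using alpha[of t t' m z] rest_Z z assms by blast
qed

text \<open>A second vertex of \<open>P\<close> would put \<open>r\<close>, \<open>r'\<close> and a
  vertex of \<open>Z\<close>, an independent triple, on one side of the neighbourhood of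
  \<open>p\<close>.\<close>

lemma P_singleton:
  assumes r: "r \<in> rest" "r' \<in> rest" "\<not> r \<approx> r'" and P: "\<forall>x\<in>P. x \<approx> r" "\<forall>x\<in>P. x \<approx> r'"
    and p: "p \<in> P"
  shows "P = {p}"
proof (rule ccontr)
  assume "P \<noteq> {p}"
  then obtain x where x: "x \<in> P" "x \<noteq> p" using p by blast
  obtain X w where X: "Z \<subseteq> X" "X \<subseteq> nbh p" "w \<in> nbh p" "w \<notin> X" "\<forall>x\<in>X. \<forall>y\<in>nbh p. y \<approx> x \<longrightarrow> y \<in> X" "x \<in> X"
    using nbh_P_component[OF p x] by blast
  have "r \<noteq> p" "r' \<noteq> p" using rest_disjoint r p by blast+
  then have "r \<in> X" "r' \<in> X" using X(5,6) P p x(1) sym by (auto simp: in_nbh)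
  moreover obtain z where "z \<in> Z" using Z_two by blast
  ultimately have "z \<approx> r \<or> z \<approx> r' \<or> r \<approx> r'"
    using component_alpha[OF X(2-5), of z r r'] X(1) by auto
  then show False using rest_Z \<open>z \<in> Z\<close> r sym by blast
qed

lemma nbh_P:
  assumes "P = {p}" "y \<approx> p" "y \<noteq> p"
  shows "y \<in> Z \<or> y \<in> rest"
  using core_cases[of y] adj_in_V[OF assms(2)] assms Q_P[of y p] privates_P[of y p] by auto

text \<open>First possibility for a vertex \<open>p\<close> with \<open>P = {p}\<close>: its neighbours outside \<open>Z\<close> do not form two
  disjoint cliques, so \<open>p\<close> lies in a second core, and the private neighbours of \<open>p\<close> there include \<open>Z\<close>.\<close>

lemma no_second_core:
  assumes P: "P = {p}" and x: "x \<in> rest" "x \<approx> p" and t: "t \<in> rest" "t \<approx> p" "t \<approx> x"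
    and t': "t' \<in> rest" "t' \<approx> p" "t' \<approx> x" and ne: "\<not> t \<approx> t'"
  shows False
proof -
  have "p \<in> V" using x in_V by blast
  have xp: "x \<noteq> p" using rest_disjoint[OF x(1)] P by auto
  obtain Z' P' Q' where core': "core V (\<approx>) Z' P' Q'" "p \<in> Z'" "x \<in> Z'" "t \<in> P'" "t' \<in> Q'"
    using diamond_core[OF x(2) xp t(2,3) t'(2,3) ne] .
  interpret c: core V "(\<approx>)" Z' P' Q' by fact
  have all_p: "y \<approx> p \<and> y \<approx> x" if "y \<in> Z' \<union> P' \<union> Q'" for y
    using that cliqueD[OF c.Z_clique] c.Z_P c.Z_Q core' sym by blast
  have Zc: "z \<in> c.privates" if z: "z \<in> Z" for z
  proof -
    have "\<not> z \<approx> x" using rest_Z[OF x(1) z] sym by blast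
    then have "z \<notin> Z' \<union> P' \<union> Q'" using all_p by blast
    moreover have "z \<approx> p" using Z_P[OF z] P by simp
    ultimately show ?thesis using core'(2) by (auto simp: c.privates_def)
  qed
  obtain z0 where z0: "z0 \<in> Z" using Z_two by blast
  have T: "y \<in> Z' \<union> P' \<union> Q'" if y: "y \<in> rest" "y \<approx> p" for y
  proof (rule ccontr)
    assume "y \<notin> Z' \<union> P' \<union> Q'"
    then have "y \<in> c.privates" using y core'(2) by (auto simp: c.privates_def)
    then show False using cliqueD[OF c.privates_clique _ Zc[OF z0]] rest_Z[OF y(1) z0] by blast
  qed
  have PQ': "y \<in> rest" if y: "y \<in> P' \<union> Q'" for y
  proof -
    have "p \<notin> P'" "p \<notin> Q'" using c.P_Q[of p t'] c.P_Q[of t p] core'(4,5) t t' sym by blast+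
    then have "y \<noteq> p" using y by auto
    moreover have "y \<approx> p" "y \<notin> Z" using all_p y Zc[of y] by (auto simp: c.privates_def)
    ultimately show ?thesis using nbh_P[OF P] by blast
  qed
  \<comment> \<open>Apart from \<open>Z\<close> and \<open>Q\<close>, this is what the second core
    does not contain. Every element of \<open>D\<close> misses \<open>x\<close> and some vertex of
    \<open>Z\<close>, which makes \<open>D\<close> a clique, and each can be added to
    \<open>P'\<close> or to \<open>Q'\<close>.\<close>
  define D where "D = privates \<union> {s \<in> rest. \<not> s \<approx> p}"
  have Dz: "\<exists>z\<in>Z. \<not> d \<approx> z" if "d \<in> D" for d
    using that non_owner[of d] rest_Z[of d] z0 by (auto simp: D_def)
  have Dx: "\<not> d \<approx> x" if d: "d \<in> D" for d
  proof
    assume "d \<approx> x"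
    have "\<not> d \<approx> p" using d privates_P P by (auto simp: D_def)
    then have "d \<notin> Z' \<union> P' \<union> Q'" using all_p by blast
    then have "d \<in> c.privates" using \<open>d \<approx> x\<close> core'(3) by (auto simp: c.privates_def)
    then have "d \<approx> z" if "z \<in> Z" for z using cliqueD[OF c.privates_clique] Zc[OF that] by blast
    then show False using Dz[OF d] by blast
  qed
  have DV: "D \<subseteq> V" "x \<in> V" using core_subsets x by (auto simp: D_def)
  have xz: "\<not> x \<approx> z" if "z \<in> Z" for z using rest_Z[OF x(1) that] .
  have D: "clique D"
  proof (rule cliqueI, rule ccontr)
    fix d e assume de: "d \<in> D" "e \<in> D" "\<not> d \<approx> e"
    have "\<exists>z\<in>Z. \<not> d \<approx> z \<and> \<not> e \<approx> z"
    proof (cases "d \<in> privates \<and> e \<in> privates")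
      case True then show ?thesis using cliqueD[OF privates_clique] de(3) by blast
    next
      case False
      then show ?thesis using de Dz[OF de(1)] Dz[OF de(2)] rest_Z[of d] rest_Z[of e] by (auto simp: D_def)
    qed
    then obtain z where z: "z \<in> Z" "\<not> d \<approx> z" "\<not> e \<approx> z" by blast
    then show False using alpha[of d e x z] de Dx xz DV core_subsets by blast
  qed
  have DPQ: "(\<forall>y\<in>P'. y \<approx> d) \<or> (\<forall>y\<in>Q'. y \<approx> d)" if "d \<in> D" for d
  proof (rule ccontr)
    assume "\<not> ?thesis"
    then obtain y y' where y: "y \<in> P'" "y' \<in> Q'" "\<not> y \<approx> d" "\<not> y' \<approx> d" by blast
    then show False using nonadjacent_hit[of d y y'] PQ' c.P_Q[OF y(1,2)] that by (auto simp: D_def)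
  qed
  have "clique (E \<union> {d \<in> D. \<forall>y\<in>E. y \<approx> d})" if "clique E" for E
    using that clique_subset[OF D, of "{d \<in> D. \<forall>y\<in>E. y \<approx> d}"] by (auto intro!: clique_Un)
  note this[OF c.P_clique] this[OF c.Q_clique]
  moreover have "clique (Z \<union> Q)" using Z_clique Q_clique Z_Q by (intro clique_Un)
  moreover note c.Z_clique
  moreover have "V \<subseteq> (P' \<union> {d \<in> D. \<forall>y\<in>P'. y \<approx> d}) \<union> (Q' \<union> {d \<in> D. \<forall>y\<in>Q'. y \<approx> d}) \<union> (Z \<union> Q) \<union> Z'"
  proof
    fix v assume "v \<in> V"
    then consider "v \<in> Z \<union> Q" | "v = p" | "v \<in> D" | "v \<in> rest" "v \<approx> p"
      using core_cases[of v] P by (auto simp: D_def)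
    then show "v \<in> (P' \<union> {d \<in> D. \<forall>y\<in>P'. y \<approx> d}) \<union> (Q' \<union> {d \<in> D. \<forall>y\<in>Q'. y \<approx> d}) \<union> (Z \<union> Q) \<union> Z'"
    proof cases
      case 3 then show ?thesis using DPQ[of v] by blast
    next
      case 4 then show ?thesis using T[of v] by blast
    qed (use core'(2) in auto)
  qed
  ultimately show False by (rule no_clique_cover)
qed

text \<open>Second possibility: the neighbours of \<open>p\<close> outside \<open>Z\<close> form disjoint cliques \<open>T1\<close> and \<open>T2\<close>. Gems force
  the private neighbours to split accordingly, into \<open>B1\<close> and \<open>B2\<close>, and almost all remaining vertices
  follow one of the two halves.\<close>

lemma no_bad_P_pair:
  assumes r: "r \<in> rest - rest_complete" "r' \<in> rest - rest_complete" "\<not> r \<approx> r'"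
    and rP: "\<forall>x\<in>P. x \<approx> r" "\<forall>x\<in>P. x \<approx> r'"
  shows False
proof -
  obtain p where p: "p \<in> P" using P_ne by blast
  have P: "P = {p}" using P_singleton[of r r' p] r rP p by auto
  define T where "T = {t \<in> rest. t \<approx> p}"
  define S where "S = rest - T"
  have rT: "r \<in> T" "r' \<in> T" using r rP p sym by (auto simp: T_def)
  have Sp: "\<not> s \<approx> p" if "s \<in> S" for s using that by (auto simp: S_def T_def)
  have no_path: False if "x \<in> T" "t \<in> T" "t' \<in> T" "t \<approx> x" "t' \<approx> x" "\<not> t \<approx> t'" for x t t'
    using no_second_core[OF P, of x t t'] that by (auto simp: T_def)
  define T1 where "T1 = {t \<in> T. t \<approx> r}"
  define T2 where "T2 = {t \<in> T. t \<approx> r'}"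
  have rr: "r \<approx> r" "r' \<approx> r'" "\<not> r' \<approx> r" using r refl core_subsets sym by auto
  have T12: "T = T1 \<union> T2" "r \<in> T1" "r' \<in> T2"
    using rest_alpha[of _ r r'] r rT rr by (auto simp: T1_def T2_def T_def)
  have T1c: "clique T1" and T2c: "clique T2"
    using no_path rT by (auto simp: T1_def T2_def intro!: cliqueI)
  have anti: "\<not> t \<approx> t'" if "t \<in> T1" "t' \<in> T2" for t t'
  proof
    assume tt: "t \<approx> t'"
    have t: "t \<in> T" "t' \<in> T" "t \<approx> r" "t' \<approx> r'" "r \<approx> t" "r' \<approx> t'" "t' \<approx> t" using that tt sym by (auto simp: T1_def T2_def)
    show False
    proof (cases "r \<approx> t'")
      case True then show False using no_path[of t' r r'] t rT r(3) by blast
    next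
      case False then show False using no_path[of t r t'] t rT by blast
    qed
  qed
  have Tp: "t \<approx> p" "p \<approx> t" "t \<in> rest" if "t \<in> T1 \<union> T2" for t
    using that sym T12(1) by (auto simp: T_def)
  have hitT: "(\<forall>t\<in>T1. t \<approx> m) \<or> (\<forall>t\<in>T2. t \<approx> m)" if "m \<in> privates \<or> m \<in> S" for m
  proof (rule ccontr)
    assume "\<not> ?thesis"
    then obtain t t' where t: "t \<in> T1" "t' \<in> T2" "\<not> t \<approx> m" "\<not> t' \<approx> m" by blast
    then show False using nonadjacent_hit[of m t t'] anti[OF t(1,2)] Tp that by (auto simp: S_def)
  qed
  define SQ where "SQ = S - rest_complete"
  have SQ: "s \<in> rest - rest_complete" "s \<in> S" if "s \<in> SQ" for s using that by (auto simp: SQ_def S_def)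
  have SQ_Q: "x \<approx> s" if s: "s \<in> SQ" and x: "x \<in> Q" for s x
  proof -
    have "\<not> p \<approx> s" using Sp[OF SQ(2)[OF s]] sym by blast
    then show ?thesis using rest_cases[of s] SQ[OF s] p x by blast
  qed
  have RA: "x \<in> rest" "a \<in> privates \<Longrightarrow> a \<approx> x" if "x \<in> rest_complete" for x a
    using that by (auto simp: rest_complete_def)
  obtain z0 where z0: "z0 \<in> Z" using Z_two by blast
  have priv_p: "\<not> a \<approx> p" "\<not> p \<approx> a" if "a \<in> privates" for a using privates_P[OF that p] sym by blast+
  have ZPc: "clique (Z \<union> P)" using Z_clique P_clique Z_P by (intro clique_Un)
  \<comment> \<open>If \<open>U\<close> were complete to the private neighbours, it would lie in
    \<open>rest_complete\<close>. The vertices of \<open>SQ\<close> complete to \<open>U\<close>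
    would then form a clique with \<open>Q\<close>, the others one with \<open>U'\<close>, and four
    cliques would suffice.\<close>
  have not_all: "\<exists>a\<in>privates. \<exists>t\<in>U. \<not> t \<approx> a"
    if U: "U = T1 \<and> U' = T2 \<or> U = T2 \<and> U' = T1" for U U'
  proof (rule ccontr)
    assume all: "\<not> ?thesis"
    have Uc: "clique U" "clique U'" "U \<noteq> {}" "U \<union> U' = T" using U T1c T2c T12 by auto
    have UT: "t \<approx> p" "p \<approx> t" "t \<in> rest" if "t \<in> U" for t using Tp U that by auto
    have Ua: "a \<approx> t" "t \<approx> a" if "t \<in> U" "a \<in> privates" for t a using all that sym by blast+
    have URA: "U \<subseteq> rest_complete" using Ua UT by (auto simp: rest_complete_def)
    define S1 where "S1 = {s \<in> SQ. \<forall>t\<in>U. t \<approx> s}"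
    define S2 where "S2 = SQ - S1"
    have S1: "clique S1"
    proof (rule cliqueI, rule ccontr)
      fix s s' assume s: "s \<in> S1" "s' \<in> S1" "\<not> s \<approx> s'"
      obtain t where t: "t \<in> U" using Uc(3) by auto
      have "s \<approx> t" "s' \<approx> t" using s t sym by (auto simp: S1_def)
      then show False using no_common_neighbour[of s s' t] s SQ(1) Ua(1)[OF t] by (auto simp: S1_def)
    qed
    have S2: "clique S2"
    proof (rule cliqueI, rule ccontr)
      fix s s' assume s: "s \<in> S2" "s' \<in> S2" "\<not> s \<approx> s'"
      have sQ: "s \<in> SQ" "s' \<in> SQ" using s by (auto simp: S2_def)
      obtain t where t: "t \<in> U" "\<not> t \<approx> s" using s(1) by (auto simp: S1_def S2_def)
      obtain t' where t': "t' \<in> U" "\<not> t' \<approx> s'" using s(2) by (auto simp: S1_def S2_def)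
      obtain a where a: "a \<in> privates" "a \<approx> s'"
        using rest_nonadjacent[OF SQ(1)[OF sQ(1)] SQ(1)[OF sQ(2)] s(3)] by metis
      have "s' \<approx> t" using nonadjacent_hit[of t s s'] s(3) SQ sQ UT[OF t(1)] t(2) sym by blast
      moreover have "a \<approx> t" "a \<approx> t'" "t' \<approx> t" "t' \<approx> p" "p \<approx> t" "s' \<approx> a"
        using Ua a t t' UT cliqueD[OF Uc(1)] sym by auto
      moreover have "\<not> s' \<approx> t'" "\<not> s' \<approx> p" "\<not> a \<approx> p" using t'(2) Sp SQ(2) sQ priv_p a sym by blast+
      ultimately show False using gem_free[of s' t a t' p] by blast
    qed
    have S2U: "t \<approx> s" if "t \<in> U'" "s \<in> S2" for t s
    proof -
      have "\<not> (\<forall>t\<in>U. t \<approx> s)" "s \<in> S" using that SQ by (auto simp: S1_def S2_def)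
      then show ?thesis using hitT[of s] U that(1) by blast
    qed
    have "clique (Q \<union> S1)" using Q_clique S1 SQ_Q by (auto intro!: clique_Un simp: S1_def)
    moreover have "clique (U' \<union> S2)" using Uc(2) S2 S2U by (intro clique_Un)
    moreover have "clique (privates \<union> rest_complete)"
      using privates_clique rest_complete_clique RA by (intro clique_Un)
    moreover have "V \<subseteq> (Z \<union> P) \<union> (Q \<union> S1) \<union> (U' \<union> S2) \<union> (privates \<union> rest_complete)"
    proof
      fix v assume "v \<in> V"
      then have "v \<in> Z \<or> v \<in> P \<or> v \<in> Q \<or> v \<in> privates \<or> v \<in> U \<or> v \<in> U' \<or> v \<in> S"
        using core_cases[of v] Uc(4) by (auto simp: S_def)
      then show "v \<in> (Z \<union> P) \<union> (Q \<union> S1) \<union> (U' \<union> S2) \<union> (privates \<union> rest_complete)"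
        using URA by (auto simp: S2_def SQ_def)
    qed
    ultimately show False using ZPc no_clique_cover by blast
  qed
  obtain b2 u1 where b2: "b2 \<in> privates" "u1 \<in> T1" "\<not> u1 \<approx> b2" using not_all[of T1 T2] by blast
  obtain b1 u2 where b1: "b1 \<in> privates" "u2 \<in> T2" "\<not> u2 \<approx> b1" using not_all[of T2 T1] by blast
  have bT: "\<forall>t\<in>T1. t \<approx> b1" "\<forall>t\<in>T2. t \<approx> b2" using hitT[of b1] hitT[of b2] b1 b2 by blast+
  \<comment> \<open>Otherwise \<open>p\<close>, \<open>u\<close>, \<open>b\<close>, \<open>a\<close>
    is an induced path around \<open>t\<close>. So once a private neighbour complete to
    \<open>U\<close> exists, any other is complete or anticomplete to \<open>U\<close>.\<close>
  have pure: "\<not> t \<approx> a" if a: "a \<in> privates" and u: "u \<in> U" "\<not> u \<approx> a" and t: "t \<in> U" and b: "b \<in> privates" "\<forall>t\<in>U. t \<approx> b"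
    and U: "U = T1 \<or> U = T2" for a u t b U
  proof
    assume ta: "t \<approx> a"
    have Uc: "clique U" "\<And>t. t \<in> U \<Longrightarrow> t \<approx> p \<and> p \<approx> t" using U T1c T2c Tp by auto
    have "p \<approx> t" "u \<approx> t" "b \<approx> t" "a \<approx> t" "p \<approx> u" "u \<approx> b" "b \<approx> a"
      using Uc(2) cliqueD[OF Uc(1)] cliqueD[OF privates_clique] a u t b ta sym by auto
    moreover have "\<not> p \<approx> b" "\<not> p \<approx> a" using priv_p a b by auto
    ultimately show False using gem_free[of p t u b a] u(2) by blast
  qed
  define B1 where "B1 = {a \<in> privates. \<forall>t\<in>T1. t \<approx> a}"
  define B2 where "B2 = {a \<in> privates. \<forall>t\<in>T2. t \<approx> a}"
  have bB: "b1 \<in> B1" "b2 \<in> B2" using b1 b2 bT by (auto simp: B1_def B2_def)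
  have b2T: "\<not> t \<approx> b2" if "t \<in> T1" for t using pure[of b2 u1 T1 t b1] b1 b2 bT that by blast
  have b1T: "\<not> t \<approx> b1" if "t \<in> T2" for t using pure[of b1 u2 T2 t b2] b1 b2 bT that by blast
  \<comment> \<open>A private neighbour complete to both halves would be the centre of the gem with
    path \<open>u1\<close>, \<open>b1\<close>, \<open>b2\<close>, \<open>u2\<close>.\<close>
  have B1T: "\<not> t \<approx> a" if a: "a \<in> B1" and t: "t \<in> T2" for a t
  proof
    assume ta: "t \<approx> a"
    have aP: "a \<in> privates" using a by (simp add: B1_def)
    have "u \<approx> a" if "u \<in> T2" for u using pure[of a u T2 t b2] aP that t b2(1) bT(2) ta by blast
    then have "u2 \<approx> a" "u1 \<approx> a" using b1(2) b2(2) a by (auto simp: B1_def)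
    moreover have "b1 \<approx> a" "b2 \<approx> a" "b1 \<approx> b2" using cliqueD[OF privates_clique] aP b1 b2 by auto
    moreover have "u1 \<approx> b1" "b2 \<approx> u2" "\<not> b1 \<approx> u2" using bT b1 b2 sym by blast+
    ultimately show False using gem_free[of u1 a b1 b2 u2] b2(3) anti[OF b2(2) b1(2)] by blast
  qed
  have B2T: "\<not> t \<approx> a" if a: "a \<in> B2" and t: "t \<in> T1" for a t
  proof
    assume ta: "t \<approx> a"
    have aP: "a \<in> privates" using a by (simp add: B2_def)
    have "u \<approx> a" if "u \<in> T1" for u using pure[of a u T1 t b1] aP that t b1(1) bT(1) ta by blast
    then have "a \<in> B1" using aP by (auto simp: B1_def)
    then show False using B1T[of a u2] a b1(2) by (auto simp: B2_def)
  qed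
  have B12: "a \<in> B1 \<or> a \<in> B2" if "a \<in> privates" for a using hitT[of a] that by (auto simp: B1_def B2_def)
  have no_mid: False if "t1 \<in> T1" "t2 \<in> T2" "a1 \<in> B1" "a2 \<in> B2" "t1 \<approx> w" "t2 \<approx> w" "a1 \<approx> w" "a2 \<approx> w" for t1 t2 a1 a2 w
  proof -
    have "t1 \<approx> a1" "a1 \<approx> a2" "a2 \<approx> t2" "\<not> a1 \<approx> t2"
      using that cliqueD[OF privates_clique] B1T[of a1 t2] sym by (auto simp: B1_def B2_def)
    then show False using gem_free[of t1 w a1 a2 t2] that B2T[of a2 t1] anti[of t1 t2] by blast
  qed
  \<comment> \<open>Both halves are treated at once. The private neighbour \<open>b\<close> is
    adjacent to all vertices of the union, so the two critical kinds of nonadjacent pairs, inside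
    \<open>?Y\<close> and between \<open>?X\<close> and \<open>?Y\<close>, yield gems with centre
    \<open>b\<close>.\<close>
  have half: "clique (B \<union> U \<union> {x \<in> S \<inter> rest_complete. \<forall>t\<in>U. t \<approx> x} \<union> {s \<in> SQ. \<forall>a\<in>B. a \<approx> s})"
    (is "clique (B \<union> U \<union> ?X \<union> ?Y)")
    and half': "\<And>s t. \<lbrakk>s \<in> SQ; a' \<in> B'; \<not> a' \<approx> s; t \<in> U\<rbrakk> \<Longrightarrow> t \<approx> s"
    if U: "U = T1 \<and> B = B1 \<and> B' = B2 \<and> b = b1 \<and> u = r \<or> U = T2 \<and> B = B2 \<and> B' = B1 \<and> b = b2 \<and> u = r'" for U B B' b u a'
  proof -
    have BU: "\<And>a t. a \<in> B \<Longrightarrow> t \<in> U \<Longrightarrow> a \<approx> t \<and> t \<approx> a" using U sym by (auto simp: B1_def B2_def)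
    have B'U: "\<And>a t. a \<in> B' \<Longrightarrow> t \<in> U \<Longrightarrow> \<not> a \<approx> t \<and> \<not> t \<approx> a" using U B1T B2T sym by blast
    have BP: "B \<subseteq> privates" "B' \<subseteq> privates" "privates \<subseteq> B \<union> B'" using U B12 by (auto simp: B1_def B2_def)
    have b: "b \<in> B" "u \<in> U" using U bB T12 by auto
    have Uc: "clique U" "\<And>t. t \<in> U \<Longrightarrow> t \<in> rest" using U T1c T2c Tp by auto
    show *: "t \<approx> s" if "s \<in> SQ" "a' \<in> B'" "\<not> a' \<approx> s" "t \<in> U" for s t a'
      using rest_private[of a' t s] SQ(1)[OF that(1)] that B'U[of a' t] BP Uc(2)[OF that(4)] by blast
    have miss: "\<exists>a'\<in>B'. \<not> a' \<approx> s" if sY: "s \<in> ?Y" for s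
    proof -
      obtain a' where "a' \<in> privates" "\<not> a' \<approx> s"
        using SQ(1)[of s] sY by (auto simp: rest_complete_def)
      then show ?thesis using BP(3) sY by blast
    qed
    have YU: "t \<approx> s" if "s \<in> ?Y" "t \<in> U" for s t
      using miss[OF that(1)] *[of s _ t] that by blast
    have Y: "clique ?Y"
    proof (rule cliqueI, rule ccontr)
      fix s s' assume s: "s \<in> ?Y" "s' \<in> ?Y" "\<not> s \<approx> s'"
      have "s \<approx> b" "s' \<approx> b" using s b sym by auto
      moreover have "a \<approx> b" if "a \<in> privates" for a using cliqueD[OF privates_clique that] b(1) BP(1) by blast
      ultimately show False using no_common_neighbour[of s s' b] s SQ(1) by auto
    qed
    have X: "clique ?X" by (rule clique_subset[OF rest_complete_clique]) auto
    have "clique B" using clique_subset[OF privates_clique BP(1)] .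
    then have BUc: "clique (B \<union> U)" using Uc(1) BU by (intro clique_Un) auto
    have BUX: "clique (B \<union> U \<union> ?X)" using BP(1) RA(2) by (intro clique_Un BUc X) auto
    show "clique (B \<union> U \<union> ?X \<union> ?Y)"
    proof (rule clique_Un[OF BUX Y])
      fix x s assume x: "x \<in> B \<union> U \<union> ?X" and s: "s \<in> ?Y"
      consider "x \<in> B" | "x \<in> U" | "x \<in> ?X" using x by blast
      then show "x \<approx> s"
      proof cases
        case 1 then show ?thesis using s by blast
      next
        case 2 then show ?thesis using YU[OF s] by blast
      next
        case 3
        obtain a' where a': "a' \<in> B'" "\<not> a' \<approx> s" using miss[OF s] by blast
        have bP: "b \<in> privates" "a' \<in> privates" using b(1) a'(1) BP by auto
        have "u \<approx> s" "u \<approx> x" "u \<approx> b" "s \<approx> b" "a' \<approx> x" "x \<approx> b" "a' \<approx> b"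
          using YU[OF s b(2)] 3 BU[OF b] s b(1,2) RA(2)[of x] sym cliqueD[OF privates_clique] bP by auto
        moreover have "s \<approx> u" "x \<approx> a'" "\<not> s \<approx> a'" "\<not> u \<approx> a'" using calculation a' sym B'U b by blast+
        ultimately show ?thesis using gem_free[of s b u x a'] sym[of s x] by blast
      qed
    qed
  qed
  \<comment> \<open>These vertices follow neither half. Each sees both \<open>r\<close> and
    \<open>r'\<close>, so by \<open>no_mid\<close> it is anticomplete to \<open>B1\<close> or to
    \<open>B2\<close>; by \<open>rest_private\<close> a nonadjacent second one would be complete to
    that set, contrary to its choice. Hence \<open>D\<close> is a clique and joins
    \<open>Q\<close>.\<close>
  define D where "D = {s \<in> SQ. \<not> (\<forall>a\<in>B1. a \<approx> s) \<and> \<not> (\<forall>a\<in>B2. a \<approx> s)}"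
  have D_anti: "(\<forall>a\<in>B1. \<not> a \<approx> s) \<or> (\<forall>a\<in>B2. \<not> a \<approx> s)" if s: "s \<in> D" for s
  proof (rule ccontr)
    assume "\<not> ?thesis"
    then obtain a1 a2 where a: "a1 \<in> B1" "a2 \<in> B2" "a1 \<approx> s" "a2 \<approx> s" by blast
    obtain c1 c2 where c: "c1 \<in> B1" "c2 \<in> B2" "\<not> c1 \<approx> s" "\<not> c2 \<approx> s" using s by (auto simp: D_def)
    have "s \<in> SQ" using s by (simp add: D_def)
    then have "r \<approx> s" "r' \<approx> s"
      using half'[of T1 B1 B2 b1 r s c2 r] half'[of T2 B2 B1 b2 r' s c1 r'] c T12 by blast+
    then show False using no_mid[of r r' a1 a2 s] a T12 by blast
  qed
  have D: "clique D"
  proof (rule cliqueI, rule ccontr)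
    fix s t assume st: "s \<in> D" "t \<in> D" "\<not> s \<approx> t"
    then have R: "s \<in> rest" "t \<in> rest" using SQ(1) by (auto simp: D_def)
    have one: "a \<approx> s \<or> a \<approx> t" if "a \<in> privates" for a
      using rest_private[OF that R] st(3) by blast
    have "(\<forall>a\<in>B1. a \<approx> t) \<or> (\<forall>a\<in>B2. a \<approx> t)" using D_anti[OF st(1)] one by (auto simp: B1_def B2_def)
    then show False using st(2) by (auto simp: D_def)
  qed
  have "clique (Q \<union> D)" using Q_clique D SQ_Q by (auto intro!: clique_Un simp: D_def)
  moreover have "V \<subseteq> (Z \<union> P) \<union> (Q \<union> D)
      \<union> (B1 \<union> T1 \<union> {x \<in> S \<inter> rest_complete. \<forall>t\<in>T1. t \<approx> x} \<union> {s \<in> SQ. \<forall>a\<in>B1. a \<approx> s})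
      \<union> (B2 \<union> T2 \<union> {x \<in> S \<inter> rest_complete. \<forall>t\<in>T2. t \<approx> x} \<union> {s \<in> SQ. \<forall>a\<in>B2. a \<approx> s})"
    (is "V \<subseteq> ?all")
  proof
    fix v assume "v \<in> V"
    then consider "v \<in> Z \<or> v \<in> P \<or> v \<in> Q" | "v \<in> privates" | "v \<in> T" | "v \<in> S \<inter> rest_complete" | "v \<in> SQ"
      using core_cases[of v] by (auto simp: S_def SQ_def)
    then show "v \<in> ?all"
    proof cases
      case 2 then show ?thesis using B12 by blast
    next
      case 3 then show ?thesis using T12 by blast
    next
      case 4 then show ?thesis using hitT[of v] by blast
    next
      case 5 then show ?thesis unfolding D_def by blast
    qed blast
  qed
  moreover note half[of T1 B1 B2 b1 r] half[of T2 B2 B1 b2 r'] ZPc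
  ultimately show False using no_clique_cover by blast
qed

text \<open>With \<open>core_swap\<close>, the absence of bad pairs applies to \<open>P\<close> and
  \<open>Q\<close> alike, so the vertices outside \<open>rest_complete\<close> can be distributed to
  these two cliques. The other two are \<open>Z\<close> and the union of \<open>privates\<close> and
  \<open>rest_complete\<close>.\<close>

lemma core_impossible: False
proof -
  let ?S = "rest - rest_complete"
  have P: "clique {s \<in> ?S. \<forall>x\<in>P. x \<approx> s}" using no_bad_P_pair by (auto intro!: cliqueI)
  interpret sw: core V "(\<approx>)" Z Q P by (rule core_swap)
  have "sw.privates = privates" by (auto simp: privates_def sw.privates_def)
  then have "sw.rest = rest" by (auto simp: rest_def sw.rest_def)
  then have "sw.rest_complete = rest_complete"
    using \<open>sw.privates = privates\<close> by (simp add: rest_complete_def sw.rest_complete_def)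
  then have Q: "clique {s \<in> ?S. \<forall>x\<in>Q. x \<approx> s}"
    using sw.no_bad_P_pair \<open>sw.rest = rest\<close> by (auto intro!: cliqueI)
  have "clique (P \<union> {s \<in> ?S. \<forall>x\<in>P. x \<approx> s})" "clique (Q \<union> {s \<in> ?S. \<forall>x\<in>Q. x \<approx> s})"
    using P Q P_clique Q_clique by (auto intro!: clique_Un)
  moreover have "clique (privates \<union> rest_complete)"
    using privates_clique rest_complete_clique by (auto intro!: clique_Un simp: rest_complete_def)
  moreover have "V \<subseteq> Z \<union> (P \<union> {s \<in> ?S. \<forall>x\<in>P. x \<approx> s}) \<union> (Q \<union> {s \<in> ?S. \<forall>x\<in>Q. x \<approx> s}) \<union> (privates \<union> rest_complete)"
    using core_cases rest_cases by blast
  ultimately show False using Z_clique no_clique_cover by blast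
qed

end

lemma (in critical_cogem_complement) no_diamond:
  assumes "d \<approx> u" "d \<noteq> u" "p \<approx> u" "p \<approx> d" "q \<approx> u" "q \<approx> d"
  shows "p \<approx> q"
proof (rule ccontr)
  assume "\<not> p \<approx> q"
  then obtain Z P Q where "core V (\<approx>) Z P Q" using diamond_core assms by metis
  then show False by (rule core.core_impossible)
qed

section \<open>Diamond-free counterexamples\<close>

context critical_cogem_complement
begin

lemma nbh_trans:
  assumes "x \<in> nbh v" "y \<in> nbh v" "z \<in> nbh v" "x \<approx> y" "y \<approx> z"
  shows "x \<approx> z"
  using no_diamond[of y v x z] assms sym[of y z] by (simp add: in_nbh)

text \<open>Otherwise \<open>m\<close> and \<open>v\<close> are the tips of a diamond with axis
  \<open>x\<close>, \<open>y\<close>.\<close>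

lemma far_unique:
  assumes "m \<in> far v" "x \<in> nbh v" "y \<in> nbh v" "x \<approx> y" "x \<approx> m" "y \<approx> m"
  shows "x = y"
proof (rule ccontr)
  assume "x \<noteq> y"
  have "m \<approx> x" "m \<approx> y" "v \<approx> x" "v \<approx> y" using assms sym by (auto simp: in_nbh)
  then have "m \<approx> v" using no_diamond[of x y m v] assms(4) \<open>x \<noteq> y\<close> by simp
  then show False using assms(1) by (simp add: in_far)
qed

text \<open>Relative to a distant vertex \<open>u\<close>, the others split into a clique
  \<open>L\<close> of nonneighbours and two cliques of neighbours. If one of the latter had two
  vertices, the other could be merged with \<open>L\<close>, leaving two cliques in all; so both are
  singletons. Absence of diamonds then shrinks \<open>L\<close> to an edge, and a pentagon
  remains.\<close>

lemma far_two_cliques_or_pentagon: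
  assumes v: "v \<in> V"
  shows "(\<exists>K L. clique K \<and> clique L \<and> far v \<subseteq> K \<union> L) \<or>
    (\<exists>c1 c2 c3 c4 c5. far v = {c1, c2, c3, c4, c5} \<and> c1 \<approx> c2 \<and> c2 \<approx> c3 \<and> c3 \<approx> c4 \<and> c4 \<approx> c5 \<and> c5 \<approx> c1 \<and>
      \<not> c1 \<approx> c3 \<and> \<not> c1 \<approx> c4 \<and> \<not> c2 \<approx> c4 \<and> \<not> c2 \<approx> c5 \<and> \<not> c3 \<approx> c5)"
proof (rule ccontr)
  assume neg: "\<not> ?thesis"
  define M where "M = far v"
  have "M \<subseteq> V" by (auto simp: M_def in_far)
  have a2: "a \<approx> b \<or> a \<approx> c \<or> b \<approx> c" if "a \<in> M" "b \<in> M" "c \<in> M" for a b c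
    using far_alpha[OF _ _ _ v] that by (simp add: M_def)
  note neg = neg[folded M_def]
  from neg have two: False if "clique K" "clique L" "M \<subseteq> K \<union> L" for K L using that by blast
  have "M \<noteq> {}" using two[of "{}" "{}"] by auto
  then obtain u where u: "u \<in> M" by auto
  have uV: "u \<in> V" using u \<open>M \<subseteq> V\<close> by auto
  define L where "L = {x \<in> M. \<not> x \<approx> u}"
  define U where "U = {x \<in> M. x \<approx> u \<and> x \<noteq> u}"
  have L: "clique L" using a2[OF _ _ u] by (auto simp: L_def intro!: cliqueI)
  have UN: "U \<subseteq> nbh u" "U \<subseteq> M" by (auto simp: U_def in_nbh)
  have LF: "L \<subseteq> far u" "L \<subseteq> M" using \<open>M \<subseteq> V\<close> by (auto simp: L_def in_far)
  have "\<not> clique U"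
  proof
    assume "clique U"
    then have "clique (insert u U)" using uV by (intro clique_insert) (auto simp: U_def)
    moreover have "M \<subseteq> insert u U \<union> L" by (auto simp: U_def L_def)
    ultimately show False using two L by blast
  qed
  then obtain k1 k2 where k: "k1 \<in> U" "k2 \<in> U" "\<not> k1 \<approx> k2" by (auto simp: clique_def)
  have k': "\<not> k2 \<approx> k1" using k(3) sym by blast
  \<comment> \<open>Neither \<open>i\<close> nor \<open>x\<close> is adjacent to \<open>y\<close>,
    so an \<open>l\<close> missing \<open>y\<close> sees both, which \<open>far_unique\<close>
    forbids.\<close>
  have cross: "\<forall>l\<in>L. \<forall>y\<in>{y \<in> U. y \<approx> j}. l \<approx> y"
    if ij: "i = k1 \<and> j = k2 \<or> i = k2 \<and> j = k1" and x: "x \<in> U" "x \<approx> i" "x \<noteq> i" for i j x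
  proof (intro ballI)
    fix l y assume l: "l \<in> L" and y: "y \<in> {y \<in> U. y \<approx> j}"
    have i: "i \<in> U" "j \<in> U" "\<not> i \<approx> j" "i \<in> nbh u" "j \<in> nbh u" "x \<in> nbh u" "y \<in> nbh u" using ij k k' x y UN by auto
    have "i \<approx> x" using x sym by blast
    have "\<not> i \<approx> y" "\<not> x \<approx> y"
      using nbh_trans[of i u y j] nbh_trans[of x u y j] nbh_trans[of i u x j] i y \<open>i \<approx> x\<close> by auto
    then have "l \<approx> i \<or> l \<approx> y" "l \<approx> x \<or> l \<approx> y"
      using a2[of l i y] a2[of l x y] i x y l UN LF by auto
    moreover have "\<not> (l \<approx> i \<and> l \<approx> x)"
      using far_unique[of l u i x] i x l LF \<open>i \<approx> x\<close> sym[of l i] sym[of l x] by auto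
    ultimately show "l \<approx> y" by blast
  qed
  have split: "x \<approx> k1 \<or> x \<approx> k2" if "x \<in> U" for x
    using a2[of x k1 k2] that k UN by auto
  have Kc: "clique {x \<in> U. x \<approx> i}" if "i \<in> U" for i
  proof (rule cliqueI)
    fix x y assume "x \<in> {x \<in> U. x \<approx> i}" "y \<in> {x \<in> U. x \<approx> i}"
    then show "x \<approx> y" using nbh_trans[of x u i y] UN that sym[of y i] by blast
  qed
  have uK: "clique (insert u {x \<in> U. x \<approx> i})" if "i \<in> U" for i
    using Kc[OF that] uV by (rule clique_insert) (auto simp: U_def)
  have cov: "M \<subseteq> insert u {x \<in> U. x \<approx> i} \<union> (L \<union> {x \<in> U. x \<approx> j})"
    if "i = k1 \<and> j = k2 \<or> i = k2 \<and> j = k1" for i j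
    using split that by (auto simp: U_def L_def)
  have single: "x = i" if ij: "i = k1 \<and> j = k2 \<or> i = k2 \<and> j = k1" and x: "x \<in> U" "x \<approx> i" for i j x
  proof (rule ccontr)
    assume "x \<noteq> i"
    have ijU: "i \<in> U" "j \<in> U" using ij k by auto
    have "clique (L \<union> {y \<in> U. y \<approx> j})"
      by (rule clique_Un[OF L Kc[OF ijU(2)]]) (use cross[OF ij x \<open>x \<noteq> i\<close>] in blast)
    then show False using two uK[OF ijU(1)] cov[OF ij] by blast
  qed
  have ij: "k1 = k1 \<and> k2 = k2 \<or> k1 = k2 \<and> k2 = k1" "k2 = k1 \<and> k1 = k2 \<or> k2 = k2 \<and> k1 = k1" by auto
  have U: "U \<subseteq> {k1, k2}" using split single[OF ij(1)] single[OF ij(2)] by blast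
  have miss: "\<exists>l\<in>L. \<not> l \<approx> j" if ij: "i = k1 \<and> j = k2 \<or> i = k2 \<and> j = k1" for i j
  proof (rule ccontr)
    assume n: "\<not> ?thesis"
    have ijU: "i \<in> U" "j \<in> U" using ij k by auto
    have "clique (L \<union> {y \<in> U. y \<approx> j})"
    proof (rule clique_Un[OF L Kc[OF ijU(2)]])
      fix x y assume "x \<in> L" "y \<in> {y \<in> U. y \<approx> j}"
      moreover have "j = k2 \<and> i = k1 \<or> j = k1 \<and> i = k2" using ij by auto
      ultimately show "x \<approx> y" using n single[of j i y] ij by blast
    qed
    then show False using two uK[OF ijU(1)] cov[OF ij] by blast
  qed
  obtain l1 where l1: "l1 \<in> L" "\<not> l1 \<approx> k2" using miss[OF ij(1)] by blast
  obtain l2 where l2: "l2 \<in> L" "\<not> l2 \<approx> k1" using miss[OF ij(2)] by blast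
  have l1k: "l1 \<approx> k1" and l2k: "l2 \<approx> k2"
    using a2[of l1 k1 k2] a2[of l2 k1 k2] l1 l2 k UN LF by blast+
  have l12: "l1 \<approx> l2" "l2 \<approx> l1" using cliqueD[OF L] l1 l2 by auto
  have ne: "l1 \<noteq> l2" using l1k l2 by auto
  have Leq: "l3 = l1 \<or> l3 = l2" if l3: "l3 \<in> L" for l3
  proof (rule ccontr)
    assume n: "\<not> ?thesis"
    have c: "l3 \<approx> l1" "l3 \<approx> l2" "l1 \<approx> l3" "l2 \<approx> l3" using cliqueD[OF L] l1 l2 l3 by auto
    have "l3 \<approx> k1 \<or> l3 \<approx> k2" using a2[of l3 k1 k2] l3 k UN LF by blast
    then show False
    proof
      assume "l3 \<approx> k1"
      then have "l2 \<approx> k1" using no_diamond[of l1 l3 l2 k1] c l12 l1k n sym by blast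
      then show False using l2 by simp
    next
      assume "l3 \<approx> k2"
      then have "l1 \<approx> k2" using no_diamond[of l2 l3 l1 k2] c l12 l2k n sym by blast
      then show False using l1 by simp
    qed
  qed
  have "M = {u, k1, l1, l2, k2}" using u k UN U l1 l2 LF Leq by (auto simp: U_def L_def)
  moreover have "u \<approx> k1" "k1 \<approx> l1" "l2 \<approx> k2" "k2 \<approx> u" "\<not> u \<approx> l1" "\<not> u \<approx> l2" "\<not> k1 \<approx> l2" "\<not> k1 \<approx> k2" "\<not> l1 \<approx> k2"
    using k l1 l2 l1k l2k sym by (auto simp: U_def L_def)
  ultimately show False using neg l12(1) by metis
qed

end

text \<open>Here \<open>ai\<close> says that a vertex \<open>a\<close> is adjacent to the \<open>i\<close>-th vertex of the pentagon. The
  disjunctions come from the absence of independent sets of size four, the threefold conjunctions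
  would give diamonds, and the fourfold ones covers.\<close>

lemma pentagon_hits_consecutive:
  fixes a1 a2 a3 a4 a5 :: bool
  assumes "a1 \<or> a3" "a3 \<or> a5" "a5 \<or> a2" "a2 \<or> a4" "a4 \<or> a1"
  shows "a1 \<and> a2 \<and> a3 \<or> a2 \<and> a3 \<and> a4 \<or> a3 \<and> a4 \<and> a5 \<or> a4 \<and> a5 \<and> a1 \<or> a5 \<and> a1 \<and> a2"
  using assms by blast

text \<open>The case of neighbourhood cliques \<open>{a, a'}\<close> and \<open>{b, b'}\<close>. The
  first ten hypotheses say that a vertex of the pentagon sees at most one vertex of each
  clique.\<close>

lemma pentagon_two_pairs:
  fixes a1 a2 a3 a4 a5 a1' a2' a3' a4' a5' b1 b2 b3 b4 b5 b1' b2' b3' b4' b5' :: bool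
  assumes "\<not> (a1 \<and> a1')" "\<not> (a2 \<and> a2')" "\<not> (a3 \<and> a3')" "\<not> (a4 \<and> a4')" "\<not> (a5 \<and> a5')"
    and "\<not> (b1 \<and> b1')" "\<not> (b2 \<and> b2')" "\<not> (b3 \<and> b3')" "\<not> (b4 \<and> b4')" "\<not> (b5 \<and> b5')"
    and "a1 \<or> a3 \<or> b1 \<or> b3" "a3 \<or> a5 \<or> b3 \<or> b5" "a5 \<or> a2 \<or> b5 \<or> b2" "a2 \<or> a4 \<or> b2 \<or> b4" "a4 \<or> a1 \<or> b4 \<or> b1"
    and "a1 \<or> a3 \<or> b1' \<or> b3'" "a3 \<or> a5 \<or> b3' \<or> b5'" "a5 \<or> a2 \<or> b5' \<or> b2'" "a2 \<or> a4 \<or> b2' \<or> b4'" "a4 \<or> a1 \<or> b4' \<or> b1'"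
    and "a1' \<or> a3' \<or> b1 \<or> b3" "a3' \<or> a5' \<or> b3 \<or> b5" "a5' \<or> a2' \<or> b5 \<or> b2" "a2' \<or> a4' \<or> b2 \<or> b4" "a4' \<or> a1' \<or> b4 \<or> b1"
    and "a1' \<or> a3' \<or> b1' \<or> b3'" "a3' \<or> a5' \<or> b3' \<or> b5'" "a5' \<or> a2' \<or> b5' \<or> b2'" "a2' \<or> a4' \<or> b2' \<or> b4'" "a4' \<or> a1' \<or> b4' \<or> b1'"
    and "\<not> (a1 \<and> a2 \<and> a3)" "\<not> (a2 \<and> a3 \<and> a4)" "\<not> (a3 \<and> a4 \<and> a5)" "\<not> (a4 \<and> a5 \<and> a1)" "\<not> (a5 \<and> a1 \<and> a2)"
    and "\<not> (a1' \<and> a2' \<and> a3')" "\<not> (a2' \<and> a3' \<and> a4')" "\<not> (a3' \<and> a4' \<and> a5')" "\<not> (a4' \<and> a5' \<and> a1')" "\<not> (a5' \<and> a1' \<and> a2')"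
    and "\<not> (b1 \<and> b2 \<and> b3)" "\<not> (b2 \<and> b3 \<and> b4)" "\<not> (b3 \<and> b4 \<and> b5)" "\<not> (b4 \<and> b5 \<and> b1)" "\<not> (b5 \<and> b1 \<and> b2)"
    and "\<not> (b1' \<and> b2' \<and> b3')" "\<not> (b2' \<and> b3' \<and> b4')" "\<not> (b3' \<and> b4' \<and> b5')" "\<not> (b4' \<and> b5' \<and> b1')" "\<not> (b5' \<and> b1' \<and> b2')"
    and "\<not> (a1 \<and> a2 \<and> a3' \<and> a4')" "\<not> (a2 \<and> a3 \<and> a4' \<and> a5')" "\<not> (a3 \<and> a4 \<and> a5' \<and> a1')" "\<not> (a4 \<and> a5 \<and> a1' \<and> a2')" "\<not> (a5 \<and> a1 \<and> a2' \<and> a3')"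
    and "\<not> (a1' \<and> a2' \<and> a3 \<and> a4)" "\<not> (a2' \<and> a3' \<and> a4 \<and> a5)" "\<not> (a3' \<and> a4' \<and> a5 \<and> a1)" "\<not> (a4' \<and> a5' \<and> a1 \<and> a2)" "\<not> (a5' \<and> a1' \<and> a2 \<and> a3)"
    and "\<not> (b1 \<and> b2 \<and> b3' \<and> b4')" "\<not> (b2 \<and> b3 \<and> b4' \<and> b5')" "\<not> (b3 \<and> b4 \<and> b5' \<and> b1')" "\<not> (b4 \<and> b5 \<and> b1' \<and> b2')" "\<not> (b5 \<and> b1 \<and> b2' \<and> b3')"
    and "\<not> (b1' \<and> b2' \<and> b3 \<and> b4)" "\<not> (b2' \<and> b3' \<and> b4 \<and> b5)" "\<not> (b3' \<and> b4' \<and> b5 \<and> b1)" "\<not> (b4' \<and> b5' \<and> b1 \<and> b2)" "\<not> (b5' \<and> b1' \<and> b2 \<and> b3)"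
  shows False
  using assms by sat

section \<open>Neighbourhoods consisting of two cliques\<close>

context critical_cogem_complement
begin

text \<open>Otherwise the neighbourhood is the union of cliques \<open>A\<close> and
  \<open>B\<close>. Two more cliques cannot cover the nonneighbours, so these form a pentagon, and
  counting adjacencies to it leaves only two vertices in each of \<open>A\<close> and
  \<open>B\<close>.\<close>

lemma claw_centre:
  assumes v: "v \<in> V"
  obtains a b c where "a \<in> nbh v" "b \<in> nbh v" "c \<in> nbh v" "\<not> a \<approx> b" "\<not> a \<approx> c" "\<not> b \<approx> c"
proof (rule ccontr)
  assume no: "\<not> thesis"
  obtain A B where AB: "A \<noteq> {}" "B \<noteq> {}" "A \<inter> B = {}" "A \<union> B = nbh v"
    "\<And>x y. x \<in> A \<Longrightarrow> y \<in> B \<Longrightarrow> \<not> x \<approx> y" by (rule nbh_split[OF v]) blast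
  have BA: "\<not> y \<approx> x" if "x \<in> A" "y \<in> B" for x y using AB(5)[OF that] sym by blast
  obtain a0 b0 where a0: "a0 \<in> A" and b0: "b0 \<in> B" using AB by blast
  have A: "clique A"
  proof (rule cliqueI, rule ccontr)
    fix x y assume "x \<in> A" "y \<in> A" "\<not> x \<approx> y"
    then show False using no that[of x y b0] AB(4,5) b0 by blast
  qed
  have B: "clique B"
  proof (rule cliqueI, rule ccontr)
    fix x y assume "x \<in> B" "y \<in> B" "\<not> x \<approx> y"
    then show False using no that[of a0 x y] AB(4,5) a0 by blast
  qed
  have sub: "A \<subseteq> nbh v" "B \<subseteq> nbh v" "A \<subseteq> V" "B \<subseteq> V" using AB(4) nbh_subset by blast+
  have vA: "clique (insert v A)" and vB: "clique (insert v B)"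
    using A B v sub(1,2) by (auto intro!: clique_insert simp: in_nbh)
  have V: "x = v \<or> x \<in> A \<or> x \<in> B \<or> x \<in> far v" if "x \<in> V" for x using V_cases[OF that] AB(4) by blast
  from far_two_cliques_or_pentagon[OF v] show False
  proof (elim disjE exE conjE)
    fix K L assume KL: "clique K" "clique L" "far v \<subseteq> K \<union> L"
    have "V \<subseteq> insert v A \<union> B \<union> K \<union> L" using V KL(3) by blast
    then show False using no_clique_cover vA B KL by blast
  next
    fix c1 c2 c3 c4 c5
    assume C: "far v = {c1, c2, c3, c4, c5}" and e: "c1 \<approx> c2" "c2 \<approx> c3" "c3 \<approx> c4" "c4 \<approx> c5" "c5 \<approx> c1"
      and ne: "\<not> c1 \<approx> c3" "\<not> c1 \<approx> c4" "\<not> c2 \<approx> c4" "\<not> c2 \<approx> c5" "\<not> c3 \<approx> c5"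
    have e': "c2 \<approx> c1" "c3 \<approx> c2" "c4 \<approx> c3" "c5 \<approx> c4" "c1 \<approx> c5" using e sym by blast+
    have ne': "\<not> c3 \<approx> c1" "\<not> c4 \<approx> c1" "\<not> c4 \<approx> c2" "\<not> c5 \<approx> c2" "\<not> c5 \<approx> c3" using ne sym by blast+
    have cV: "c1 \<in> V" "c2 \<in> V" "c3 \<in> V" "c4 \<in> V" "c5 \<in> V" using in_V e by blast+
    have cF: "c1 \<in> far v" "c2 \<in> far v" "c3 \<in> far v" "c4 \<in> far v" "c5 \<in> far v" using C by auto
    have path: "\<not> (x \<approx> c1 \<and> x \<approx> c2 \<and> x \<approx> c3)" "\<not> (x \<approx> c2 \<and> x \<approx> c3 \<and> x \<approx> c4)" "\<not> (x \<approx> c3 \<and> x \<approx> c4 \<and> x \<approx> c5)"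
      "\<not> (x \<approx> c4 \<and> x \<approx> c5 \<and> x \<approx> c1)" "\<not> (x \<approx> c5 \<and> x \<approx> c1 \<and> x \<approx> c2)" if "x \<in> nbh v" for x
    proof -
      have "x \<noteq> c1" "x \<noteq> c2" "x \<noteq> c3" "x \<noteq> c4" "x \<noteq> c5" using that cF by (auto simp: in_nbh in_far)
      then show "\<not> (x \<approx> c1 \<and> x \<approx> c2 \<and> x \<approx> c3)" "\<not> (x \<approx> c2 \<and> x \<approx> c3 \<and> x \<approx> c4)" "\<not> (x \<approx> c3 \<and> x \<approx> c4 \<and> x \<approx> c5)"
        "\<not> (x \<approx> c4 \<and> x \<approx> c5 \<and> x \<approx> c1)" "\<not> (x \<approx> c5 \<and> x \<approx> c1 \<and> x \<approx> c2)"
        using no_diamond[of x c2 c1 c3] no_diamond[of x c3 c2 c4] no_diamond[of x c4 c3 c5]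
          no_diamond[of x c5 c4 c1] no_diamond[of x c1 c5 c2] e e' ne ne' sym by blast+
    qed
    have hits: "a \<approx> x \<or> a \<approx> y \<or> b \<approx> x \<or> b \<approx> y" if "a \<in> A" "b \<in> B" "x \<in> V" "y \<in> V" "\<not> x \<approx> y" for a b x y
      using alpha[of a b x y] AB(5)[OF that(1,2)] sub that by blast
    have hits5: "a \<approx> c1 \<or> a \<approx> c3 \<or> b \<approx> c1 \<or> b \<approx> c3" "a \<approx> c3 \<or> a \<approx> c5 \<or> b \<approx> c3 \<or> b \<approx> c5"
      "a \<approx> c5 \<or> a \<approx> c2 \<or> b \<approx> c5 \<or> b \<approx> c2" "a \<approx> c2 \<or> a \<approx> c4 \<or> b \<approx> c2 \<or> b \<approx> c4"
      "a \<approx> c4 \<or> a \<approx> c1 \<or> b \<approx> c4 \<or> b \<approx> c1" if "a \<in> A" "b \<in> B" for a b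
      using hits[OF that] cV ne ne' by blast+
    have once: "x = y" if "K = A \<or> K = B" "x \<in> K" "y \<in> K" "x \<approx> c" "y \<approx> c" "c \<in> far v" for K x y c
      using far_unique[of c v x y] that sub cliqueD[OF A] cliqueD[OF B] by blast
    have edge: "clique {x, y}" if "x \<approx> y" for x y
      using that sym refl in_V[OF that] by (auto simp: clique_def)
    have tri: "clique {x, y, z}" if "x \<approx> y" "x \<approx> z" "y \<approx> z" for x y z
      by (intro clique_insert edge) (use that in_V sym in auto)
    \<comment> \<open>If \<open>b\<close> saw a vertex of the pentagon, this edge and two more would
      cover \<open>b\<close> and the pentagon. Hence \<open>b\<close> sees none, so \<open>a\<close>
      alone meets every nonadjacent pair and a diamond arises.\<close>
    have card1: False if K: "K = A \<and> L = B \<or> K = B \<and> L = A" and b: "L = {b}" for K L b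
    proof -
      obtain a where a: "a \<in> K" using K a0 b0 by blast
      have vK: "clique (insert v K)" using K vA vB by auto
      have bn: "a \<in> nbh v" "b \<in> nbh v" using K a b sub by auto
      have cov: "V \<subseteq> insert v K \<union> {b, c1, c2, c3, c4, c5}" using V K b C by blast
      have "\<not> b \<approx> c1"
      proof
        assume "b \<approx> c1"
        note edge[OF this] edge[OF e(2)] edge[OF e(4)]
        moreover have "V \<subseteq> insert v K \<union> {b, c1} \<union> {c2, c3} \<union> {c4, c5}" using cov by blast
        ultimately show False using no_clique_cover vK by blast
      qed
      moreover have "\<not> b \<approx> c2"
      proof
        assume "b \<approx> c2"
        note edge[OF this] edge[OF e(3)] edge[OF e(5)]
        moreover have "V \<subseteq> insert v K \<union> {b, c2} \<union> {c3, c4} \<union> {c5, c1}" using cov by blast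
        ultimately show False using no_clique_cover vK by blast
      qed
      moreover have "\<not> b \<approx> c3"
      proof
        assume "b \<approx> c3"
        note edge[OF this] edge[OF e(4)] edge[OF e(1)]
        moreover have "V \<subseteq> insert v K \<union> {b, c3} \<union> {c4, c5} \<union> {c1, c2}" using cov by blast
        ultimately show False using no_clique_cover vK by blast
      qed
      moreover have "\<not> b \<approx> c4"
      proof
        assume "b \<approx> c4"
        note edge[OF this] edge[OF e(5)] edge[OF e(2)]
        moreover have "V \<subseteq> insert v K \<union> {b, c4} \<union> {c5, c1} \<union> {c2, c3}" using cov by blast
        ultimately show False using no_clique_cover vK by blast
      qed
      moreover have "\<not> b \<approx> c5"
      proof
        assume "b \<approx> c5"
        note edge[OF this] edge[OF e(1)] edge[OF e(3)]
        moreover have "V \<subseteq> insert v K \<union> {b, c5} \<union> {c1, c2} \<union> {c3, c4}" using cov by blast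
        ultimately show False using no_clique_cover vK by blast
      qed
      moreover have "a \<approx> x \<or> a \<approx> y \<or> b \<approx> x \<or> b \<approx> y" if xy: "x \<in> V" "y \<in> V" "\<not> x \<approx> y" for x y
      proof -
        have "a \<in> A \<and> b \<in> B \<or> b \<in> A \<and> a \<in> B" using K a b by auto
        then show ?thesis using hits[of a b x y] hits[of b a x y] xy by blast
      qed
      note this[OF cV(1,3) ne(1)] this[OF cV(3,5) ne(5)] this[OF cV(5,2) ne'(4)] this[OF cV(2,4) ne(3)] this[OF cV(4,1) ne'(2)]
      ultimately show False
        using pentagon_hits_consecutive[of "a \<approx> c1" "a \<approx> c3" "a \<approx> c5" "a \<approx> c2" "a \<approx> c4"] path[OF bn(1)] by argo
    qed
    \<comment> \<open>If \<open>a\<close> missed the nonadjacent \<open>x\<close> and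
      \<open>y\<close>, each of three vertices of \<open>L\<close> would see one of them, whereas
      each of \<open>x\<close>, \<open>y\<close> is seen by at most one. So again \<open>a\<close>
      meets every nonadjacent pair.\<close>
    have card3: False if K: "K = A \<and> L = B \<or> K = B \<and> L = A" and b: "b \<in> L" "b' \<in> L" "b'' \<in> L" "b \<noteq> b'" "b \<noteq> b''" "b' \<noteq> b''"
      for K L b b' b''
    proof -
      obtain a where a: "a \<in> K" using K a0 b0 by blast
      have an: "a \<in> nbh v" using K a sub by auto
      have "a \<approx> x \<or> a \<approx> y" if xy: "x \<in> far v" "y \<in> far v" "\<not> x \<approx> y" for x y
      proof (rule ccontr)
        assume n: "\<not> ?thesis"
        have xyV: "x \<in> V" "y \<in> V" using xy by (auto simp: in_far)
        have "l \<approx> x \<or> l \<approx> y" if "l \<in> L" for l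
          using hits[of a l x y] hits[of l a x y] K a that n xyV xy(3) by auto
        then have "b \<approx> x \<or> b \<approx> y" "b' \<approx> x \<or> b' \<approx> y" "b'' \<approx> x \<or> b'' \<approx> y" using b by auto
        moreover have "L = A \<or> L = B" using K by auto
        ultimately show False using once[of L] b xy by metis
      qed
      then have "a \<approx> c1 \<or> a \<approx> c3" "a \<approx> c3 \<or> a \<approx> c5" "a \<approx> c5 \<or> a \<approx> c2" "a \<approx> c2 \<or> a \<approx> c4" "a \<approx> c4 \<or> a \<approx> c1"
        using cF ne ne' by blast+
      then show False
        using pentagon_hits_consecutive[of "a \<approx> c1" "a \<approx> c3" "a \<approx> c5" "a \<approx> c2" "a \<approx> c4"] path[OF an] by blast
    qed
    have pair: "\<exists>x y. L = {x, y} \<and> x \<noteq> y" if K: "K = A \<and> L = B \<or> K = B \<and> L = A" for K L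
    proof -
      have "L \<noteq> {}" using K AB by auto
      then obtain x where x: "x \<in> L" by auto
      have "L \<noteq> {x}" using card1[OF K] by auto
      then obtain y where y: "y \<in> L" "y \<noteq> x" using x by auto
      have "z \<in> {x, y}" if "z \<in> L" for z using card3[OF K x y(1) that] y(2) by auto
      then have "L = {x, y}" using x y by auto
      then show ?thesis using y(2) by auto
    qed
    obtain a a' where a: "A = {a, a'}" "a \<noteq> a'" using pair[of B A] by auto
    obtain b b' where b: "B = {b, b'}" "b \<noteq> b'" using pair[of A B] by auto
    have mem: "a \<in> A" "a' \<in> A" "b \<in> B" "b' \<in> B" using a b by auto
    have N: "a \<in> nbh v" "a' \<in> nbh v" "b \<in> nbh v" "b' \<in> nbh v" using mem sub by auto
    have onceA: "\<not> (a \<approx> c \<and> a' \<approx> c)" "\<not> (b \<approx> c \<and> b' \<approx> c)" if "c \<in> far v" for c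
      using once[of A a a' c] once[of B b b' c] that mem a(2) b(2) by auto
    \<comment> \<open>Two triangles and the fifth vertex of the pentagon would cover everything
      outside \<open>v\<close> and \<open>K\<close>.\<close>
    have no: "\<not> (x \<approx> d1 \<and> x \<approx> d2 \<and> x' \<approx> d3 \<and> x' \<approx> d4)"
      if K: "K = A \<and> L = {x, x'} \<and> L = B \<or> K = B \<and> L = {x, x'} \<and> L = A" and d: "far v = {d1, d2, d3, d4, d5}" "d1 \<approx> d2" "d3 \<approx> d4"
      for x x' d1 d2 d3 d4 d5 K L
    proof
      assume x: "x \<approx> d1 \<and> x \<approx> d2 \<and> x' \<approx> d3 \<and> x' \<approx> d4"
      have "V \<subseteq> insert v K \<union> {x, d1, d2} \<union> {x', d3, d4} \<union> {d5}" using V K d(1) by blast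
      moreover have "clique {d5}" using d(1) by (auto simp: in_far)
      moreover have "clique (insert v K)" using K vA vB by auto
      ultimately show False using no_clique_cover tri d x by blast
    qed
    have perm: "far v = {c2, c3, c4, c5, c1}" "far v = {c3, c4, c5, c1, c2}" "far v = {c4, c5, c1, c2, c3}" "far v = {c5, c1, c2, c3, c4}"
      using C by auto
    have KL: "A = A \<and> {b, b'} = {b, b'} \<and> {b, b'} = B \<or> A = B \<and> {b, b'} = {b, b'} \<and> {b, b'} = A"
      "A = A \<and> {b, b'} = {b', b} \<and> {b, b'} = B \<or> A = B \<and> {b, b'} = {b', b} \<and> {b, b'} = A"
      "B = A \<and> {a, a'} = {a, a'} \<and> {a, a'} = B \<or> B = B \<and> {a, a'} = {a, a'} \<and> {a, a'} = A"
      "B = A \<and> {a, a'} = {a', a} \<and> {a, a'} = B \<or> B = B \<and> {a, a'} = {a', a} \<and> {a, a'} = A"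
      using a b by auto
    show False
      by (rule pentagon_two_pairs[OF onceA(1)[OF cF(1)] onceA(1)[OF cF(2)] onceA(1)[OF cF(3)] onceA(1)[OF cF(4)] onceA(1)[OF cF(5)]
        onceA(2)[OF cF(1)] onceA(2)[OF cF(2)] onceA(2)[OF cF(3)] onceA(2)[OF cF(4)] onceA(2)[OF cF(5)]
        hits5[OF mem(1,3)] hits5[OF mem(1,4)] hits5[OF mem(2,3)] hits5[OF mem(2,4)]
        path[OF N(1)] path[OF N(2)] path[OF N(3)] path[OF N(4)]
        no[OF KL(3) C e(1,3)] no[OF KL(3) perm(1) e(2,4)] no[OF KL(3) perm(2) e(3,5)] no[OF KL(3) perm(3) e(4,1)] no[OF KL(3) perm(4) e(5,2)]
        no[OF KL(4) C e(1,3)] no[OF KL(4) perm(1) e(2,4)] no[OF KL(4) perm(2) e(3,5)] no[OF KL(4) perm(3) e(4,1)] no[OF KL(4) perm(4) e(5,2)]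
        no[OF KL(1) C e(1,3)] no[OF KL(1) perm(1) e(2,4)] no[OF KL(1) perm(2) e(3,5)] no[OF KL(1) perm(3) e(4,1)] no[OF KL(1) perm(4) e(5,2)]
        no[OF KL(2) C e(1,3)] no[OF KL(2) perm(1) e(2,4)] no[OF KL(2) perm(2) e(3,5)] no[OF KL(2) perm(3) e(4,1)] no[OF KL(2) perm(4) e(5,2)]])
  qed
qed

section \<open>Neighbourhoods consisting of three cliques\<close>

definition triple :: "'a \<Rightarrow> 'a set \<Rightarrow> 'a set \<Rightarrow> 'a set \<Rightarrow> bool" where
  "triple v A B C \<longleftrightarrow> v \<in> V \<and> nbh v = A \<union> B \<union> C \<and> clique A \<and> clique B \<and> clique C \<and>
    A \<noteq> {} \<and> B \<noteq> {} \<and> C \<noteq> {} \<and> (\<forall>x\<in>A. \<forall>y\<in>B \<union> C. \<not> x \<approx> y) \<and> (\<forall>x\<in>B. \<forall>y\<in>C. \<not> x \<approx> y)"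

lemma tripleD:
  assumes "triple v A B C"
  shows "v \<in> V" "nbh v = A \<union> B \<union> C" "clique A" "clique B" "clique C" "A \<noteq> {}" "B \<noteq> {}" "C \<noteq> {}"
    "\<And>x y. x \<in> A \<Longrightarrow> y \<in> B \<Longrightarrow> \<not> x \<approx> y" "\<And>x y. x \<in> A \<Longrightarrow> y \<in> C \<Longrightarrow> \<not> x \<approx> y"
    "\<And>x y. x \<in> B \<Longrightarrow> y \<in> C \<Longrightarrow> \<not> x \<approx> y"
  using assms unfolding triple_def by simp_all

lemma triple_rotate:
  assumes "triple v A B C" shows "triple v B C A"
proof -
  note T = tripleD[OF assms]
  have "\<not> y \<approx> x" if "x \<in> A" "y \<in> B \<union> C" for x y using T(9,10) that sym[of y x] by blast
  then show ?thesis using T(1-8,11) unfolding triple_def by auto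
qed

lemma triple_swap:
  assumes "triple v A B C" shows "triple v A C B"
proof -
  note T = tripleD[OF assms]
  have "\<not> y \<approx> x" if "x \<in> B" "y \<in> C" for x y using T(11) that sym[of y x] by blast
  then show ?thesis using T(1-10) unfolding triple_def by auto
qed

lemma triple_component:
  assumes t: "triple v A B C" and p: "p \<in> A"
  shows "A = {x \<in> nbh v. x \<approx> p}"
proof -
  have "\<not> x \<approx> p" if "x \<in> B \<union> C" for x using tripleD(9,10)[OF t p] that sym[of x p] by blast
  then show ?thesis using tripleD(2)[OF t] cliqueD[OF tripleD(3)[OF t] _ p] by auto
qed

lemma ex_triple:
  assumes p: "p \<in> nbh v"
  obtains B C where "triple v {x \<in> nbh v. x \<approx> p} B C"
proof -
  have v: "v \<in> V" using p in_V by (auto simp: in_nbh)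
  obtain a b c where abc: "a \<in> nbh v" "b \<in> nbh v" "c \<in> nbh v" and ne: "\<not> a \<approx> b" "\<not> a \<approx> c" "\<not> b \<approx> c"
    using claw_centre[OF v] .
  have ne': "\<not> b \<approx> a" "\<not> c \<approx> a" "\<not> c \<approx> b" using ne sym by blast+
  have V: "x \<in> V" if "x \<in> nbh v" for x using that nbh_subset by blast
  let ?K = "\<lambda>i. {x \<in> nbh v. x \<approx> i}"
  have K: "clique (?K i)" if "i \<in> nbh v" for i
  proof (rule cliqueI)
    fix x y assume "x \<in> ?K i" "y \<in> ?K i"
    then show "x \<approx> y" using nbh_trans[of x v i y] that sym[of y i] by blast
  qed
  have anti: "\<not> x \<approx> y" if "i \<in> nbh v" "j \<in> nbh v" "\<not> i \<approx> j" "x \<in> ?K i" "y \<in> ?K j" for i j x y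
  proof
    assume "x \<approx> y"
    then have "i \<approx> y" using nbh_trans[of i v x y] that sym[of x i] by blast
    then show False using nbh_trans[of i v y j] that by blast
  qed
  have cov: "x \<approx> a \<or> x \<approx> b \<or> x \<approx> c" if "x \<in> nbh v" for x
    using alpha[of x a b c] V that abc ne by blast
  have t: "triple v (?K a) (?K b) (?K c)"
    unfolding triple_def
  proof (intro conjI ballI)
    show "nbh v = ?K a \<union> ?K b \<union> ?K c" using cov by blast
    show "?K a \<noteq> {}" "?K b \<noteq> {}" "?K c \<noteq> {}" using abc refl V by blast+
    show "\<not> x \<approx> y" if "x \<in> ?K a" "y \<in> ?K b \<union> ?K c" for x y
      using that anti[OF abc(1,2) ne(1)] anti[OF abc(1,3) ne(2)] by blast
    show "\<not> x \<approx> y" if "x \<in> ?K b" "y \<in> ?K c" for x y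
      using anti[OF abc(2,3) ne(3) that] .
  qed (use v K abc in auto)
  have "p \<in> ?K a \<or> p \<in> ?K b \<or> p \<in> ?K c" using cov[OF p] p by blast
  then show thesis
  proof (elim disjE)
    assume "p \<in> ?K a" then show thesis using that t triple_component[OF t] by metis
  next
    assume p: "p \<in> ?K b" 
    have t': "triple v (?K b) (?K c) (?K a)" using t triple_rotate by blast
    then show thesis using that triple_component[OF t' p] by metis
  next
    assume p: "p \<in> ?K c" 
    have t': "triple v (?K c) (?K a) (?K b)" using t triple_rotate by blast
    then show thesis using that triple_component[OF t' p] by metis
  qed
qed

text \<open>By \<open>alpha\<close>, \<open>m\<close> cannot miss a vertex in each of the three
  cliques, and by \<open>far_unique\<close> a clique complete to \<open>m\<close> is a single
  vertex.\<close>

lemma far_adjacent: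
  assumes t: "triple v A B C" and m: "m \<in> far v"
  shows "(\<exists>a. A = {a} \<and> a \<approx> m) \<or> (\<exists>a. B = {a} \<and> a \<approx> m) \<or> (\<exists>a. C = {a} \<and> a \<approx> m)"
proof -
  note T = tripleD[OF t]
  have V: "A \<subseteq> V" "B \<subseteq> V" "C \<subseteq> V" "m \<in> V" using T(2) nbh_subset m by (auto simp: in_far)
  have "(\<forall>a\<in>A. a \<approx> m) \<or> (\<forall>a\<in>B. a \<approx> m) \<or> (\<forall>a\<in>C. a \<approx> m)"
  proof (rule ccontr)
    assume "\<not> ?thesis"
    then obtain a b c where "a \<in> A" "b \<in> B" "c \<in> C" "\<not> a \<approx> m" "\<not> b \<approx> m" "\<not> c \<approx> m" by blast
    then show False using alpha[of a b c m] T(9-11) V by blast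
  qed
  moreover have "\<exists>a. K = {a} \<and> a \<approx> m" if K: "\<forall>a\<in>K. a \<approx> m" "clique K" "K \<noteq> {}" "K \<subseteq> nbh v" for K
  proof -
    obtain a where a: "a \<in> K" using K(3) by auto
    have "x = a" if "x \<in> K" for x
      using far_unique[OF m, of x a] cliqueD[OF K(2) that a] that a K(1,4) by blast
    then show ?thesis using a K(1) by blast
  qed
  moreover have "A \<subseteq> nbh v" "B \<subseteq> nbh v" "C \<subseteq> nbh v" using T(2) by auto
  ultimately show ?thesis using T(3-8) by metis
qed

lemma triple_clique:
  assumes t: "triple v A B C"
  shows "clique (insert v A)" "clique (insert v B)" "clique (insert v C)"
  using tripleD(1-5)[OF t] by (auto intro!: clique_insert simp: in_nbh set_eq_iff)

lemma triple_cases: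
  assumes "triple v A B C" "x \<in> V"
  shows "x = v \<or> x \<in> A \<or> x \<in> B \<or> x \<in> C \<or> x \<in> far v"
  using V_cases[OF assms(2), of v] tripleD(2)[OF assms(1)] by blast

text \<open>A common neighbour of \<open>v\<close> and \<open>p\<close> would belong to the clique
  of \<open>p\<close> in the neighbourhood of \<open>v\<close>, which is \<open>{p}\<close>.\<close>

lemma triple_back:
  assumes t: "triple v {p} B C"
  obtains X Y where "triple p {v} X Y"
proof -
  have p: "p \<in> nbh v" using tripleD(2)[OF t] by auto
  then have v: "v \<in> nbh p" using sym by (auto simp: in_nbh)
  have "x = v" if "x \<in> nbh p" "x \<approx> v" for x
  proof (rule ccontr)
    assume "x \<noteq> v"
    then have "x \<in> {x \<in> nbh v. x \<approx> p}" using that by (auto simp: in_nbh)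
    then have "x = p" using triple_component[OF t] by auto
    then show False using that by (simp add: in_nbh)
  qed
  then have "{x \<in> nbh p. x \<approx> v} = {v}" using v refl in_V by (auto simp: in_nbh)
  then show thesis using ex_triple[OF v] that by metis
qed

text \<open>If only \<open>A\<close> is a singleton \<open>{p}\<close>, all nonneighbours of
  \<open>v\<close> are adjacent to \<open>p\<close>, and two cliques at \<open>v\<close> with two at
  \<open>p\<close> cover everything. By rotation, at least two of the three cliques are
  singletons.\<close>

lemma second_singleton:
  assumes t: "triple v A B C"
  shows "(\<exists>p. B = {p}) \<or> (\<exists>p. C = {p})"
proof (rule ccontr)
  assume n: "\<not> ?thesis"
  show False
  proof (cases "\<exists>p. A = {p}")
    case True
    then obtain p where A: "A = {p}" by auto
    then obtain X Y where T: "triple p {v} X Y" using triple_back t by metis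
    have "V \<subseteq> insert v B \<union> insert v C \<union> insert p X \<union> insert p Y"
    proof
      fix x assume x: "x \<in> V"
      have "x \<in> far v \<Longrightarrow> x \<in> X \<union> Y \<union> {p}"
        using far_adjacent[OF t, of x] n A triple_cases[OF T x] sym[of p x] refl[OF tripleD(1)[OF t]] by (auto simp: in_far)
      then show "x \<in> insert v B \<union> insert v C \<union> insert p X \<union> insert p Y"
        using triple_cases[OF t x] A by blast
    qed
    then show False using no_clique_cover triple_clique[OF t] triple_clique[OF T] by blast
  next
    case False
    then have "far v = {}" using far_adjacent[OF t] n by blast
    then have "V \<subseteq> insert v A \<union> insert v B \<union> insert v C \<union> {}" using triple_cases[OF t] by blast
    then show False using no_clique_cover triple_clique[OF t] clique_empty by blast
  qed
qed

lemma triple_back_singleton: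
  assumes t: "triple v {p} B C"
  obtains x X where "triple p {v} {x} X"
proof -
  obtain X Y where T: "triple p {v} X Y" using triple_back[OF t] .
  from second_singleton[OF T] show thesis using that T triple_swap[OF T] by blast
qed

text \<open>Otherwise every nonneighbour of \<open>v\<close> sees \<open>p\<close> or
  \<open>q\<close>. The cliques of \<open>v\<close> with \<open>C\<close>, \<open>p\<close> with
  \<open>X\<close> and \<open>q\<close> with \<open>Y\<close> leave only \<open>x\<close> and
  \<open>y\<close>, which are therefore nonadjacent. This makes \<open>X\<close> and
  \<open>Y\<close> single vertices adjacent to \<open>y\<close> and \<open>x\<close> respectively,
  and three edges replace the cliques at \<open>p\<close> and \<open>q\<close>.\<close>

lemma third_singleton:
  assumes t: "triple v {p} {q} C"
  shows "\<exists>w. C = {w}"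
proof (rule ccontr)
  assume C: "\<not> ?thesis"
  obtain x X where P: "triple p {v} {x} X" using triple_back_singleton[OF t] .
  obtain y Y where Q: "triple q {v} {y} Y" using triple_back_singleton[OF triple_swap[OF triple_rotate[OF t]]] .
  note TP = tripleD[OF P] and TQ = tripleD[OF Q] and T = tripleD[OF t]
  have vV: "v \<in> V" using T(1) .
  have far: "m \<in> far v" if "m \<in> {x} \<union> X \<or> m \<in> {y} \<union> Y" for m
  proof -
    have "\<not> v \<approx> m" using that TP(9)[of v m] TP(10)[of v m] TQ(9)[of v m] TQ(10)[of v m] by auto
    moreover have "m \<in> nbh p \<or> m \<in> nbh q" using that TP(2) TQ(2) by auto
    then have "m \<in> V" using nbh_subset by auto
    ultimately show ?thesis using sym[of m v] by (auto simp: in_far)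
  qed
  have cov: "m = v \<or> m \<in> C \<or> m = p \<or> m = q \<or> m = x \<or> m = y \<or> m \<in> X \<or> m \<in> Y" if m: "m \<in> V" for m
  proof (cases "m \<in> far v")
    case True
    then have "p \<approx> m \<or> q \<approx> m" using far_adjacent[OF t True] C by auto
    then show ?thesis using triple_cases[OF P m] triple_cases[OF Q m] sym[of p m] sym[of q m] by (auto simp: in_far)
  next
    case False
    then show ?thesis using triple_cases[OF t m] by blast
  qed
  have vC: "clique (insert v C)" and pX: "clique (insert p X)" and qY: "clique (insert q Y)"
    using triple_clique[OF t] triple_clique[OF P] triple_clique[OF Q] by auto
  have xyV: "x \<in> V" "y \<in> V" using far[of x] far[of y] by (auto simp: in_far)
  have four: False if "clique {x, y} \<or> x \<in> Y \<or> y \<in> X"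
  proof -
    have "\<exists>K. clique K \<and> V \<subseteq> insert v C \<union> insert p X \<union> insert q Y \<union> K"
      using that
    proof (elim disjE)
      assume "clique {x, y}" then show ?thesis using cov by (intro exI[of _ "{x, y}"]) blast
    next
      assume "x \<in> Y" then show ?thesis using cov xyV by (intro exI[of _ "{y}"]) auto
    next
      assume "y \<in> X" then show ?thesis using cov xyV by (intro exI[of _ "{x}"]) auto
    qed
    then show False using no_clique_cover vC pX qY by blast
  qed
  have "clique {x, y}" if "x \<approx> y \<or> y \<approx> x"
    using that sym[of x y] sym[of y x] refl xyV by (auto simp: clique_def)
  then have xy: "\<not> x \<approx> y" "\<not> y \<approx> x" using four by auto
  \<comment> \<open>Each \<open>t\<close> in \<open>X'\<close> sees \<open>y'\<close> because
    \<open>v\<close>, \<open>x'\<close>, \<open>y'\<close>, \<open>t\<close> are not independent;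
    two such vertices would be the axis of a diamond with tips \<open>y'\<close> and
    \<open>p'\<close>.\<close>
  have single: "\<exists>t. X' = {t} \<and> t \<approx> y'"
    if R: "triple p' {v} {x'} X'" and p': "p' \<in> nbh v" and y': "y' \<in> far v" "\<not> x' \<approx> y'" "\<not> y' \<approx> x'" "y' \<notin> X'" for p' x' X' y'
  proof -
    note TR = tripleD[OF R]
    have x'v: "\<not> v \<approx> x'" using TR(9)[of v x'] by simp
    have x'n: "x' \<in> nbh p'" using TR(2) by auto
    then have x'V: "x' \<in> V" using nbh_subset by auto
    have X: "t \<approx> y'" if "t \<in> X'" for t
    proof -
      have "\<not> v \<approx> t" "\<not> x' \<approx> t" using TR(10)[of v t] TR(11)[of x' t] that by simp_all
      moreover have "t \<in> nbh p'" using TR(2) that by auto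
      then have "t \<in> V" using nbh_subset by auto
      moreover have "\<not> v \<approx> y'" "y' \<in> V" using y'(1) sym[of v y'] by (auto simp: in_far)
      ultimately show ?thesis using alpha[of v x' y' t] x'v x'V vV y'(2) sym[of y' t] by blast
    qed
    obtain t where t: "t \<in> X'" using TR(8) by auto
    have "t' = t" if t': "t' \<in> X'" for t'
    proof (rule ccontr)
      assume "t' \<noteq> t"
      have "t \<in> nbh p'" "t' \<in> nbh p'" using TR(2) t t' by auto
      then have "p' \<approx> t" "p' \<approx> t'" "y' \<approx> t" "y' \<approx> t'" "t' \<approx> t"
        using t t' X cliqueD[OF TR(5)] sym by (auto simp: in_nbh)
      then have "y' \<approx> p'" using no_diamond[of t' t y' p'] \<open>t' \<noteq> t\<close> by blast
      moreover have "y' \<noteq> p'" using y'(1) p' by (auto simp: in_far in_nbh)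
      ultimately have "y' \<in> nbh p'" by (simp add: in_nbh)
      then have "y' \<in> {v} \<union> {x'} \<union> X'" unfolding TR(2) .
      moreover have "y' \<noteq> v" using y'(1) refl[OF vV] by (auto simp: in_far)
      moreover have "y' \<noteq> x'" using y'(2) refl[OF x'V] by auto
      ultimately show False using y'(4) by blast
    qed
    then show ?thesis using t X by blast
  qed
  have pqn: "p \<in> nbh v" "q \<in> nbh v" using T(2) by auto
  have xyf: "x \<in> far v" "y \<in> far v" "y \<notin> X" "x \<notin> Y" using far four by auto
  obtain a where a: "X = {a}" "a \<approx> y" using single[OF P pqn(1) xyf(2) xy xyf(3)] by auto
  obtain b where b: "Y = {b}" "b \<approx> x" using single[OF Q pqn(2) xyf(1) xy(2,1) xyf(4)] by auto
  have edge: "clique {u, w}" if "u \<approx> w" for u w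
    using that sym refl in_V[OF that] by (auto simp: clique_def)
  have "x \<in> nbh p" "b \<in> nbh q" using TP(2) TQ(2) b by auto
  then have "x \<approx> p" "b \<approx> q" by (auto simp: in_nbh)
  then have "clique {x, p}" "clique {a, y}" "clique {b, q}" using edge a by auto
  moreover have "V \<subseteq> insert v C \<union> {x, p} \<union> {a, y} \<union> {b, q}" using cov a b by blast
  ultimately show False using vC no_clique_cover by blast
qed

section \<open>The cubic triangle-free case\<close>

lemma cubic:
  assumes "v \<in> V"
  obtains p q w where "triple v {p} {q} {w}"
proof -
  note result = that
  obtain a where a: "a \<in> nbh v" using no_isolated_vertex[OF assms] by auto
  obtain B C where t: "triple v {x \<in> nbh v. x \<approx> a} B C" using ex_triple[OF a] .
  let ?A = "{x \<in> nbh v. x \<approx> a}"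
  have 1: thesis if T: "triple v X {p} Y" for X p Y
  proof -
    from second_singleton[OF triple_rotate[OF T]] show thesis
    proof (elim disjE exE)
      fix q assume "Y = {q}"
      then have T': "triple v {p} {q} X" using triple_rotate[OF T] by simp
      from third_singleton[OF T'] show thesis using result T' by blast
    next
      fix q assume "X = {q}"
      then have T': "triple v {q} {p} Y" using T by simp
      from third_singleton[OF T'] show thesis using result T' by blast
    qed
  qed
  from second_singleton[OF t] show thesis using 1 t triple_swap[OF t] by blast
qed

lemma triangle_free:
  assumes "x \<in> nbh u" "y \<in> nbh u" "x \<approx> y"
  shows "x = y"
proof -
  have "u \<in> V" using assms(1) in_V by (auto simp: in_nbh)
  then obtain p q w where t: "triple u {p} {q} {w}" by (rule cubic)
  have ne: "\<not> p \<approx> q" "\<not> p \<approx> w" "\<not> q \<approx> w" using tripleD(9-11)[OF t] by simp_all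
  then have "\<not> q \<approx> p" "\<not> w \<approx> p" "\<not> w \<approx> q" using sym[of q p] sym[of w p] sym[of w q] by auto
  moreover have "nbh u = {p} \<union> {q} \<union> {w}" by (rule tripleD(2)[OF t])
  then have "(x = p \<or> x = q \<or> x = w) \<and> (y = p \<or> y = q \<or> y = w)" using assms by auto
  ultimately show ?thesis using ne assms(3) by auto
qed

lemma degree_three:
  assumes "a \<in> nbh u" "b \<in> nbh u" "c \<in> nbh u" "d \<in> nbh u"
  shows "\<not> distinct [a, b, c, d]"
proof -
  have "u \<in> V" using assms in_V by (auto simp: in_nbh)
  then obtain p q w where t: "triple u {p} {q} {w}" by (rule cubic)
  have "nbh u = {p} \<union> {q} \<union> {w}" by (rule tripleD(2)[OF t])
  then have "set [a, b, c, d] \<subseteq> set [p, q, w]" using assms by auto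
  then have "card (set [a, b, c, d]) \<le> length [p, q, w]"
    by (meson List.finite_set card_length card_mono le_trans)
  moreover have "card (set [a, b, c, d]) = length [a, b, c, d]" if "distinct [a, b, c, d]"
    using that by (rule distinct_card)
  ultimately have "length [a, b, c, d] \<le> length [p, q, w]" if "distinct [a, b, c, d]"
    using that by (simp only:)
  then show ?thesis by auto
qed

text \<open>The set \<open>S\<close> holds the vertices at distance greater than one from both
  \<open>v\<close> and \<open>p\<close>, and each of them sees \<open>t1\<close> or
  \<open>t2\<close>. Small \<open>S\<close> admits explicit covers by edges. Two vertices of
  \<open>S\<close> at the same \<open>ti\<close> lead to exactly three vertices in \<open>S\<close>,
  which the degree bound refutes.\<close>

lemma critical_impossible: False
proof -
  have "V \<noteq> {}" using no_clique_cover[of "{}" "{}" "{}" "{}"] by auto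
  then obtain v where v: "v \<in> V" by auto
  obtain p q w where t: "triple v {p} {q} {w}" using cubic[OF v] .
  note T = tripleD[OF t]
  have edge: "clique {a, b}" if "a \<approx> b" for a b
    using that sym refl in_V[OF that] by (auto simp: clique_def)
  have N: "p \<in> nbh v" "q \<in> nbh v" "w \<in> nbh v" unfolding T(2) by simp_all
  have pV: "p \<in> V" "q \<in> V" "w \<in> V" using N nbh_subset by auto
  obtain t1 X where P1: "triple p {v} {t1} X" using triple_back_singleton[OF t] .
  then obtain t2 where P: "triple p {v} {t1} {t2}" using third_singleton by blast
  note TP = tripleD[OF P]
  have tn: "t1 \<in> nbh p" "t2 \<in> nbh p" unfolding TP(2) by simp_all
  have tne: "\<not> v \<approx> t1" "\<not> v \<approx> t2" "\<not> t1 \<approx> t2" using TP(9-11) by simp_all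
  then have far: "t1 \<in> far v" "t2 \<in> far v" "\<not> t1 \<approx> t2" "\<not> t2 \<approx> t1"
    using tn nbh_subset sym[of t1 v] sym[of t2 v] sym[of t2 t1] by (auto simp: in_far)
  have pf: "x \<noteq> p \<and> x \<noteq> q \<and> x \<noteq> w \<and> x \<noteq> v \<and> \<not> v \<approx> x \<and> x \<in> V" if "x \<in> far v" for x
    using that N v refl sym[of v x] by (auto simp: in_far in_nbh)
  define S where "S = far v - {t1, t2}"
  have St: "s \<approx> t1 \<or> s \<approx> t2" if "s \<in> S" for s
    using far_alpha[of s v t1 t2] that far v by (auto simp: S_def)
  have Sqw: "s \<approx> q \<or> s \<approx> w" if "s \<in> S" for s
  proof -
    have "s \<notin> nbh p" "s \<noteq> p" unfolding TP(2) using that pf[of s] by (auto simp: S_def)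
    then have "\<not> s \<approx> p" by (simp add: in_nbh)
    then show ?thesis using far_adjacent[OF t, of s] that sym[of p s] sym[of q s] sym[of w s] by (auto simp: S_def)
  qed
  have cov: "x \<in> {v, p, q, w, t1, t2} \<union> S" if "x \<in> V" for x
    using triple_cases[OF t that] by (auto simp: S_def)
  have e: "clique {v, q}" "clique {v, w}" "clique {p, t1}" "clique {p, t2}"
    using edge N tn sym by (auto simp: in_nbh)
  have one: False if "S \<subseteq> {s}" "s \<approx> t1 \<or> s \<approx> t2 \<or> S = {}" for s
  proof -
    have "clique {w}" using pV by simp
    from that(2) show False
    proof (elim disjE)
      assume "s \<approx> t1"
      moreover have "V \<subseteq> {s, t1} \<union> {p, t2} \<union> {v, q} \<union> {w}" using cov that(1) by blast
      ultimately show False using no_clique_cover e edge \<open>clique {w}\<close> by blast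
    next
      assume "s \<approx> t2"
      moreover have "V \<subseteq> {s, t2} \<union> {p, t1} \<union> {v, q} \<union> {w}" using cov that(1) by blast
      ultimately show False using no_clique_cover e edge \<open>clique {w}\<close> by blast
    next
      assume "S = {}"
      then have "V \<subseteq> {t1} \<union> {p, t2} \<union> {v, q} \<union> {w}" using cov by blast
      moreover have "clique {t1}" using pf[OF far(1)] by simp
      ultimately show False using no_clique_cover e \<open>clique {w}\<close> by blast
    qed
  qed
  have two: False if "S = {s, s'}" "s \<approx> t1" "s' \<approx> t2" for s s'
  proof -
    have "s' \<approx> q \<or> s' \<approx> w" using Sqw that(1) by blast
    then show False
    proof
      assume "s' \<approx> q"
      moreover have "V \<subseteq> {s, t1} \<union> {p, t2} \<union> {s', q} \<union> {v, w}" using cov that(1) by blast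
      ultimately show False using no_clique_cover e edge that(2) by blast
    next
      assume "s' \<approx> w"
      moreover have "V \<subseteq> {s, t1} \<union> {p, t2} \<union> {s', w} \<union> {v, q}" using cov that(1) by blast
      ultimately show False using no_clique_cover e edge that(2) by blast
    qed
  qed
  have main: False
    if ab: "a = t1 \<and> b = t2 \<or> a = t2 \<and> b = t1" and s: "s \<in> S" "s' \<in> S" "s \<noteq> s'" "s \<approx> a" "s' \<approx> a" "s \<approx> b" for a b s s'
  proof -
    have abS: "a \<notin> S" "b \<notin> S" "a \<in> nbh p" "b \<in> nbh p" "a \<noteq> b" "a \<in> far v" "b \<in> far v"
      using ab far tn refl pf by (auto simp: S_def)
    have SF: "x \<in> far v" "x \<noteq> a" "x \<noteq> b" if "x \<in> S" for x using that ab by (auto simp: S_def)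
    have pn: "p \<in> nbh a" "p \<in> nbh b" using abS sym by (auto simp: in_nbh)
    have sn: "s \<in> nbh a" "s' \<in> nbh a" "s \<in> nbh b" using s SF by (auto simp: in_nbh)
    have ss: "\<not> s \<approx> s'" using triangle_free[OF sn(1,2)] s(3) by blast
    obtain s'' where s'': "s'' \<in> S" "s'' \<noteq> s" "s'' \<noteq> s'"
    proof (rule ccontr)
      assume "\<not> thesis"
      then have "S = {s', s}" using that s by blast
      then show False using two[of s' s] two[of s s'] s ab by (auto simp: insert_commute)
    qed
    have ne: "p \<noteq> s" "p \<noteq> s'" "p \<noteq> s''" using pf SF s s'' by blast+
    have "\<not> s'' \<approx> a"
      using degree_three[of p a s s' s''] pn sn ne s s'' SF by (auto simp: in_nbh)
    then have sb: "s'' \<approx> b" using St[OF s''(1)] ab by auto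
    then have s''n: "s'' \<in> nbh b" using SF s'' by (auto simp: in_nbh)
    have ss'': "\<not> s \<approx> s''" using triangle_free[OF sn(3) s''n] s'' by blast
    have s's'': "s' \<approx> s''" using far_alpha[of s v s' s''] SF s s'' ss ss'' v by blast
    have S3: "x \<in> {s, s', s''}" if x: "x \<in> S" for x
    proof (rule ccontr)
      assume n: "x \<notin> {s, s', s''}"
      have "p \<noteq> x" using pf SF x by blast
      have "x \<approx> a \<or> x \<approx> b" using St[OF x] ab by auto
      then have "x \<in> nbh a \<or> x \<in> nbh b" using SF[OF x] by (auto simp: in_nbh)
      then show False
        using degree_three[of p a s s' x] degree_three[of p b s s'' x] pn sn s''n ne s s'' n \<open>p \<noteq> x\<close> by auto
    qed
    \<comment> \<open>The vertices \<open>a\<close> and \<open>b\<close> have already used up their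
      three neighbours, so the two neighbours of \<open>q\<close> other than \<open>v\<close>, and
      likewise those of \<open>w\<close>, lie among three vertices. The two pairs share a vertex
      \<open>z\<close>, which then has four neighbours.\<close>
    have nbrs: "\<exists>x y. x \<in> {s, s', s''} \<and> y \<in> {s, s', s''} \<and> x \<noteq> y \<and> x \<approx> u \<and> y \<approx> u"
      if u: "u = q \<or> u = w" for u
    proof -
      have tu: "\<exists>B C. triple v {u} B C" using u t triple_rotate by blast
      then obtain x Y where "triple u {v} {x} Y" using triple_back_singleton by blast
      then obtain y where U: "triple u {v} {x} {y}" using third_singleton by blast
      note TU = tripleD[OF U]
      have xyn: "x \<in> nbh u" "y \<in> nbh u" unfolding TU(2) by simp_all
      have xyV: "x \<in> V" "y \<in> V" using xyn nbh_subset by auto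
      have "\<not> v \<approx> x" "\<not> v \<approx> y" "\<not> x \<approx> y" using TU(9-11) by simp_all
      then have xy: "x \<in> far v" "y \<in> far v" "x \<noteq> y"
        using xyV sym[of x v] sym[of y v] refl[of x] by (auto simp: in_far)
      have "\<not> p \<approx> q" "\<not> p \<approx> w" using T(9,10) by simp_all
      then have un: "u \<noteq> p" using u refl[of p] pV by auto
      have uS: "u \<noteq> s" "u \<noteq> s'" "u \<noteq> s''" "u \<noteq> a" "u \<noteq> b" using pf SF s s'' abS(6,7) u by blast+
      have "\<not> u \<approx> a"
        using degree_three[of p a s s' u] pn sn ne s un uS by (auto simp: in_nbh)
      moreover have "\<not> u \<approx> b"
        using degree_three[of p b s s'' u] pn sn s''n ne s'' un uS by (auto simp: in_nbh)
      moreover have "u \<approx> x" "u \<approx> y" "x \<approx> u" "y \<approx> u" using xyn sym by (auto simp: in_nbh)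
      ultimately have "x \<in> S" "y \<in> S" using xy ab by (auto simp: S_def)
      then show ?thesis using S3 xy(3) \<open>x \<approx> u\<close> \<open>y \<approx> u\<close> by blast
    qed
    obtain x y where x: "x \<in> {s, s', s''}" "y \<in> {s, s', s''}" "x \<noteq> y" "x \<approx> q" "y \<approx> q" using nbrs[of q] by blast
    obtain x' y' where x': "x' \<in> {s, s', s''}" "y' \<in> {s, s', s''}" "x' \<noteq> y'" "x' \<approx> w" "y' \<approx> w" using nbrs[of w] by blast
    have "\<exists>z\<in>{s, s', s''}. z \<approx> q \<and> z \<approx> w" using x x' by auto
    then obtain z where z: "z \<in> {s, s', s''}" "z \<approx> q" "z \<approx> w" by blast
    have "\<not> q \<approx> w" using T(11) by simp
    then have qw: "q \<noteq> w" using refl[of q] pV by auto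
    have nq: "q \<noteq> y \<and> w \<noteq> y \<and> q \<noteq> a \<and> q \<noteq> b \<and> w \<noteq> a \<and> w \<noteq> b" if "y \<in> {s, s', s''}" for y
      using that pf SF s s'' abS(6,7) by blast
    have zn: "q \<in> nbh z" "w \<in> nbh z" using z nq[OF z(1)] sym by (auto simp: in_nbh)
    have "a \<approx> s" "b \<approx> s" "a \<approx> s'" "s'' \<approx> s'" "b \<approx> s''" using s sb s's'' sym by blast+
    then have "(z = s \<longrightarrow> a \<in> nbh z \<and> b \<in> nbh z) \<and> (z = s' \<longrightarrow> a \<in> nbh z \<and> s'' \<in> nbh z) \<and> (z = s'' \<longrightarrow> b \<in> nbh z \<and> s' \<in> nbh z)"
      using SF s s'' s's'' by (auto simp: in_nbh)
    then show False
      using z(1) zn qw nq abS(5) SF s s'' degree_three[of q z w a b] degree_three[of q z w a s''] degree_three[of q z w b s']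
      by auto
  qed
  have pair: False if ab: "a = t1 \<and> b = t2 \<or> a = t2 \<and> b = t1" and s: "s \<in> S" "s' \<in> S" "s \<noteq> s'" "s \<approx> a" "s' \<approx> a" for a b s s'
  proof -
    have F: "s \<in> far v" "s' \<in> far v" "b \<in> far v" using s far ab by (auto simp: S_def)
    have "s \<noteq> a" "s' \<noteq> a" using s ab by (auto simp: S_def)
    then have "\<not> s \<approx> s'" using triangle_free[of s a s'] s by (auto simp: in_nbh)
    then have "s \<approx> b \<or> s' \<approx> b" using far_alpha[of s v s' b] F v by blast
    then show False using main[OF ab s] main[OF ab s(2,1) s(3)[symmetric] s(5,4)] by blast
  qed
  show False
  proof (cases "S = {}")
    case True then show False using one[of v] by auto
  next
    case False
    show False
    proof (cases "(\<exists>s\<in>S. s \<approx> t1) \<and> (\<exists>s\<in>S. s \<approx> t2)")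
      case True
      then obtain s s' where s: "s \<in> S" "s \<approx> t1" "s' \<in> S" "s' \<approx> t2" by blast
      have "x = s \<or> x = s'" if x: "x \<in> S" for x
        using St[OF x] pair[of t1 t2 x s] pair[of t2 t1 x s'] x s by auto
      then have "S = {s, s'}" using s by blast
      then show False using two s by blast
    next
      case n: False
      obtain s where s: "s \<in> S" using False by auto
      have "x = s" if x: "x \<in> S" for x
        using St[OF x] St[OF s] pair[of t1 t2 x s] pair[of t2 t1 x s] x s n by blast
      then have "S \<subseteq> {s}" by blast
      then show False using one St[OF s] by blast
    qed
  qed
qed

end

section \<open>Colouring the graph\<close>

text \<open>A minimal uncovered subset \<open>W\<close> with the induced relation would be critical,
  since both forbidden configurations are hereditary.\<close>

lemma cogem_complement_covered:
  assumes "cogem_complement V adj"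
  shows "cogem_complement.covered adj V"
proof -
  interpret cogem_complement V adj by fact
  have "W \<subseteq> V \<Longrightarrow> covered W" if "finite W" for W
    using that
  proof (induction W rule: finite_psubset_induct)
    case (psubset W)
    show ?case
    proof (rule ccontr)
      assume ncov: "\<not> covered W"
      let ?adj = "\<lambda>x y. adj x y \<and> x \<in> W \<and> y \<in> W"
      interpret W: cogem_complement W ?adj
      proof
        show "?adj a c \<or> ?adj a d \<or> ?adj b d"
          if "?adj a e" "?adj b e" "?adj c e" "?adj d e" "?adj a b" "?adj b c" "?adj c d" for a b c d e
          using gem_free[of a e b c d] that by simp
        show "?adj a b \<or> ?adj a c \<or> ?adj a d \<or> ?adj b c \<or> ?adj b d \<or> ?adj c d"
          if "a \<in> W" "b \<in> W" "c \<in> W" "d \<in> W" for a b c d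
          using alpha[of a b c d] that psubset.prems by auto
      qed (use psubset.hyps psubset.prems refl sym in auto)
      have covered_eq: "W.covered U \<longleftrightarrow> covered U" if "U \<subseteq> W" for U
      proof -
        have "?adj x y \<longleftrightarrow> adj x y" if "x \<in> U" "y \<in> U" for x y using that \<open>U \<subseteq> W\<close> by auto
        then show ?thesis unfolding W.covered_def covered_def by simp
      qed
      interpret W: critical_cogem_complement W ?adj
      proof
        show "W.covered U" if "U \<subset> W" for U
          using psubset.IH[OF that] psubset.prems that covered_eq[of U] by auto
        show "\<not> W.covered W" using ncov covered_eq[of W] by simp
      qed
      show False by (rule W.critical_impossible)
    qed
  qed
  then show ?thesis using finite_V by blast
qed

lemma pair_wf_digraph_complete_graph: "pair_wf_digraph (complete_graph n)"
  by unfold_locales (auto simp: complete_graph_def)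

section \<open>From the graph to its complement\<close>

context
  fixes G :: "('a, 'b) pre_digraph"
  assumes graph: "graph G"
begin

interpretation graph G by (fact graph)

lemma symmetric_arcs: "u \<rightarrow>\<^bsub>G\<^esub> v \<Longrightarrow> v \<rightarrow>\<^bsub>G\<^esub> u"
  using sym_arcs by (auto simp: symmetric_def sym_def)

lemma no_K4:
  assumes free: "free_of G (complete_graph 4)"
    and v: "a \<in> verts G" "b \<in> verts G" "c \<in> verts G" "d \<in> verts G"
    and e: "a \<rightarrow>\<^bsub>G\<^esub> b" "a \<rightarrow>\<^bsub>G\<^esub> c" "a \<rightarrow>\<^bsub>G\<^esub> d" "b \<rightarrow>\<^bsub>G\<^esub> c" "b \<rightarrow>\<^bsub>G\<^esub> d" "c \<rightarrow>\<^bsub>G\<^esub> d"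
  shows False
proof -
  let ?f = "\<lambda>i. [a, b, c, d] ! i"
  have V: "pverts (complete_graph 4) = {0, 1, 2, 3}" by (auto simp: complete_graph_def)
  have ne: "a \<noteq> b" "a \<noteq> c" "a \<noteq> d" "b \<noteq> c" "b \<noteq> d" "c \<noteq> d" using e adj_not_same by auto
  have irrefl: "\<not> u \<rightarrow>\<^bsub>G\<^esub> u" for u using adj_not_same by auto
  have "inj_on ?f (pverts (complete_graph 4))" unfolding V using ne by (auto simp: inj_on_def)
  moreover have "?f ` pverts (complete_graph 4) \<subseteq> verts G" unfolding V using v by auto
  moreover have "\<forall>u\<in>pverts (complete_graph 4). \<forall>w\<in>pverts (complete_graph 4).
      (u, w) \<in> parcs (complete_graph 4) \<longleftrightarrow> ?f u \<rightarrow>\<^bsub>G\<^esub> ?f w"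
    unfolding V using e e[THEN symmetric_arcs] irrefl by (simp add: complete_graph_def)
  ultimately have "\<not> free_of G (complete_graph 4)"
    unfolding not_free_of_iff[OF nomulti_digraph_axioms pair_wf_digraph_complete_graph] by blast
  then show False using free by simp
qed

lemma no_co_gem:
  assumes free: "free_of G co_gem"
    and v: "a \<in> verts G" "b \<in> verts G" "c \<in> verts G" "d \<in> verts G" "e \<in> verts G"
    and ne: "a \<noteq> e" "b \<noteq> e" "c \<noteq> e" "d \<noteq> e"
    and arcs: "a \<rightarrow>\<^bsub>G\<^esub> b" "b \<rightarrow>\<^bsub>G\<^esub> c" "c \<rightarrow>\<^bsub>G\<^esub> d"
    and no: "\<not> a \<rightarrow>\<^bsub>G\<^esub> c" "\<not> a \<rightarrow>\<^bsub>G\<^esub> d" "\<not> b \<rightarrow>\<^bsub>G\<^esub> d" "\<not> a \<rightarrow>\<^bsub>G\<^esub> e" "\<not> b \<rightarrow>\<^bsub>G\<^esub> e" "\<not> c \<rightarrow>\<^bsub>G\<^esub> e" "\<not> d \<rightarrow>\<^bsub>G\<^esub> e"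
  shows False
proof -
  let ?f = "case_sum (\<lambda>i. [a, b, c, d] ! i) (\<lambda>_. e)"
  have V: "pverts co_gem = {Inl 0, Inl 1, Inl 2, Inl 3, Inr 0}"
    by (auto simp: co_gem_def disjoint_graph_union_def path_graph_def)
  have irrefl: "\<not> u \<rightarrow>\<^bsub>G\<^esub> u" for u using adj_not_same by auto
  have no': "\<not> c \<rightarrow>\<^bsub>G\<^esub> a" "\<not> d \<rightarrow>\<^bsub>G\<^esub> a" "\<not> d \<rightarrow>\<^bsub>G\<^esub> b" "\<not> e \<rightarrow>\<^bsub>G\<^esub> a" "\<not> e \<rightarrow>\<^bsub>G\<^esub> b" "\<not> e \<rightarrow>\<^bsub>G\<^esub> c" "\<not> e \<rightarrow>\<^bsub>G\<^esub> d"
    using no symmetric_arcs by blast+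
  have dist: "a \<noteq> b" "b \<noteq> c" "c \<noteq> d" "a \<noteq> c" "a \<noteq> d" "b \<noteq> d"
    using arcs no no' irrefl by auto
  have pair: "pair_wf_digraph co_gem"
    using pair_graph_co_gem by (simp add: pair_graph_def pair_pseudo_graph_def pair_fin_digraph_def)
  have arc_iff: "(Inl i, Inl j) \<in> parcs co_gem \<longleftrightarrow> i < 4 \<and> j < 4 \<and> (j = Suc i \<or> i = Suc j)"
    "(Inl i, Inr k) \<notin> parcs co_gem" "(Inr k, Inl i) \<notin> parcs co_gem" "(Inr k, Inr l) \<notin> parcs co_gem" for i j k l
    by (auto simp: co_gem_def disjoint_graph_union_def path_graph_def)
  have "inj_on ?f (pverts co_gem)" unfolding V using ne dist by (auto simp: inj_on_def)
  moreover have "?f ` pverts co_gem \<subseteq> verts G" unfolding V using v by auto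
  moreover have "\<forall>u\<in>pverts co_gem. \<forall>w\<in>pverts co_gem. (u, w) \<in> parcs co_gem \<longleftrightarrow> ?f u \<rightarrow>\<^bsub>G\<^esub> ?f w"
    unfolding V using arcs arcs[THEN symmetric_arcs] irrefl no no' by (simp add: arc_iff)
  ultimately have "\<not> free_of G co_gem"
    unfolding not_free_of_iff[OF nomulti_digraph_axioms pair] by blast
  then show False using free by simp
qed

text \<open>Looplessness makes the relation of having no arc reflexive, as the locale requires;
  \<open>K4\<close> turns into an independent set and the co-gem into a gem.\<close>

lemma cogem_complement_graph:
  assumes "free_of G co_gem" and "free_of G (complete_graph 4)"
  shows "cogem_complement (verts G) (\<lambda>x y. x \<in> verts G \<and> y \<in> verts G \<and> \<not> x \<rightarrow>\<^bsub>G\<^esub> y)"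
    (is "cogem_complement _ ?adj")
proof
  show "?adj x x" if "x \<in> verts G" for x using that adj_not_same by auto
  show "?adj y x" if "?adj x y" for x y using that symmetric_arcs by blast
  show "?adj a c \<or> ?adj a d \<or> ?adj b d"
    if H: "?adj a e" "?adj b e" "?adj c e" "?adj d e" "?adj a b" "?adj b c" "?adj c d" for a b c d e
  proof (rule ccontr)
    assume neg: "\<not> ?thesis"
    then have "a \<rightarrow>\<^bsub>G\<^esub> c" "a \<rightarrow>\<^bsub>G\<^esub> d" "b \<rightarrow>\<^bsub>G\<^esub> d" using H by auto
    moreover from this have "c \<rightarrow>\<^bsub>G\<^esub> a" "d \<rightarrow>\<^bsub>G\<^esub> b" by (auto intro: symmetric_arcs)
    moreover have "\<not> c \<rightarrow>\<^bsub>G\<^esub> b" "\<not> a \<rightarrow>\<^bsub>G\<^esub> b" using H symmetric_arcs by blast+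
    moreover have "a \<noteq> e" "b \<noteq> e" "c \<noteq> e" "d \<noteq> e" using H calculation by auto
    \<comment> \<open>The vertices are reordered because the complement of the path
      \<open>a b c d\<close> is the path \<open>c a d b\<close>.\<close>
    ultimately show False using no_co_gem[OF assms(1), of c a d b e] H by blast
  qed
  show "?adj a b \<or> ?adj a c \<or> ?adj a d \<or> ?adj b c \<or> ?adj b d \<or> ?adj c d"
    if "a \<in> verts G" "b \<in> verts G" "c \<in> verts G" "d \<in> verts G" for a b c d
    using no_K4[OF assms(2) that] that by blast
qed auto

end

theorem corollary5p2:
  fixes G :: "('a, 'b) pre_digraph"
  assumes "graph G"
    and "free_of G co_gem"
    and "free_of G (complete_graph 4)"
  shows "colourable 4 G"
proof -
  interpret graph G by fact
  let ?adj = "\<lambda>x y. x \<in> verts G \<and> y \<in> verts G \<and> \<not> x \<rightarrow>\<^bsub>G\<^esub> y"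
  interpret H: cogem_complement "verts G" ?adj by (rule cogem_complement_graph[OF assms])
  have "H.covered (verts G)" by (rule cogem_complement_covered[OF H.cogem_complement_axioms])
  then obtain g :: "'a \<Rightarrow> nat" where g: "\<forall>x\<in>verts G. g x < 4" "\<forall>x\<in>verts G. \<forall>y\<in>verts G. g x = g y \<longrightarrow> ?adj x y"
    unfolding H.covered_def by blast
  have "(\<lambda>x. Suc (g x)) ` verts G \<subseteq> {1..4}" using g(1) by auto
  moreover have "Suc (g u) \<noteq> Suc (g v)" if "u \<rightarrow>\<^bsub>G\<^esub> v" for u v
  proof -
    have "u \<in> verts G" "v \<in> verts G" using that by (auto dest: adj_in_verts)
    then show ?thesis using g(2) that by auto
  qed
  ultimately show ?thesis unfolding colourable_def by (intro exI[of _ "\<lambda>x. Suc (g x)"]) blast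
qed

end
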